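(* For every smooth real hypersurface $M\subset\mathbb{C}^n$ and every point $p\in M$ of Levi rank $q$ there exist local holomorphic coordinates $(w,z)=(w,z_2,z_3)\in\mathbb{C}\times\mathbb{C}^q\times\mathbb{C}^{n-q-1}$ vanishing at $p$, in which $M$ takes the form $$w+\bar w=\phi(z,\bar z,i(w-\bar w)),\qquad \phi(z,\bar z,u)=\phi^2(z,\bar z,u)+\phi^3(z,\bar z,u)+O(4),$$ where $$\phi^2(z,\bar z,u)=\sum_j\pm|z_{2j}|^2,\qquad \phi^3(z,\bar z,u)=2\,\mathrm{Re}\,\phi^{21}(z,\bar z_3)+\phi^{111}(z_3,\bar z_3,u),$$ with $$\phi^{21}=\sum a_{j_1j_2j_3}z_{2j_1}z_{2j_2}\bar z_{3j_3}+\sum b_{j_1j_2j_3}z_{2j_1}z_{3j_2}\bar z_{3j_3}+\sum c_{j_1j_2j_3}z_{3j_1}z_{3j_2}\bar z_{3j_3}$$ for some complex coefficients $a_{j_1j_2j_3},b_{j_1j_2j_3},c_{j_1j_2j_3}$, and $$\phi^{111}=\sum_j\varepsilon_j|z_{3j}|^2u,\qquad\varepsilon_j\in\{-1,0,1\},$$ and $O(4)$ stands for terms of total order at least $4$ in $(z,\bar z,u)$.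
   Context: $z_2=(z_{21},\dots,z_{2q})$ and $z_3=(z_{31},\dots,z_{3,n-q-1})$ denote coordinate vectors with their components. The Levi rank of $M$ at $p$ is the rank of the Levi form of $M$ at $p$. Everything is $C^\infty$; no pseudoconvexity is assumed. *)

theory Defs
  imports "HOL-Analysis.Analysis" "HOL-Library.Landau_Symbols"
begin

text \<open>\<open>Ck_on k S f\<close>: \<open>f\<close> has continuous iterated directional derivatives up to order \<open>k\<close>
  on \<open>S\<close>; it is only used for open \<open>S\<close>.\<close>

primrec Ck_on ::
  "nat \<Rightarrow> 'a::real_normed_vector set \<Rightarrow> ('a \<Rightarrow> 'b::real_normed_vector) \<Rightarrow> bool" where
  "Ck_on 0 S f \<longleftrightarrow> continuous_on S f"
| "Ck_on (Suc k) S f \<longleftrightarrow>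
     (\<forall>x\<in>S. f differentiable (at x)) \<and>
     (\<forall>v. Ck_on k S (\<lambda>x. frechet_derivative f (at x) v))"

definition smooth_on ::
  "'a::real_normed_vector set \<Rightarrow> ('a \<Rightarrow> 'b::real_normed_vector) \<Rightarrow> bool" where
  "smooth_on S f \<longleftrightarrow> (\<forall>k. Ck_on k S f)"

definition local_defining_function ::
  "(complex^'n) set \<Rightarrow> complex^'n \<Rightarrow> (complex^'n) set \<Rightarrow> (complex^'n \<Rightarrow> real) \<Rightarrow> bool" where
  "local_defining_function M p U \<rho> \<longleftrightarrow>
     open U \<and> p \<in> U \<and> smooth_on U \<rho> \<and>
     (\<forall>x\<in>U. frechet_derivative \<rho> (at x) \<noteq> (\<lambda>v. 0)) \<and>
     M \<inter> U = {x\<in>U. \<rho> x = 0}"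

definition smooth_real_hypersurface :: "(complex^'n) set \<Rightarrow> bool" where
  "smooth_real_hypersurface M \<longleftrightarrow> (\<forall>p\<in>M. \<exists>U \<rho>. local_defining_function M p U \<rho>)"

text \<open>The Wirtinger derivatives \<open>\<partial>/\<partial>z\<^sub>i = (\<partial>/\<partial>x\<^sub>i - \<i> \<partial>/\<partial>y\<^sub>i)/2\<close> and
  \<open>\<partial>/\<partial>\<bar>z\<^sub>i = (\<partial>/\<partial>x\<^sub>i + \<i> \<partial>/\<partial>y\<^sub>i)/2\<close>.\<close>

definition wirtinger :: "'n::finite \<Rightarrow> (complex^'n \<Rightarrow> complex) \<Rightarrow> complex^'n \<Rightarrow> complex" where
  "wirtinger i f x =
     (frechet_derivative f (at x) (axis i 1) - \<i> * frechet_derivative f (at x) (axis i \<i>)) / 2"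

definition wirtinger_bar :: "'n::finite \<Rightarrow> (complex^'n \<Rightarrow> complex) \<Rightarrow> complex^'n \<Rightarrow> complex" where
  "wirtinger_bar i f x =
     (frechet_derivative f (at x) (axis i 1) + \<i> * frechet_derivative f (at x) (axis i \<i>)) / 2"

text \<open>The holomorphic tangent space at \<open>p\<close> of a hypersurface with defining function \<open>\<rho>\<close>,
  with \<open>\<Sum>\<^sub>i v\<^sub>i \<partial>/\<partial>z\<^sub>i\<close> identified with \<open>v\<close>.\<close>

definition holomorphic_tangent_space :: "(complex^'n \<Rightarrow> real) \<Rightarrow> complex^'n \<Rightarrow> (complex^'n) set" where
  "holomorphic_tangent_space \<rho> p =
     {v. (\<Sum>i\<in>UNIV. wirtinger i (\<lambda>x. complex_of_real (\<rho> x)) p * v $ i) = 0}"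

definition levi_form ::
  "(complex^'n \<Rightarrow> real) \<Rightarrow> complex^'n \<Rightarrow> complex^'n \<Rightarrow> complex^'n \<Rightarrow> complex" where
  "levi_form \<rho> p v v' =
     (\<Sum>i\<in>UNIV. \<Sum>j\<in>UNIV.
        wirtinger i (wirtinger_bar j (\<lambda>x. complex_of_real (\<rho> x))) p * v $ i * cnj (v' $ j))"

text \<open>Rank over the complex numbers of a sesquilinear form \<open>L\<close> on a complex subspace \<open>H\<close>: the
  dimension of \<open>H\<close> minus that of the radical.\<close>

definition form_rank ::
  "(complex^'n) set \<Rightarrow> (complex^'n \<Rightarrow> complex^'n \<Rightarrow> complex) \<Rightarrow> nat" where
  "form_rank H L = vec.dim H - vec.dim {v\<in>H. \<forall>v'\<in>H. L v v' = 0}"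

text \<open>A change of defining function multiplies the Levi form on the holomorphic tangent space by
  a nonzero real number, so \<open>q\<close> does not depend on the choice of \<open>\<rho>\<close>.\<close>

definition has_levi_rank :: "(complex^'n) set \<Rightarrow> complex^'n \<Rightarrow> nat \<Rightarrow> bool" where
  "has_levi_rank M p q \<longleftrightarrow>
     (\<exists>U \<rho>. local_defining_function M p U \<rho> \<and>
        form_rank (holomorphic_tangent_space \<rho> p) (levi_form \<rho> p) = q)"

definition holomorphic_map_on ::
  "(complex^'n) set \<Rightarrow> (complex^'n \<Rightarrow> complex^'m) \<Rightarrow> bool" where
  "holomorphic_map_on V f \<longleftrightarrow>
     (\<forall>x\<in>V. \<exists>f'. (f has_derivative f') (at x) \<and> Vector_Spaces.linear (*s) (*s) f')"

text \<open>\<open>Z\<close> is a system of holomorphic coordinates on \<open>V\<close>, vanishing at \<open>p\<close>.\<close>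

definition holomorphic_coordinates_at ::
  "complex^'n \<Rightarrow> (complex^'n) set \<Rightarrow> (complex^'n \<Rightarrow> complex^'n) \<Rightarrow> bool" where
  "holomorphic_coordinates_at p V Z \<longleftrightarrow>
     open V \<and> p \<in> V \<and> Z p = 0 \<and> inj_on Z V \<and> open (Z ` V) \<and>
     holomorphic_map_on V Z \<and> holomorphic_map_on (Z ` V) (inv_into V Z)"

text \<open>The splitting \<open>(w, z\<^sub>2, z\<^sub>3)\<close> of the coordinates is a partition of the index type into the
  index \<open>k\<close> of \<open>w\<close>, the \<open>q\<close> indices \<open>J\<^sub>2\<close> of \<open>z\<^sub>2\<close> and the remaining indices \<open>J\<^sub>3\<close> of \<open>z\<^sub>3\<close>.\<close>

definition coordinate_splitting :: "nat \<Rightarrow> 'n::finite \<Rightarrow> 'n set \<Rightarrow> 'n set \<Rightarrow> bool" where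
  "coordinate_splitting q k J\<^sub>2 J\<^sub>3 \<longleftrightarrow>
     k \<notin> J\<^sub>2 \<and> k \<notin> J\<^sub>3 \<and> J\<^sub>2 \<inter> J\<^sub>3 = {} \<and> insert k (J\<^sub>2 \<union> J\<^sub>3) = UNIV \<and>
     card J\<^sub>2 = q \<and> card J\<^sub>3 = CARD('n) - q - 1"

text \<open>The vector \<open>z\<close> of the coordinates other than \<open>w\<close>. Index types are nonempty, so the space of
  these vectors (a point if the ambient dimension is 1) is represented by the hyperplane on which
  the component with index \<open>k\<close> vanishes.\<close>

definition z_part :: "'n::finite \<Rightarrow> complex^'n \<Rightarrow> complex^'n" where
  "z_part k \<zeta> = (\<chi> i. if i = k then 0 else \<zeta> $ i)"

text \<open>\<open>\<i>(w - \<bar>w)\<close>, which is real.\<close>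

definition u_part :: "'n::finite \<Rightarrow> complex^'n \<Rightarrow> real" where
  "u_part k \<zeta> = Re (\<i> * (\<zeta> $ k - cnj (\<zeta> $ k)))"

definition phi2 :: "'n::finite set \<Rightarrow> ('n \<Rightarrow> real) \<Rightarrow> complex^'n \<Rightarrow> real" where
  "phi2 J\<^sub>2 s z = (\<Sum>j\<in>J\<^sub>2. s j * (cmod (z $ j))\<^sup>2)"

definition phi21 ::
  "'n::finite set \<Rightarrow> 'n set \<Rightarrow> ('n \<Rightarrow> 'n \<Rightarrow> 'n \<Rightarrow> complex) \<Rightarrow> ('n \<Rightarrow> 'n \<Rightarrow> 'n \<Rightarrow> complex) \<Rightarrow>
   ('n \<Rightarrow> 'n \<Rightarrow> 'n \<Rightarrow> complex) \<Rightarrow> complex^'n \<Rightarrow> complex" where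
  "phi21 J\<^sub>2 J\<^sub>3 a b c z =
     (\<Sum>j1\<in>J\<^sub>2. \<Sum>j2\<in>J\<^sub>2. \<Sum>j3\<in>J\<^sub>3. a j1 j2 j3 * z $ j1 * z $ j2 * cnj (z $ j3)) +
     (\<Sum>j1\<in>J\<^sub>2. \<Sum>j2\<in>J\<^sub>3. \<Sum>j3\<in>J\<^sub>3. b j1 j2 j3 * z $ j1 * z $ j2 * cnj (z $ j3)) +
     (\<Sum>j1\<in>J\<^sub>3. \<Sum>j2\<in>J\<^sub>3. \<Sum>j3\<in>J\<^sub>3. c j1 j2 j3 * z $ j1 * z $ j2 * cnj (z $ j3))"

definition phi111 :: "'n::finite set \<Rightarrow> ('n \<Rightarrow> real) \<Rightarrow> complex^'n \<Rightarrow> real \<Rightarrow> real" where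
  "phi111 J\<^sub>3 \<epsilon> z u = (\<Sum>j\<in>J\<^sub>3. \<epsilon> j * (cmod (z $ j))\<^sup>2 * u)"

end

theory Submission
  imports Defs
begin

text \<open>
  The theorem is a computation with the third-order Taylor polynomial of a defining function
  \<open>\<rho>\<close>, combined with two soft facts: a holomorphic change of coordinates may be chosen
  polynomial, and a hypersurface is unchanged when \<open>\<rho>\<close> is multiplied by a nonvanishing factor.

  Linear algebra puts the first two orders in shape (\<open>adapted_linear_coordinates\<close>): in suitable
  linear coordinates \<open>x\<close> centred at \<open>p\<close>, the differential of \<open>\<rho>\<close> is \<open>2 Re x\<^sub>k\<close> and the
  Hermitian part of its second-order term is \<open>h\<^sub>0 + 2 Re (x\<^sub>k \<bar>\<lambda>)\<close>, where
  \<open>h\<^sub>0 = \<Sum> \<plusminus>|x\<^sub>j|\<^sup>2\<close> runs over \<open>q\<close> indices and \<open>\<lambda>\<close> is a linear form. Thus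
    \<open>\<rho> = 2 Re x\<^sub>k + 2 Re \<alpha> + h\<^sub>0 + 2 Re (x\<^sub>k \<bar>\<lambda>) + 2 Re A + 2 Re B + O(4)\<close>
  with \<open>\<alpha>\<close>, \<open>A\<close>, \<open>B\<close> homogeneous of bidegrees (2,0), (3,0), (2,1). The central step,
  \<open>cubic_normal_form\<close>, writes the right-hand side as \<open>m(x) N(x + a(x)) + O(4)\<close>, where
    \<open>N = 2 Re w + h\<^sub>0 + 2 Re B'(z, \<bar>z\<^sub>3) + K(z\<^sub>3, \<bar>z\<^sub>3) u\<close>.
  The freedom is used as follows. The linear part \<open>2 Re \<lambda>\<close> of the factor \<open>m\<close> removes the terms
  \<open>x\<^sub>k \<bar>\<lambda>\<close>. The pluriharmonic terms \<open>2 Re \<alpha>\<close>, \<open>2 Re A\<close> go into the new coordinate \<open>w\<close>. A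
  term of type (2,1) containing some \<open>\<bar>z\<^sub>2\<^sub>j\<close> is removed by a quadratic change of \<open>z\<^sub>2\<^sub>j\<close>,
  because \<open>|z\<^sub>2\<^sub>j + Q|\<^sup>2 = |z\<^sub>2\<^sub>j|\<^sup>2 + 2 Re (Q \<bar>z\<^sub>2\<^sub>j) + O(4)\<close>. A term containing \<open>\<bar>w\<close> is
  removed by the quadratic part of \<open>m\<close>. There remain \<open>B'\<close> and terms \<open>w S(z, \<bar>z\<^sub>3)\<close>; the
  quadratic part of \<open>m\<close> absorbs the Hermitian part of \<open>S\<close>, and the anti-Hermitian part
  \<open>\<i>K\<close> contributes \<open>2 Re (\<i>w) K = u K\<close>. Finally a linear change of \<open>z\<^sub>3\<close> diagonalises \<open>K\<close>
  with entries in \<open>{-1, 0, 1}\<close> (\<open>diagonalize_block\<close>).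

  It is convenient to parametrise by a polynomial map: \<open>truncated_inverse\<close> supplies a polynomial
  \<open>F\<close> inverse to \<open>x + a(x)\<close> up to \<open>O(4)\<close>, so that \<open>\<rho> \<circ> \<Phi> = m (2 Re w - P(z, u)) + O(4)\<close>
  for a polynomial map \<open>\<Phi>\<close> with invertible derivative at 0, where \<open>P = 2 Re w - N\<close> is
  the desired cubic polynomial after diagonalisation. The coordinates are the local inverse of \<open>\<Phi>\<close>. The implicit function theorem gives
  \<open>\<phi>\<close>, and since \<open>\<rho> \<circ> \<Phi>\<close> is \<open>O(4)\<close> along the graph of \<open>P\<close> while it vanishes along the
  graph of \<open>\<phi>\<close>, transversality yields \<open>\<phi> - P = O(4)\<close> (\<open>hypersurface_graph\<close>).
\<close>

section \<open>Smooth maps\<close>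

text \<open>Openness of \<open>S\<close> is what makes this true: the derivatives in the definition of \<open>Ck_on\<close> are
  taken in the ambient space.\<close>

lemma Ck_on_cong:
  assumes "open S" and "\<And>x. x \<in> S \<Longrightarrow> f x = g x" and "Ck_on k S f"
  shows "Ck_on k S g"
  using assms(2,3)
proof (induction k arbitrary: f g)
  case 0
  then show ?case using continuous_on_cong by fastforce
next
  case (Suc k)
  have d: "frechet_derivative g (at x) = frechet_derivative f (at x)" if "x \<in> S" for x
    using frechet_derivative_transform_within_open[of f x S g] Suc.prems that assms(1) by auto
  have "g differentiable (at x)" if "x \<in> S" for x
  proof -
    have "(f has_derivative frechet_derivative f (at x)) (at x)"
      using Suc.prems(2) that by (simp add: frechet_derivative_works[symmetric])
    then have "(g has_derivative frechet_derivative f (at x)) (at x)"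
      by (rule has_derivative_transform_within_open[OF _ assms(1) that Suc.prems(1)])
    then show ?thesis by (rule differentiableI)
  qed
  moreover have "Ck_on k S (\<lambda>x. frechet_derivative g (at x) v)" for v
    by (rule Suc.IH[of "\<lambda>x. frechet_derivative f (at x) v"]) (use d Suc.prems in auto)
  ultimately show ?case by simp
qed

text \<open>In this form the derivative may be given by any formula; all closure properties below are
  inductions on \<open>k\<close> through this rule.\<close>

lemma Ck_on_SucI:
  assumes "open S" and "\<And>x. x \<in> S \<Longrightarrow> (f has_derivative f' x) (at x)"
    and "\<And>v. Ck_on k S (\<lambda>x. f' x v)"
  shows "Ck_on (Suc k) S f"
proof -
  have "f' x = frechet_derivative f (at x)" if "x \<in> S" for x
    using assms(2)[OF that] by (rule frechet_derivative_at)
  then have "Ck_on k S (\<lambda>x. frechet_derivative f (at x) v)" for v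
    by (intro Ck_on_cong[OF assms(1) _ assms(3)[of v]]) simp
  then show ?thesis using assms(2) by (auto simp: differentiable_def)
qed

lemma Ck_on_SucD:
  assumes "Ck_on (Suc k) S f"
  shows "Ck_on k S f"
  using assms
proof (induction k arbitrary: f)
  case 0
  then show ?case
    by (auto intro!: continuous_at_imp_continuous_on differentiable_imp_continuous_within)
next
  case (Suc k)
  then show ?case by (metis Ck_on.simps(2))
qed

lemma Ck_on_subset: "Ck_on k S f \<Longrightarrow> T \<subseteq> S \<Longrightarrow> Ck_on k T f"
  by (induction k arbitrary: f) (auto intro: continuous_on_subset)

lemma Ck_on_const: "Ck_on k S (\<lambda>x. c)"
  by (induction k arbitrary: c) auto

lemma Ck_on_bounded_linear: "open S \<Longrightarrow> bounded_linear f \<Longrightarrow> Ck_on k S f"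
proof (induction k)
  case (Suc k)
  then show ?case
    by (intro Ck_on_SucI[where f' = "\<lambda>x. f"]) (auto intro: Ck_on_const bounded_linear_imp_has_derivative)
qed (auto intro: linear_continuous_on)

lemma Ck_on_linear_compose:
  assumes "open S" "bounded_linear L"
  shows "Ck_on k S f \<Longrightarrow> Ck_on k S (\<lambda>x. L (f x))"
proof (induction k arbitrary: f)
  case 0
  then show ?case using assms by (auto intro: bounded_linear.continuous_on)
next
  case (Suc k)
  show ?case
  proof (rule Ck_on_SucI[OF assms(1)])
    show "((\<lambda>x. L (f x)) has_derivative (\<lambda>v. L (frechet_derivative f (at x) v))) (at x)" if "x \<in> S" for x
      using Suc.prems that by (intro bounded_linear.has_derivative[OF assms(2)]) (simp add: frechet_derivative_works[symmetric])
  qed (use Suc in auto)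
qed

lemma Ck_on_add:
  assumes "open S"
  shows "Ck_on k S f \<Longrightarrow> Ck_on k S g \<Longrightarrow> Ck_on k S (\<lambda>x. f x + g x)"
proof (induction k arbitrary: f g)
  case (Suc k)
  show ?case
  proof (rule Ck_on_SucI[OF assms(1)])
    show "((\<lambda>x. f x + g x) has_derivative (\<lambda>v. frechet_derivative f (at x) v + frechet_derivative g (at x) v)) (at x)"
      if "x \<in> S" for x
      using Suc.prems that by (intro has_derivative_add) (simp_all add: frechet_derivative_works[symmetric])
  qed (use Suc in auto)
qed (auto intro: continuous_intros)

lemma Ck_on_sum:
  assumes "open S" "\<And>i. i \<in> I \<Longrightarrow> Ck_on k S (f i)"
  shows "Ck_on k S (\<lambda>x. \<Sum>i\<in>I. f i x)"
  using assms(2)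
  by (induction I rule: infinite_finite_induct) (auto intro: Ck_on_const Ck_on_add assms(1))

lemma Ck_on_bilinear:
  assumes "open S" and bl: "bounded_bilinear B"
  shows "Ck_on k S f \<Longrightarrow> Ck_on k S g \<Longrightarrow> Ck_on k S (\<lambda>x. B (f x) (g x))"
proof (induction k arbitrary: f g)
  case 0
  then show ?case using bounded_bilinear.continuous_on[OF bl] by auto
next
  case (Suc k)
  show ?case
  proof (rule Ck_on_SucI[OF assms(1)])
    show "((\<lambda>x. B (f x) (g x)) has_derivative
       (\<lambda>v. B (f x) (frechet_derivative g (at x) v) + B (frechet_derivative f (at x) v) (g x))) (at x)"
      if "x \<in> S" for x
      using Suc.prems that by (intro bounded_bilinear.FDERIV[OF bl]) (simp_all add: frechet_derivative_works[symmetric])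
    show "Ck_on k S (\<lambda>x. B (f x) (frechet_derivative g (at x) v) + B (frechet_derivative f (at x) v) (g x))" for v
      by (intro Ck_on_add assms(1) Suc.IH) (use Suc.prems Ck_on_SucD in auto)
  qed
qed

lemma linear_eq_sum_Basis:
  fixes L :: "'a::euclidean_space \<Rightarrow> 'b::real_vector"
  assumes "linear L"
  shows "L x = (\<Sum>b\<in>Basis. (x \<bullet> b) *\<^sub>R L b)"
  by (subst euclidean_representation[of x, symmetric])
    (simp add: linear_sum[OF assms] linear_scale[OF assms])

text \<open>By the chain rule the derivative of \<open>g \<circ> f\<close> in direction \<open>v\<close> is \<open>Dg(f x)\<close> applied to a
  vector that itself depends on \<open>x\<close>. Expanding that vector in an orthonormal basis leaves only
  derivatives of \<open>g\<close> in fixed directions, to which the induction hypothesis applies.\<close>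

lemma Ck_on_compose:
  fixes f :: "'a::real_normed_vector \<Rightarrow> 'b::euclidean_space" and g :: "'b \<Rightarrow> 'c::real_normed_vector"
  assumes "open S" "open T" and ST: "\<And>x. x \<in> S \<Longrightarrow> f x \<in> T"
  shows "Ck_on k T g \<Longrightarrow> Ck_on k S f \<Longrightarrow> Ck_on k S (\<lambda>x. g (f x))"
proof (induction k arbitrary: g)
  case 0
  then show ?case using ST by (auto intro: continuous_on_compose2)
next
  case (Suc k)
  have lin: "linear (frechet_derivative g (at (f x)))" if "x \<in> S" for x
    using Suc.prems ST that by (auto intro: linear_frechet_derivative)
  show ?case
  proof (rule Ck_on_SucI[OF assms(1)])
    show "((\<lambda>x. g (f x)) has_derivative
       (\<lambda>v. \<Sum>b\<in>Basis. (frechet_derivative f (at x) v \<bullet> b) *\<^sub>R frechet_derivative g (at (f x)) b)) (at x)"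
      if "x \<in> S" for x
    proof -
      have "(g \<circ> f has_derivative frechet_derivative g (at (f x)) \<circ> frechet_derivative f (at x)) (at x)"
        using Suc.prems that ST by (intro diff_chain_at) (simp_all add: frechet_derivative_works[symmetric])
      then show ?thesis
        by (simp add: o_def linear_eq_sum_Basis[OF lin[OF that], symmetric])
    qed
    show "Ck_on k S (\<lambda>x. \<Sum>b\<in>Basis. (frechet_derivative f (at x) v \<bullet> b) *\<^sub>R frechet_derivative g (at (f x)) b)" for v
    proof (intro Ck_on_sum assms(1) Ck_on_bilinear[OF _ bounded_bilinear_scaleR])
      fix b :: 'b
      show "Ck_on k S (\<lambda>x. frechet_derivative f (at x) v \<bullet> b)"
        using Suc.prems by (intro Ck_on_linear_compose[OF assms(1) bounded_linear_inner_left]) simp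
      show "Ck_on k S (\<lambda>x. frechet_derivative g (at (f x)) b)"
        by (rule Suc.IH) (use Suc.prems Ck_on_SucD in auto)
    qed
  qed
qed

lemma Ck_on_inverse:
  fixes f :: "'a::real_normed_vector \<Rightarrow> real"
  assumes "open S" "\<And>x. x \<in> S \<Longrightarrow> f x \<noteq> 0"
  shows "Ck_on k S f \<Longrightarrow> Ck_on k S (\<lambda>x. inverse (f x))"
proof (induction k)
  case 0
  then show ?case using assms(2) by (auto intro: continuous_intros)
next
  case (Suc k)
  have inv: "Ck_on k S (\<lambda>x. inverse (f x))"
    using Suc Ck_on_SucD by blast
  show ?case
  proof (rule Ck_on_SucI[OF assms(1)])
    show "((\<lambda>x. inverse (f x)) has_derivative
       (\<lambda>v. - (inverse (f x) * frechet_derivative f (at x) v * inverse (f x)))) (at x)"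
      if "x \<in> S" for x
      using Suc.prems that by (intro Deriv.has_derivative_inverse assms(2)) (simp_all add: frechet_derivative_works[symmetric])
    show "Ck_on k S (\<lambda>x. - (inverse (f x) * frechet_derivative f (at x) v * inverse (f x)))" for v
      by (intro Ck_on_linear_compose[OF _ bounded_linear_minus[OF bounded_linear_ident]]
          Ck_on_bilinear[OF _ bounded_bilinear_mult] assms(1) inv) (use Suc.prems in auto)
  qed
qed

lemma smooth_on_differentiable: "smooth_on S f \<Longrightarrow> x \<in> S \<Longrightarrow> f differentiable (at x)"
  unfolding smooth_on_def using Ck_on.simps(2) by blast

lemma smooth_on_has_derivative:
  "smooth_on S f \<Longrightarrow> x \<in> S \<Longrightarrow> (f has_derivative frechet_derivative f (at x)) (at x)"
  by (simp add: smooth_on_differentiable frechet_derivative_works[symmetric])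

lemma smooth_on_frechet_derivative:
  "smooth_on S f \<Longrightarrow> smooth_on S (\<lambda>x. frechet_derivative f (at x) v)"
  unfolding smooth_on_def by (metis Ck_on.simps(2))

lemma smooth_on_continuous: "smooth_on S f \<Longrightarrow> continuous_on S f"
  unfolding smooth_on_def by (metis Ck_on.simps(1))

lemma smooth_on_subset: "smooth_on S f \<Longrightarrow> T \<subseteq> S \<Longrightarrow> smooth_on T f"
  by (auto simp: smooth_on_def intro: Ck_on_subset)

lemma smooth_on_const: "smooth_on S (\<lambda>x. c)"
  by (simp add: smooth_on_def Ck_on_const)

lemma smooth_on_bounded_linear: "open S \<Longrightarrow> bounded_linear f \<Longrightarrow> smooth_on S f"
  by (simp add: smooth_on_def Ck_on_bounded_linear)

lemma smooth_on_add: "open S \<Longrightarrow> smooth_on S f \<Longrightarrow> smooth_on S g \<Longrightarrow> smooth_on S (\<lambda>x. f x + g x)"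
  by (simp add: smooth_on_def Ck_on_add)

lemma smooth_on_sum:
  "open S \<Longrightarrow> (\<And>i. i \<in> I \<Longrightarrow> smooth_on S (f i)) \<Longrightarrow> smooth_on S (\<lambda>x. \<Sum>i\<in>I. f i x)"
  by (simp add: smooth_on_def Ck_on_sum)

lemma smooth_on_bilinear:
  "open S \<Longrightarrow> bounded_bilinear B \<Longrightarrow> smooth_on S f \<Longrightarrow> smooth_on S g \<Longrightarrow> smooth_on S (\<lambda>x. B (f x) (g x))"
  by (simp add: smooth_on_def Ck_on_bilinear)

lemma smooth_on_linear_compose:
  "open S \<Longrightarrow> bounded_linear L \<Longrightarrow> smooth_on S f \<Longrightarrow> smooth_on S (\<lambda>x. L (f x))"
  by (simp add: smooth_on_def Ck_on_linear_compose)

lemma smooth_on_compose: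
  fixes f :: "'a::real_normed_vector \<Rightarrow> 'b::euclidean_space" and g :: "'b \<Rightarrow> 'c::real_normed_vector"
  assumes "open S" "open T" "\<And>x. x \<in> S \<Longrightarrow> f x \<in> T" "smooth_on T g" "smooth_on S f"
  shows "smooth_on S (\<lambda>x. g (f x))"
  unfolding smooth_on_def
proof
  show "Ck_on k S (\<lambda>x. g (f x))" for k
    by (rule Ck_on_compose[OF assms(1,2,3)]) (use assms(4,5) in \<open>simp_all add: smooth_on_def\<close>)
qed

text \<open>The inverse function theorem in terms of \<open>frechet_derivative\<close>: directional derivatives that
  are continuous for each fixed direction give continuity in the operator norm, because the space
  is finite-dimensional.\<close>

lemma smooth_inverse_function:
  fixes f :: "'a::euclidean_space \<Rightarrow> 'a"
  assumes "open U" "smooth_on U f" "x0 \<in> U" and inj: "inj (frechet_derivative f (at x0))"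
  obtains U' V g where "open U'" "U' \<subseteq> U" "x0 \<in> U'" "open V" "f x0 \<in> V" "homeomorphism U' V f g"
    "\<And>y. y \<in> V \<Longrightarrow> (g has_derivative inv (frechet_derivative f (at (g y)))) (at y)"
    "\<And>y. y \<in> V \<Longrightarrow> bij (frechet_derivative f (at (g y)))"
proof -
  define f' where "f' x = Blinfun (frechet_derivative f (at x))" for x
  have f': "blinfun_apply (f' x) = frechet_derivative f (at x)" if "x \<in> U" for x
    unfolding f'_def
    using smooth_on_differentiable[OF assms(2) that]
    by (intro bounded_linear_Blinfun_apply)
      (simp add: linear_conv_bounded_linear[symmetric] linear_frechet_derivative)
  have der: "(f has_derivative blinfun_apply (f' x)) (at x)" if "x \<in> U" for x
    using smooth_on_differentiable[OF assms(2) that] that by (simp add: f' frechet_derivative_works[symmetric])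
  have cont: "continuous_on U f'"
  proof (rule continuous_on_blinfun_componentwise)
    fix i :: 'a
    have "continuous_on U (\<lambda>x. frechet_derivative f (at x) i)"
      by (intro smooth_on_continuous smooth_on_frechet_derivative assms(2))
    then show "continuous_on U (\<lambda>x. blinfun_apply (f' x) i)"
      by (rule continuous_on_cong[THEN iffD1, rotated 2]) (simp_all add: f')
  qed
  have lin: "linear (frechet_derivative f (at x0))"
    using smooth_on_differentiable[OF assms(2,3)] by (rule linear_frechet_derivative)
  obtain G where G: "linear G" "G \<circ> frechet_derivative f (at x0) = id"
    using linear_injective_left_inverse[OF lin inj] by auto
  define invf where "invf = Blinfun G"
  have "blinfun_apply invf = G"
    unfolding invf_def using G(1) by (intro bounded_linear_Blinfun_apply) (simp add: linear_conv_bounded_linear)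
  then have "invf o\<^sub>L f' x0 = id_blinfun"
    using G(2) assms(3) by (intro blinfun_eqI) (simp add: f' fun_eq_iff)
  from inverse_function_theorem[OF assms(1) der cont assms(3) this]
  obtain U' V g g' where *: "open U'" "U' \<subseteq> U" "x0 \<in> U'" "open V" "f x0 \<in> V" "homeomorphism U' V f g"
    "\<And>y. y \<in> V \<Longrightarrow> (g has_derivative (g' y)) (at y)"
    "\<And>y. y \<in> V \<Longrightarrow> g' y = inv (blinfun_apply (f'(g y)))"
    "\<And>y. y \<in> V \<Longrightarrow> bij (blinfun_apply (f'(g y)))" by blast
  have "g y \<in> U" if "y \<in> V" for y
    using *(2,6) that by (auto simp: homeomorphism_def)
  then have "\<And>y. y \<in> V \<Longrightarrow> blinfun_apply (f' (g y)) = frechet_derivative f (at (g y))"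
    by (rule f')
  then show ?thesis using that[OF *(1-6)] *(7-9) by simp
qed

text \<open>Differentiating \<open>R(y, \<phi>(y)) = 0\<close> expresses \<open>D\<phi>\<close> through the derivatives of \<open>R\<close> along the
  graph, so \<open>\<phi>\<close> is always one order smoother than already known.\<close>

lemma implicit_function_Ck:
  fixes R :: "'a::euclidean_space \<times> real \<Rightarrow> real"
  assumes "open W" "smooth_on W R" "open A"
    and W: "\<And>y. y \<in> A \<Longrightarrow> (y, \<phi> y) \<in> W"
    and zero: "\<And>y. y \<in> A \<Longrightarrow> R (y, \<phi> y) = 0"
    and ne: "\<And>y. y \<in> A \<Longrightarrow> frechet_derivative R (at (y, \<phi> y)) (0,1) \<noteq> 0"
    and diff: "\<And>y. y \<in> A \<Longrightarrow> \<phi> differentiable (at y)"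
  shows "Ck_on k A \<phi>"
proof (induction k)
  case 0
  then show ?case using diff
    by (auto intro!: continuous_at_imp_continuous_on differentiable_imp_continuous_within)
next
  case (Suc k)
  have graph: "Ck_on k A (\<lambda>y. (y, \<phi> y))"
  proof -
    have "Ck_on k A (\<lambda>y. (y, 0) + (0, \<phi> y))"
      by (intro Ck_on_add assms Ck_on_bounded_linear Ck_on_linear_compose[OF assms(3) _ Suc.IH]
          bounded_linear_Pair bounded_linear_ident bounded_linear_zero)
    then show ?thesis by simp
  qed
  have part: "Ck_on k A (\<lambda>y. frechet_derivative R (at (y, \<phi> y)) v)" for v
    by (rule Ck_on_compose[OF assms(3,1) _ _ graph])
      (use W smooth_on_frechet_derivative[OF assms(2)] in \<open>auto simp: smooth_on_def\<close>)
  show ?case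
  proof (rule Ck_on_SucI[OF assms(3)])
    fix y assume y: "y \<in> A"
    let ?D = "frechet_derivative R (at (y, \<phi> y))" and ?d = "frechet_derivative \<phi> (at y)"
    have D: "(R has_derivative ?D) (at (y, \<phi> y))"
      using smooth_on_differentiable[OF assms(2)] W y by (simp add: frechet_derivative_works[symmetric])
    have d: "(\<phi> has_derivative ?d) (at y)"
      using diff[OF y] by (simp add: frechet_derivative_works[symmetric])
    have "((R \<circ> (\<lambda>y. (y, \<phi> y))) has_derivative (?D \<circ> (\<lambda>v. (v, ?d v)))) (at y)"
      by (intro diff_chain_at has_derivative_Pair has_derivative_ident d D)
    then have "((\<lambda>y. R (y, \<phi> y)) has_derivative (\<lambda>v. ?D (v, ?d v))) (at y)"
      by (simp add: o_def)
    then have "((\<lambda>y. 0) has_derivative (\<lambda>v. ?D (v, ?d v))) (at y)"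
      by (rule has_derivative_transform_within_open[OF _ assms(3) y]) (simp add: zero)
    then have "(\<lambda>v. ?D (v, ?d v)) = (\<lambda>v. 0)"
      by (rule has_derivative_unique) simp
    then have D0: "?D (v, ?d v) = 0" for v by (rule fun_cong)
    have lin: "linear ?D" by (rule has_derivative_linear[OF D])
    have D1: "?D (v, ?d v) = ?D (v, 0) + ?d v * ?D (0, 1)" for v
      using linear_add[OF lin, of "(v,0)" "(0, ?d v)"] linear_scale[OF lin, of "?d v" "(0,1)"] by simp
    have "?d v = - (?D (v, 0) * inverse (?D (0, 1)))" for v
    proof -
      have "?d v * ?D (0, 1) = - ?D (v, 0)" using D0[of v] D1[of v] by linarith
      then show ?thesis using ne[OF y] by (simp add: field_simps)
    qed
    then have "?d = (\<lambda>v. - (?D (v, 0) * inverse (?D (0, 1))))" by (rule ext)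
    with d show "(\<phi> has_derivative (\<lambda>v. - (?D (v, 0) * inverse (?D (0, 1))))) (at y)" by simp
  next
    fix v :: 'a
    show "Ck_on k A (\<lambda>y. - (frechet_derivative R (at (y, \<phi> y)) (v, 0) *
                 inverse (frechet_derivative R (at (y, \<phi> y)) (0, 1))))"
      by (intro Ck_on_linear_compose[OF _ bounded_linear_minus[OF bounded_linear_ident]]
          Ck_on_bilinear[OF _ bounded_bilinear_mult] Ck_on_inverse assms(3) part ne)
  qed
qed

text \<open>The solution function is a component of the inverse of \<open>(y, x) \<mapsto> (y, R(y, x))\<close>. The last
  estimate is the mean value theorem, \<open>\<partial>R/\<partial>x\<close> being bounded below near the origin; it is what
  turns the size of \<open>R\<close> into the distance to the hypersurface.\<close>

lemma implicit_function:
  fixes R :: "'a::euclidean_space \<times> real \<Rightarrow> real"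
  assumes W: "open W" "smooth_on W R" "0 \<in> W" and R0: "R 0 = 0"
    and pos: "frechet_derivative R (at 0) (0, 1) > 0"
  obtains A \<delta> \<phi> C where "open A" "0 \<in> A" "\<delta> > 0" "smooth_on A \<phi>" "C > 0"
    "\<And>y x. y \<in> A \<Longrightarrow> \<bar>x\<bar> < \<delta> \<Longrightarrow> (y, x) \<in> W"
    "\<And>y. y \<in> A \<Longrightarrow> \<bar>\<phi> y\<bar> < \<delta>"
    "\<And>y x. y \<in> A \<Longrightarrow> \<bar>x\<bar> < \<delta> \<Longrightarrow> R (y, x) = 0 \<longleftrightarrow> x = \<phi> y"
    "\<And>y x. y \<in> A \<Longrightarrow> \<bar>x\<bar> < \<delta> \<Longrightarrow> \<bar>x - \<phi> y\<bar> \<le> C * \<bar>R (y, x)\<bar>"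
proof -
  let ?D = "\<lambda>v. frechet_derivative R (at v)"
  define c where "c = ?D 0 (0, 1)"
  define \<Psi> where "\<Psi> v = (fst v, R v)" for v
  have derR: "(R has_derivative ?D v) (at v)" if "v \<in> W" for v
    by (rule smooth_on_has_derivative[OF W(2) that])
  have der: "(\<Psi> has_derivative (\<lambda>h. (fst h, ?D v h))) (at v)" if "v \<in> W" for v
    unfolding \<Psi>_def
    by (intro has_derivative_Pair derR that bounded_linear_imp_has_derivative bounded_linear_fst)
  have "smooth_on W (\<lambda>v. (fst v, 0) + (0, R v))"
    by (intro smooth_on_add W smooth_on_bounded_linear
        smooth_on_linear_compose[OF W(1) bounded_linear_Pair[OF bounded_linear_zero bounded_linear_ident]]
        bounded_linear_Pair bounded_linear_fst bounded_linear_zero)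
  then have sm: "smooth_on W \<Psi>" by (simp add: \<Psi>_def[abs_def])
  have D\<Psi>: "frechet_derivative \<Psi> (at 0) = (\<lambda>h. (fst h, ?D 0 h))"
    using frechet_derivative_at[OF der[OF W(3)]] by simp
  have lin: "linear (?D 0)" by (rule has_derivative_linear[OF derR[OF W(3)]])
  have "inj (frechet_derivative \<Psi> (at 0))"
  proof (rule linear_injective_0[THEN iffD2])
    show "linear (frechet_derivative \<Psi> (at 0))"
      by (rule linear_frechet_derivative[OF smooth_on_differentiable[OF sm W(3)]])
    have "h = 0" if "fst h = 0" "?D 0 h = 0" for h
    proof -
      have "h = snd h *\<^sub>R (0, 1)" using that(1) by (cases h) simp
      then have "?D 0 h = snd h * c"
        using linear_scale[OF lin, of "snd h" "(0, 1)"] by (simp add: c_def)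
      with that pos have "snd h = 0" by (simp add: c_def)
      with that show ?thesis by (cases h) (simp add: zero_prod_def)
    qed
    then show "\<forall>h. frechet_derivative \<Psi> (at 0) h = 0 \<longrightarrow> h = 0"
      unfolding D\<Psi> by (simp add: zero_prod_def)
  qed
  with W(1) sm W(3) obtain U' V g where U': "open U'" "U' \<subseteq> W" "0 \<in> U'" and V: "open V" "\<Psi> 0 \<in> V"
    and hom: "homeomorphism U' V \<Psi> g"
    and dg: "\<And>y. y \<in> V \<Longrightarrow> (g has_derivative inv (frechet_derivative \<Psi> (at (g y)))) (at y)"
    by (rule smooth_inverse_function) blast
  have \<Psi>0: "\<Psi> 0 = (0, 0)" using R0 by (simp add: \<Psi>_def)
  have g0: "g (0, 0) = 0" using homeomorphism_apply1[OF hom U'(3)] \<Psi>0 by simp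
  define W1 where "W1 = {v \<in> W. ?D v (0,1) > c/2}"
  have "continuous_on W (\<lambda>v. ?D v (0,1))"
    by (intro smooth_on_continuous smooth_on_frechet_derivative W)
  from continuous_open_preimage[OF this W(1), of "{c/2<..}"]
  have W1: "open W1" by (simp add: W1_def vimage_def Int_def)
  have "0 \<in> W1" using pos W by (simp add: W1_def c_def)
  then have "open (U' \<inter> W1)" "(0, 0) \<in> U' \<inter> W1" using U' W1 by (auto simp: zero_prod_def)
  then obtain A1 B1 where AB: "open A1" "open B1" "0 \<in> A1" "0 \<in> B1" "A1 \<times> B1 \<subseteq> U' \<inter> W1"
    by (rule open_prod_elim) blast
  obtain \<delta> where \<delta>: "\<delta> > 0" "ball 0 \<delta> \<subseteq> B1" using AB(2,4) openE by blast
  have inW: "(y, x) \<in> U' \<inter> W1" if "y \<in> A1" "\<bar>x\<bar> < \<delta>" for y x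
    using that \<delta>(2) AB(5) by (auto simp: subset_iff)
  define \<phi> where "\<phi> y = snd (g (y, 0))" for y
  define V0 where "V0 = {y. (y, 0::real) \<in> V}"
  have V0: "open V0"
    unfolding V0_def using open_vimage[OF V(1), of "\<lambda>y. (y, 0)"] by (simp add: vimage_def continuous_intros)
  have d\<phi>: "\<phi> differentiable (at y)" if "y \<in> V0" for y
  proof -
    have "g differentiable (at (y, 0))"
      using dg[of "(y,0)"] that by (auto simp: V0_def differentiable_def)
    moreover have "(\<lambda>y. (y, 0::real)) differentiable (at y)"
      by (rule differentiableI[of _ "\<lambda>y. (y, 0)"]) (intro has_derivative_Pair has_derivative_ident has_derivative_const)
    ultimately have "(g \<circ> (\<lambda>y. (y, 0::real))) differentiable (at y)"
      by (intro differentiable_chain_at) auto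
    then obtain D where "((\<lambda>y. g (y, 0)) has_derivative D) (at y)"
      unfolding differentiable_def o_def by blast
    from bounded_linear.has_derivative[OF bounded_linear_snd this]
    have "(\<lambda>y. snd (g (y, 0))) differentiable (at y)"
      by (rule differentiableI)
    then show ?thesis by (simp add: \<phi>_def[abs_def])
  qed
  then have "continuous_on V0 \<phi>"
    by (intro continuous_at_imp_continuous_on ballI differentiable_imp_continuous_within)
  from continuous_open_preimage[OF this V0, of "{-\<delta><..<\<delta>}"]
  have "open (V0 \<inter> \<phi> -` {-\<delta><..<\<delta>})" by simp
  define A where "A = A1 \<inter> (V0 \<inter> \<phi> -` {-\<delta><..<\<delta>})"
  have A: "open A" unfolding A_def using AB(1) \<open>open (V0 \<inter> _)\<close> by (rule open_Int)
  have A0: "0 \<in> A" using AB(3) \<delta>(1) V(2) g0 by (simp add: A_def V0_def \<Psi>0 \<phi>_def)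
  have Ab: "y \<in> A1" "\<bar>\<phi> y\<bar> < \<delta>" if "y \<in> A" for y
    using that by (auto simp: A_def)
  have graph: "g (y, 0) = (y, \<phi> y)" "R (y, \<phi> y) = 0" if "y \<in> A" for y
  proof -
    have "(y, 0) \<in> V" using that by (simp add: A_def V0_def)
    then have "\<Psi> (g (y, 0)) = (y, 0)" by (rule homeomorphism_apply2[OF hom])
    then have *: "fst (g (y, 0)) = y" "R (g (y, 0)) = 0" by (simp_all add: \<Psi>_def)
    show g: "g (y, 0) = (y, \<phi> y)" using *(1) by (simp add: \<phi>_def prod_eq_iff)
    show "R (y, \<phi> y) = 0" using *(2) unfolding g .
  qed
  have iff: "R (y, x) = 0 \<longleftrightarrow> x = \<phi> y" if "y \<in> A" "\<bar>x\<bar> < \<delta>" for y x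
  proof
    assume "R (y, x) = 0"
    then have "\<Psi> (y, x) = (y, 0)" by (simp add: \<Psi>_def)
    moreover have "(y, x) \<in> U'" using inW[of y x] Ab that by blast
    ultimately have "g (y, 0) = (y, x)" using homeomorphism_apply1[OF hom, of "(y, x)"] by simp
    then show "x = \<phi> y" by (simp add: \<phi>_def)
  qed (use graph that in simp)
  have smooth: "smooth_on A \<phi>"
    unfolding smooth_on_def
  proof (intro allI implicit_function_Ck[OF W(1,2) A])
    fix y assume y: "y \<in> A"
    then have "(y, \<phi> y) \<in> W1" using inW[of y "\<phi> y"] Ab by blast
    then show "(y, \<phi> y) \<in> W" "?D (y, \<phi> y) (0, 1) \<noteq> 0"
      using pos by (auto simp: W1_def c_def)
    show "\<phi> differentiable (at y)" using d\<phi> y by (simp add: A_def)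
  qed (rule graph)
  have low: "c / 2 * (b - a) \<le> R (y, b) - R (y, a)" if "y \<in> A" "\<bar>a\<bar> < \<delta>" "\<bar>b\<bar> < \<delta>" "a < b" for y a b
  proof -
    have "((\<lambda>t. R (y, t)) has_real_derivative ?D (y, t) (0, 1)) (at t)" if "a \<le> t" "t \<le> b" for t
    proof -
      have "(y, t) \<in> W" using inW[of y t] Ab(1)[OF \<open>y \<in> A\<close>] that \<open>\<bar>a\<bar> < \<delta>\<close> \<open>\<bar>b\<bar> < \<delta>\<close>
        by (simp add: W1_def)
      then have D: "(R has_derivative ?D (y, t)) (at (y, t))" by (rule derR)
      have "((R \<circ> (\<lambda>t. (y, t))) has_derivative (?D (y, t) \<circ> (\<lambda>h. (0, h)))) (at t)"
        by (intro diff_chain_at has_derivative_Pair has_derivative_ident has_derivative_const D)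
      moreover have "?D (y, t) \<circ> (\<lambda>h. (0, h)) = (*) (?D (y, t) (0, 1))"
      proof
        fix h
        show "(?D (y, t) \<circ> (\<lambda>h. (0, h))) h = ?D (y, t) (0, 1) * h"
          using linear_scale[OF has_derivative_linear[OF D], of h "(0, 1)"] by simp
      qed
      ultimately show ?thesis unfolding has_field_derivative_def by (simp add: o_def)
    qed
    from MVT2[OF \<open>a < b\<close> this] obtain t where t: "a < t" "t < b" "R (y, b) - R (y, a) = (b - a) * ?D (y, t) (0, 1)"
      by blast
    have "(y, t) \<in> W1" using inW[of y t] Ab[OF \<open>y \<in> A\<close>] that t by auto
    then have "c / 2 \<le> ?D (y, t) (0, 1)" by (simp add: W1_def)
    with t(3) \<open>a < b\<close> show ?thesis by (simp add: mult.commute)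
  qed
  have bound: "\<bar>x - \<phi> y\<bar> \<le> 2 / c * \<bar>R (y, x)\<bar>" if "y \<in> A" "\<bar>x\<bar> < \<delta>" for x y
  proof -
    have "c / 2 * \<bar>x - \<phi> y\<bar> \<le> \<bar>R (y, x)\<bar>"
    proof (cases x "\<phi> y" rule: linorder_cases)
      case less
      then show ?thesis using low[of y x "\<phi> y"] that Ab(2)[of y] graph(2)[of y] by simp
    next
      case greater
      then show ?thesis using low[of y "\<phi> y" x] that Ab(2)[of y] graph(2)[of y] by simp
    qed simp
    moreover have "c > 0" using pos by (simp add: c_def)
    ultimately show ?thesis by (simp add: field_simps)
  qed
  show ?thesis
  proof (rule that[of A \<delta> \<phi> "2 / c"])
    show "0 < 2 / c" using pos by (simp add: c_def)
    show "(y, x) \<in> W" if "y \<in> A" "\<bar>x\<bar> < \<delta>" for y x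
      using inW[of y x] Ab that by (auto simp: W1_def)
  qed (fact A A0 \<delta>(1) smooth Ab iff bound)+
qed

section \<open>Homogeneous polynomials of a given bidegree\<close>

text \<open>Polynomials in \<open>x\<close> and \<open>\<bar>x\<close> that are homogeneous of degree \<open>m\<close> in \<open>x\<close> and of degree \<open>n\<close> in
  \<open>\<bar>x\<close>. Defining them by generation, and not by coefficients, makes all closure properties simple
  inductions; coefficients are recovered by \<open>bihom_factor\<close>.\<close>

inductive bihom :: "nat \<Rightarrow> nat \<Rightarrow> (complex^'n \<Rightarrow> complex) \<Rightarrow> bool" where
  const: "bihom 0 0 (\<lambda>x. c)"
| var: "bihom m n f \<Longrightarrow> bihom (Suc m) n (\<lambda>x. x $ i * f x)"
| cnj_var: "bihom m n f \<Longrightarrow> bihom m (Suc n) (\<lambda>x. cnj (x $ i) * f x)"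
| add: "bihom m n f \<Longrightarrow> bihom m n g \<Longrightarrow> bihom m n (\<lambda>x. f x + g x)"

lemma bihom_scale: "bihom m n f \<Longrightarrow> bihom m n (\<lambda>x. c * f x)"
proof (induction rule: bihom.induct)
  case (const d)
  then show ?case by (rule bihom.const)
next
  case (var m n f i)
  show ?case using bihom.var[OF var.IH, of i] by (simp add: mult_ac)
next
  case (cnj_var m n f i)
  show ?case using bihom.cnj_var[OF cnj_var.IH, of i] by (simp add: mult_ac)
next
  case (add m n f g)
  show ?case using bihom.add[OF add.IH] by (simp add: algebra_simps)
qed

lemma bihom_zero: "bihom m n (\<lambda>x. 0)"
proof (induction m)
  case 0
  show ?case
  proof (induction n)
    case (Suc n)
    show ?case using bihom.cnj_var[OF Suc] by simp
  qed (rule bihom.const)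
next
  case (Suc m)
  show ?case using bihom.var[OF Suc] by simp
qed

lemma bihom_mult: "bihom m n f \<Longrightarrow> bihom m' n' g \<Longrightarrow> bihom (m + m') (n + n') (\<lambda>x. f x * g x)"
proof (induction rule: bihom.induct)
  case (const d)
  then show ?case by (simp add: bihom_scale)
next
  case (var m n f i)
  show ?case using bihom.var[OF var.IH[OF var.prems], of i] by (simp add: mult_ac)
next
  case (cnj_var m n f i)
  show ?case using bihom.cnj_var[OF cnj_var.IH[OF cnj_var.prems], of i] by (simp add: mult_ac)
next
  case (add m n f h)
  show ?case using bihom.add[OF add.IH(1)[OF add.prems] add.IH(2)[OF add.prems]] by (simp add: algebra_simps)
qed

lemma bihom_cnj: "bihom m n f \<Longrightarrow> bihom n m (\<lambda>x. cnj (f x))"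
  by (induction rule: bihom.induct) (auto intro: bihom.intros)

lemma bihom_diff: "bihom m n f \<Longrightarrow> bihom m n g \<Longrightarrow> bihom m n (\<lambda>x. f x - g x)"
  using bihom.add[OF _ bihom_scale[of m n g "-1"]] by simp

lemma bihom_uminus: "bihom m n f \<Longrightarrow> bihom m n (\<lambda>x. - f x)"
  using bihom_scale[of m n f "-1"] by simp

lemma bihom_sum: "(\<And>i. i \<in> I \<Longrightarrow> bihom m n (f i)) \<Longrightarrow> bihom m n (\<lambda>x. \<Sum>i\<in>I. f i x)"
  by (induction I rule: infinite_finite_induct) (auto intro: bihom.add bihom_zero)

lemma bihom_coord: "bihom 1 0 (\<lambda>x. x $ i)"
  using bihom.var[OF bihom.const[of 1], of i] by simp

lemma bihom_cnj_coord: "bihom 0 1 (\<lambda>x. cnj (x $ i))"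
  using bihom.cnj_var[OF bihom.const[of 1], of i] by simp

lemma bihom_compose:
  assumes "\<And>i. bihom 1 0 (\<lambda>x. T x $ i)"
  shows "bihom m n f \<Longrightarrow> bihom m n (\<lambda>x. f (T x))"
proof (induction rule: bihom.induct)
  case (var m n f i)
  show ?case using bihom_mult[OF assms var.IH, of i] by simp
next
  case (cnj_var m n f i)
  show ?case using bihom_mult[OF bihom_cnj[OF assms] cnj_var.IH, of i] by simp
qed (auto intro: bihom.intros)

text \<open>Euler-type factorisation: this is how coefficients are extracted, one variable at a time.\<close>

lemma bihom_factor: "bihom M n f \<Longrightarrow> M = Suc m \<Longrightarrow> \<exists>g. (\<forall>i. bihom m n (g i)) \<and> f = (\<lambda>x. \<Sum>i\<in>UNIV. x $ i * g i x)"
proof (induction arbitrary: m rule: bihom.induct)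
  case (var m' n f i)
  have "(\<Sum>j\<in>UNIV. x $ j * (if j = i then f x else 0)) = x $ i * f x" for x
    by (simp add: if_distrib cong: if_cong)
  moreover have "bihom m n (\<lambda>x. if j = i then f x else 0)" for j
    using var bihom_zero by (cases "j = i") auto
  ultimately show ?case by (intro exI[of _ "\<lambda>j x. if j = i then f x else 0"]) auto
next
  case (cnj_var m' n f i)
  then obtain g where "\<forall>j. bihom m n (g j)" "f = (\<lambda>x. \<Sum>j\<in>UNIV. x $ j * g j x)" by blast
  then show ?case by (intro exI[of _ "\<lambda>j x. cnj (x $ i) * g j x"])
      (auto intro: bihom.cnj_var simp: sum_distrib_left mult.left_commute)
next
  case (add m' n f h)
  then obtain g g' where "\<forall>j. bihom m n (g j)" "f = (\<lambda>x. \<Sum>j\<in>UNIV. x $ j * g j x)"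
    "\<forall>j. bihom m n (g' j)" "h = (\<lambda>x. \<Sum>j\<in>UNIV. x $ j * g' j x)" by blast
  then show ?case by (intro exI[of _ "\<lambda>j x. g j x + g' j x"])
      (auto intro: bihom.add simp: algebra_simps sum.distrib)
qed simp

lemma bihom_cnj_factor:
  assumes "bihom m (Suc n) f"
  obtains g where "\<And>i. bihom m n (g i)" "\<And>x. f x = (\<Sum>i\<in>UNIV. cnj (x $ i) * g i x)"
proof -
  obtain g where g: "\<forall>i. bihom n m (g i)" "(\<lambda>x. cnj (f x)) = (\<lambda>x. \<Sum>i\<in>UNIV. x $ i * g i x)"
    using bihom_factor[OF bihom_cnj[OF assms] refl] by blast
  have "f x = (\<Sum>i\<in>UNIV. cnj (x $ i) * cnj (g i x))" for x
    using arg_cong[OF fun_cong[OF g(2), of x], of cnj] by simp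
  with that[of "\<lambda>i x. cnj (g i x)"] g(1) bihom_cnj show ?thesis by blast
qed

lemma bihom_0_const: "bihom m n f \<Longrightarrow> m = 0 \<Longrightarrow> n = 0 \<Longrightarrow> \<exists>c. f = (\<lambda>x. c)"
  by (induction rule: bihom.induct) auto

lemma bihom_linear_coeffs:
  assumes "bihom 1 0 f"
  obtains c where "\<And>x. f x = (\<Sum>i\<in>UNIV. c i * x $ i)"
proof -
  obtain g where g: "\<forall>i. bihom 0 0 (g i)" "f = (\<lambda>x. \<Sum>i\<in>UNIV. x $ i * g i x)"
    using bihom_factor[OF assms, of 0] by auto
  from g(1) have "\<forall>i. \<exists>c. g i = (\<lambda>x. c)" using bihom_0_const by blast
  then obtain c where "\<And>i. g i = (\<lambda>x. c i)" by metis
  with g(2) that[of c] show ?thesis by (simp add: mult.commute)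
qed

lemma bihom_quadratic_coeffs:
  assumes "bihom 2 0 f"
  obtains c where "\<And>x. f x = (\<Sum>i\<in>UNIV. \<Sum>j\<in>UNIV. c i j * x $ i * x $ j)"
proof -
  obtain g where g: "\<forall>i. bihom 1 0 (g i)" "f = (\<lambda>x. \<Sum>i\<in>UNIV. x $ i * g i x)"
    using bihom_factor[OF assms, of 1] by auto
  have "\<exists>c. \<forall>x. g i x = (\<Sum>j\<in>UNIV. c j * x $ j)" for i
    using bihom_linear_coeffs[OF g(1)[rule_format]] by metis
  then obtain c where "\<And>i x. g i x = (\<Sum>j\<in>UNIV. c i j * x $ j)" by metis
  with g(2) that[of c] show ?thesis by (simp add: sum_distrib_left mult_ac)
qed

lemma bihom_bound: "bihom m n f \<Longrightarrow> \<exists>C\<ge>0. \<forall>x. norm (f x) \<le> C * norm x ^ (m + n)"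
proof (induction rule: bihom.induct)
  case (const c)
  show ?case by (intro exI[of _ "norm c"]) simp
next
  case (var m n f i)
  then obtain C where C: "C \<ge> 0" "\<And>x. norm (f x) \<le> C * norm x ^ (m + n)" by blast
  have "norm (x $ i * f x) \<le> norm x * (C * norm x ^ (m + n))" for x
    unfolding norm_mult by (intro mult_mono C(2) Finite_Cartesian_Product.norm_nth_le) auto
  with C(1) show ?case by (intro exI[of _ C]) (auto simp: mult_ac)
next
  case (cnj_var m n f i)
  then obtain C where C: "C \<ge> 0" "\<And>x. norm (f x) \<le> C * norm x ^ (m + n)" by blast
  have "norm (cnj (x $ i) * f x) \<le> norm x * (C * norm x ^ (m + n))" for x
    unfolding norm_mult complex_mod_cnj by (intro mult_mono C(2) Finite_Cartesian_Product.norm_nth_le) auto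
  with C(1) show ?case by (intro exI[of _ C]) (auto simp: mult_ac)
next
  case (add m n f g)
  then obtain C D where C: "C \<ge> 0" "\<And>x. norm (f x) \<le> C * norm x ^ (m + n)"
    and D: "D \<ge> 0" "\<And>x. norm (g x) \<le> D * norm x ^ (m + n)" by blast
  have "norm (f x + g x) \<le> (C + D) * norm x ^ (m + n)" for x
    using norm_triangle_ineq[of "f x" "g x"] C(2)[of x] D(2)[of x] by (simp add: algebra_simps)
  then show ?case using C D by (intro exI[of _ "C + D"]) auto
qed

text \<open>The induction step of the next lemma, stated for a factor \<open>u\<close> so that it serves both the
  coordinates and their conjugates.\<close>

lemma lipschitz_times_coordinate:
  fixes f u :: "'a::real_normed_vector \<Rightarrow> complex"
  assumes C: "C \<ge> 0" "\<And>x y r. norm x \<le> r \<Longrightarrow> norm y \<le> r \<Longrightarrow> r \<le> 1 \<Longrightarrow>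
     norm (f x - f y) \<le> C * r ^ (d - 1) * norm (x - y)"
    and D: "D \<ge> 0" "\<And>x. norm (f x) \<le> D * norm x ^ d"
    and u: "\<And>x. norm (u x) \<le> norm x" "\<And>x y. norm (u x - u y) \<le> norm (x - y)"
    and r: "norm x \<le> r" "norm y \<le> r" "r \<le> 1"
  shows "norm (u x * f x - u y * f y) \<le> (C + D) * r ^ d * norm (x - y)"
proof -
  have r0: "0 \<le> r" using norm_ge_zero r(1) by (rule order_trans)
  have "norm (u x * f x - u y * f y) = norm (u x * (f x - f y) + (u x - u y) * f y)"
    by (simp add: algebra_simps)
  also have "\<dots> \<le> norm (u x) * norm (f x - f y) + norm (u x - u y) * norm (f y)"
    using norm_triangle_ineq[of "u x * (f x - f y)" "(u x - u y) * f y"] by (simp add: norm_mult)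
  also have "\<dots> \<le> r * (C * r ^ (d - 1) * norm (x - y)) + norm (x - y) * (D * r ^ d)"
  proof (intro add_mono mult_mono)
    show "norm (u x) \<le> r" using u(1)[of x] r(1) by linarith
    show "norm (f x - f y) \<le> C * r ^ (d - 1) * norm (x - y)" by (rule C(2)[OF r])
    show "norm (f y) \<le> D * r ^ d"
      using D(2)[of y] mult_left_mono[OF power_mono[OF r(2), of d] D(1)] by simp
  qed (use r0 u in auto)
  also have "r * (C * r ^ (d - 1) * norm (x - y)) \<le> C * r ^ d * norm (x - y)"
  proof (cases d)
    case 0
    then show ?thesis using r(3) C(1) mult_right_mono[of r 1 "C * norm (x - y)"] by (simp add: mult_ac)
  qed (simp add: mult_ac)
  finally show ?thesis by (simp add: algebra_simps)
qed

text \<open>A homogeneous polynomial of degree \<open>d\<close> has Lipschitz constant \<open>O(r\<^bsup>d-1\<^esup>)\<close> on the ball of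
  radius \<open>r\<close>. The restriction to \<open>r \<le> 1\<close> accounts for the truncated subtraction in the exponent
  when \<open>d = 0\<close>.\<close>

lemma bihom_lipschitz:
  "bihom m n f \<Longrightarrow> \<exists>C\<ge>0. \<forall>x y r. norm x \<le> r \<longrightarrow> norm y \<le> r \<longrightarrow> r \<le> 1 \<longrightarrow>
     norm (f x - f y) \<le> C * r ^ (m + n - 1) * norm (x - y)"
proof (induction rule: bihom.induct)
  case (const c)
  show ?case by (intro exI[of _ 0]) simp
next
  case (var m n f i)
  then obtain C where C: "C \<ge> 0" "\<And>x y r. norm x \<le> r \<Longrightarrow> norm y \<le> r \<Longrightarrow> r \<le> 1 \<Longrightarrow>
     norm (f x - f y) \<le> C * r ^ (m + n - 1) * norm (x - y)" by blast
  obtain D where D: "D \<ge> 0" "\<And>x. norm (f x) \<le> D * norm x ^ (m + n)" using bihom_bound[OF var.hyps] by blast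
  show ?case
    using lipschitz_times_coordinate[OF C D, of "\<lambda>x. x $ i"] C(1) D(1)
    by (intro exI[of _ "C + D"])
      (simp add: Finite_Cartesian_Product.norm_nth_le flip: vector_minus_component)
next
  case (cnj_var m n f i)
  then obtain C where C: "C \<ge> 0" "\<And>x y r. norm x \<le> r \<Longrightarrow> norm y \<le> r \<Longrightarrow> r \<le> 1 \<Longrightarrow>
     norm (f x - f y) \<le> C * r ^ (m + n - 1) * norm (x - y)" by blast
  obtain D where D: "D \<ge> 0" "\<And>x. norm (f x) \<le> D * norm x ^ (m + n)" using bihom_bound[OF cnj_var.hyps] by blast
  show ?case
    using lipschitz_times_coordinate[OF C D, of "\<lambda>x. cnj (x $ i)"] C(1) D(1)
    by (intro exI[of _ "C + D"])
      (simp add: Finite_Cartesian_Product.norm_nth_le flip: vector_minus_component complex_cnj_diff)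
next
  case (add m n f g)
  then obtain C D where C: "C \<ge> 0" "\<And>x y r. norm x \<le> r \<Longrightarrow> norm y \<le> r \<Longrightarrow> r \<le> 1 \<Longrightarrow>
     norm (f x - f y) \<le> C * r ^ (m + n - 1) * norm (x - y)"
    and D: "D \<ge> 0" "\<And>x y r. norm x \<le> r \<Longrightarrow> norm y \<le> r \<Longrightarrow> r \<le> 1 \<Longrightarrow>
     norm (g x - g y) \<le> D * r ^ (m + n - 1) * norm (x - y)" by metis
  have "norm ((f x + g x) - (f y + g y)) \<le> (C + D) * r ^ (m + n - 1) * norm (x - y)"
    if r: "norm x \<le> r" "norm y \<le> r" "r \<le> 1" for x y r
    using norm_diff_triangle_ineq[of "f x" "g x" "f y" "g y"] C(2)[OF r] D(2)[OF r] by (simp add: algebra_simps)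
  then show ?case using C(1) D(1) by (intro exI[of _ "C + D"]) auto
qed

lemma bihom_smooth: "bihom m n f \<Longrightarrow> smooth_on UNIV f"
proof (induction rule: bihom.induct)
  case (const c)
  show ?case by (rule smooth_on_const)
next
  case (var m n f i)
  then show ?case
    by (intro smooth_on_bilinear[OF _ bounded_bilinear_mult] smooth_on_bounded_linear[OF _ bounded_linear_vec_nth]) auto
next
  case (cnj_var m n f i)
  then show ?case
    by (intro smooth_on_bilinear[OF _ bounded_bilinear_mult] smooth_on_bounded_linear[OF _
        bounded_linear_compose[OF bounded_linear_cnj bounded_linear_vec_nth]]) auto
qed (auto intro: smooth_on_add)

lemma bihom_holomorphic:
  "bihom m n f \<Longrightarrow> n = 0 \<Longrightarrow> \<exists>f'. (f has_derivative f') (at x) \<and> (\<forall>c v. f' (c *s v) = c * f' v)"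
proof (induction rule: bihom.induct)
  case (const c)
  show ?case by (intro exI[of _ "\<lambda>v. 0"]) auto
next
  case (var m n f i)
  then obtain f' where f': "(f has_derivative f') (at x)" "\<And>c v. f' (c *s v) = c * f' v" by blast
  have "((\<lambda>x. x $ i * f x) has_derivative (\<lambda>v. x $ i * f' v + v $ i * f x)) (at x)"
    by (intro has_derivative_mult f' bounded_linear_imp_has_derivative bounded_linear_vec_nth)
  then show ?case using f'(2) by (intro exI[of _ "\<lambda>v. x $ i * f' v + v $ i * f x"]) (auto simp: algebra_simps)
next
  case (add m n f g)
  then obtain f' g' where "(f has_derivative f') (at x)" "\<And>c v. f' (c *s v) = c * f' v"
    "(g has_derivative g') (at x)" "\<And>c v. g' (c *s v) = c * g' v" by blast
  then show ?case by (intro exI[of _ "\<lambda>v. f' v + g' v"]) (auto simp: algebra_simps intro: has_derivative_add)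
qed simp

lemma bihom_homogeneous: "bihom m n f \<Longrightarrow> f (c *s x) = c ^ m * cnj c ^ n * f x"
  by (induction rule: bihom.induct) (simp_all add: algebra_simps)

lemma bihom_z_part: "bihom 1 0 (\<lambda>x. z_part k x $ i)"
  using bihom_coord[of i] bihom_zero[of 1 0] by (cases "i = k") (auto simp: z_part_def)

lemma of_real_phi2: "complex_of_real (phi2 J s x) = (\<Sum>j\<in>J. s j * (x $ j * cnj (x $ j)))"
  by (simp only: phi2_def of_real_sum of_real_mult complex_norm_square)

lemma bihom_phi2: "bihom 1 1 (\<lambda>x. complex_of_real (phi2 J s x))"
proof -
  have "bihom 1 1 (\<lambda>x. x $ j * cnj (x $ j))" for j
    using bihom_mult[OF bihom_coord bihom_cnj_coord, of j j] by simp
  then show ?thesis unfolding of_real_phi2 by (intro bihom_sum bihom_scale)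
qed

lemma bihom_phi21: "bihom 2 1 (phi21 J\<^sub>2 J\<^sub>3 a b c)"
proof -
  have "bihom 2 1 (\<lambda>z. d * z $ i * z $ j * cnj (z $ l))" for d i j l
    using bihom_scale[OF bihom_mult[OF bihom_mult[OF bihom_coord[of i] bihom_coord[of j]] bihom_cnj_coord[of l]], of d]
    by (simp add: mult.assoc numeral_2_eq_2)
  then show ?thesis unfolding phi21_def[abs_def] by (intro bihom.add bihom_sum)
qed

section \<open>Germs vanishing to a given order\<close>

text \<open>The neighbourhood filter includes the origin itself, so that an inner function may take the
  value 0 at other points in \<open>vanishing_compose\<close>.\<close>

definition vanishing :: "nat \<Rightarrow> ('a::real_normed_vector \<Rightarrow> 'b::real_normed_vector) \<Rightarrow> bool" where
  "vanishing d f \<longleftrightarrow> (\<exists>C. \<forall>\<^sub>F x in nhds 0. norm (f x) \<le> C * norm x ^ d)"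

lemma vanishingI: "\<forall>\<^sub>F x in nhds 0. norm (f x) \<le> C * norm x ^ d \<Longrightarrow> vanishing d f"
  unfolding vanishing_def by blast

lemma vanishingE:
  assumes "vanishing d f"
  obtains C where "C \<ge> 0" "\<forall>\<^sub>F x in nhds 0. norm (f x) \<le> C * norm x ^ d"
proof -
  obtain C where C: "\<forall>\<^sub>F x in nhds 0. norm (f x) \<le> C * norm x ^ d"
    using assms unfolding vanishing_def by blast
  have "\<forall>\<^sub>F x in nhds 0. norm (f x) \<le> \<bar>C\<bar> * norm x ^ d"
    using C
  proof eventually_elim
    case (elim x)
    also have "C * norm x ^ d \<le> \<bar>C\<bar> * norm x ^ d" by (intro mult_right_mono) auto
    finally show ?case .
  qed
  then show ?thesis by (intro that[of "\<bar>C\<bar>"]) auto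
qed

lemma eventually_norm_less_one: "\<forall>\<^sub>F x in nhds 0. norm (x::'a::real_normed_vector) < 1"
proof -
  have "\<forall>\<^sub>F x in nhds (0::'a). x \<in> ball 0 1" by (rule eventually_nhds_in_open) auto
  then show ?thesis by eventually_elim (simp add: dist_norm)
qed

lemma vanishing_mono:
  assumes "vanishing e f" "d \<le> e"
  shows "vanishing d f"
proof -
  obtain C where C: "C \<ge> 0" "\<forall>\<^sub>F x in nhds 0. norm (f x) \<le> C * norm x ^ e"
    using assms(1) by (rule vanishingE)
  from C(2) eventually_norm_less_one have "\<forall>\<^sub>F x in nhds 0. norm (f x) \<le> C * norm x ^ d"
  proof eventually_elim
    case (elim x)
    have "C * norm x ^ e \<le> C * norm x ^ d"
      using elim assms(2) C(1) by (intro mult_left_mono power_decreasing) auto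
    with elim show ?case by linarith
  qed
  then show ?thesis by (rule vanishingI)
qed

lemma vanishing_mult:
  fixes f g :: "'a::real_normed_vector \<Rightarrow> 'b::real_normed_field"
  assumes "vanishing d f" "vanishing e g"
  shows "vanishing (d + e) (\<lambda>x. f x * g x)"
proof -
  obtain C D where C: "C \<ge> 0" "\<forall>\<^sub>F x in nhds 0. norm (f x) \<le> C * norm x ^ d"
    and D: "D \<ge> 0" "\<forall>\<^sub>F x in nhds 0. norm (g x) \<le> D * norm x ^ e"
    using assms by (elim vanishingE)
  from C(2) D(2) have "\<forall>\<^sub>F x in nhds 0. norm (f x * g x) \<le> (C * D) * norm x ^ (d + e)"
  proof eventually_elim
    case (elim x)
    have "norm (f x) * norm (g x) \<le> (C * norm x ^ d) * (D * norm x ^ e)"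
      by (intro mult_mono elim) (use C(1) in auto)
    then show ?case by (simp add: norm_mult power_add mult_ac)
  qed
  then show ?thesis by (rule vanishingI)
qed

lemma vanishing_add:
  assumes "vanishing d f" "vanishing d g"
  shows "vanishing d (\<lambda>x. f x + g x)"
proof -
  obtain C D where C: "C \<ge> 0" "\<forall>\<^sub>F x in nhds 0. norm (f x) \<le> C * norm x ^ d"
    and D: "D \<ge> 0" "\<forall>\<^sub>F x in nhds 0. norm (g x) \<le> D * norm x ^ d"
    using assms by (elim vanishingE)
  from C(2) D(2) have "\<forall>\<^sub>F x in nhds 0. norm (f x + g x) \<le> (C + D) * norm x ^ d"
  proof eventually_elim
    case (elim x)
    then show ?case using norm_triangle_ineq[of "f x" "g x"] by (simp add: distrib_right)
  qed
  then show ?thesis by (rule vanishingI)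
qed

lemma vanishing_uminus: "vanishing d f \<Longrightarrow> vanishing d (\<lambda>x. - f x)"
  by (simp add: vanishing_def)

lemma vanishing_diff: "vanishing d f \<Longrightarrow> vanishing d g \<Longrightarrow> vanishing d (\<lambda>x. f x - g x)"
  using vanishing_add[of d f "\<lambda>x. - g x"] vanishing_uminus[of d g] by simp

lemma vanishing_zero: "vanishing d (\<lambda>x. 0)"
  by (rule vanishingI[of _ 0]) simp

lemma vanishing_sum: "(\<And>i. i \<in> I \<Longrightarrow> vanishing d (f i)) \<Longrightarrow> vanishing d (\<lambda>x. \<Sum>i\<in>I. f i x)"
  by (induction I rule: infinite_finite_induct) (auto intro: vanishing_add vanishing_zero)

lemma vanishing_norm_le:
  assumes "vanishing d f" "\<And>x. norm (g x) \<le> norm (f x)"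
  shows "vanishing d g"
proof -
  obtain C where "C \<ge> 0" "\<forall>\<^sub>F x in nhds 0. norm (f x) \<le> C * norm x ^ d"
    using assms(1) by (rule vanishingE)
  then have "\<forall>\<^sub>F x in nhds 0. norm (g x) \<le> C * norm x ^ d"
    by (auto elim!: eventually_mono intro: order_trans[OF assms(2)])
  then show ?thesis by (rule vanishingI)
qed

lemma vanishing_const: "vanishing 0 (\<lambda>x. c)"
  by (rule vanishingI[of _ "norm c"]) simp

lemma vanishing_Re: "vanishing d f \<Longrightarrow> vanishing d (\<lambda>x. Re (f x))"
  by (erule vanishing_norm_le) (simp add: abs_Re_le_cmod)

lemma vanishing_vec:
  fixes a :: "'a::real_normed_vector \<Rightarrow> complex^'n"
  assumes "\<And>i. vanishing d (\<lambda>x. a x $ i)"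
  shows "vanishing d a"
proof (rule vanishing_norm_le)
  have "vanishing d (\<lambda>x. norm (a x $ i))" for i
    by (rule vanishing_norm_le[OF assms[of i]]) simp
  then show "vanishing d (\<lambda>x. \<Sum>i\<in>UNIV. norm (a x $ i))" by (rule vanishing_sum)
  show "norm (a x) \<le> norm (\<Sum>i\<in>UNIV. norm (a x $ i))" for x
    using L2_set_le_sum[of UNIV "\<lambda>i. norm (a x $ i)"] by (simp add: norm_vec_def sum_nonneg)
qed

lemma vanishing_tendsto:
  assumes "vanishing d a" "d > 0"
  shows "(a \<longlongrightarrow> 0) (nhds 0)"
proof -
  obtain C where C: "\<forall>\<^sub>F x in nhds 0. norm (a x) \<le> C * norm x ^ d"
    using assms(1) by (rule vanishingE)
  have "((\<lambda>x. x) \<longlongrightarrow> (0::'a)) (nhds 0)" by (simp add: filterlim_def)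
  then have "((\<lambda>x::'a. C * norm x ^ d) \<longlongrightarrow> C * norm (0::'a) ^ d) (nhds 0)"
    by (intro tendsto_intros)
  then have "((\<lambda>x::'a. C * norm x ^ d) \<longlongrightarrow> 0) (nhds 0)" using assms(2) by (simp add: zero_power)
  with C show ?thesis by (rule Lim_null_comparison)
qed

lemma vanishing_real_mult:
  "vanishing d f \<Longrightarrow> vanishing d (\<lambda>x. (c::real) * f x)"
  using vanishing_mult[OF vanishing_const[of c], of d f] by simp

lemma vanishing_id: "vanishing 1 (\<lambda>x. x)"
  by (rule vanishingI[of _ 1]) simp

lemma vanishing_compose:
  assumes "vanishing d f" "vanishing 1 h"
  shows "vanishing d (\<lambda>y. f (h y))"
proof -
  obtain C where C: "C \<ge> 0" "\<forall>\<^sub>F x in nhds 0. norm (f x) \<le> C * norm x ^ d"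
    using assms(1) by (rule vanishingE)
  obtain D where D: "D \<ge> 0" "\<forall>\<^sub>F y in nhds 0. norm (h y) \<le> D * norm y ^ 1"
    using assms(2) by (rule vanishingE)
  have "filterlim h (nhds 0) (nhds 0)" by (rule vanishing_tendsto[OF assms(2)]) simp
  with C(2) have "\<forall>\<^sub>F y in nhds 0. norm (f (h y)) \<le> C * norm (h y) ^ d"
    by (rule eventually_compose_filterlim)
  with D(2) have "\<forall>\<^sub>F y in nhds 0. norm (f (h y)) \<le> (C * D ^ d) * norm y ^ d"
  proof eventually_elim
    case (elim y)
    have "C * norm (h y) ^ d \<le> C * (D * norm y ^ 1) ^ d"
      by (intro mult_left_mono power_mono elim C) simp
    with elim show ?case by (simp add: power_mult_distrib mult.assoc)
  qed
  then show ?thesis by (rule vanishingI)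
qed

lemma vanishing_bounded_linear:
  assumes "bounded_linear h"
  shows "vanishing 1 h"
proof -
  obtain C where "\<forall>x. norm (h x) \<le> norm x * C" using bounded_linear.bounded[OF assms] by blast
  then show ?thesis by (intro vanishingI[of _ C] always_eventually) (simp add: mult.commute)
qed

lemma vanishing_at_zero: "vanishing d f \<Longrightarrow> d > 0 \<Longrightarrow> f 0 = 0"
proof -
  assume "vanishing d f" "d > 0"
  then obtain C where "\<forall>\<^sub>F x in nhds 0. norm (f x) \<le> C * norm x ^ d" by (auto elim: vanishingE)
  then have "norm (f 0) \<le> C * norm (0::'a) ^ d" by (rule eventually_nhds_x_imp_x)
  then show "f 0 = 0" using \<open>d > 0\<close> by (simp add: zero_power)
qed

lemma vanishing_imp_bigo:
  fixes f :: "'a::real_normed_vector \<Rightarrow> real"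
  assumes "vanishing d f"
  shows "f \<in> O[at 0](\<lambda>x. norm x ^ d)"
proof -
  obtain C where "\<forall>\<^sub>F x in nhds 0. norm (f x) \<le> C * norm x ^ d"
    using assms by (rule vanishingE)
  then have "\<forall>\<^sub>F x in at 0. norm (f x) \<le> C * norm (norm x ^ d)"
    unfolding eventually_at_filter by (auto elim: eventually_mono)
  then show ?thesis by (rule bigoI)
qed

lemma tendsto_imp_vanishing_0:
  fixes f :: "'a::real_normed_vector \<Rightarrow> real"
  assumes "(f \<longlongrightarrow> c) (nhds 0)"
  shows "vanishing 0 f"
proof -
  have "\<forall>\<^sub>F x in nhds 0. dist (f x) c < 1" using assms by (rule tendstoD) simp
  then have "\<forall>\<^sub>F x in nhds 0. norm (f x) \<le> (\<bar>c\<bar> + 1) * norm x ^ 0"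
    by (rule eventually_mono) (auto simp: dist_real_def)
  then show ?thesis by (rule vanishingI)
qed

lemma vanishing_2_derivative:
  fixes F :: "'a::real_normed_vector \<Rightarrow> 'a"
  assumes "vanishing 2 (\<lambda>x. F x - x)"
  shows "(F has_derivative (\<lambda>x. x)) (at 0)"
proof -
  obtain C where C: "\<forall>\<^sub>F x in nhds 0. norm (F x - x) \<le> C * norm x ^ 2"
    using assms by (rule vanishingE)
  have F0: "F 0 = 0" using vanishing_at_zero[OF assms] by simp
  have "((\<lambda>h. norm (F (0 + h) - F 0 - h) / norm h) \<longlongrightarrow> 0) (at 0)"
  proof (rule Lim_null_comparison)
    show "\<forall>\<^sub>F h in at 0. norm (norm (F (0 + h) - F 0 - h) / norm h) \<le> C * norm h"
      unfolding eventually_at_filter using C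
      by eventually_elim (auto simp: F0 divide_le_eq power2_eq_square)
    have "((\<lambda>h::'a. C * norm h) \<longlongrightarrow> C * norm (0::'a)) (at 0)" by (intro tendsto_intros)
    then show "((\<lambda>h::'a. C * norm h) \<longlongrightarrow> 0) (at 0)" by simp
  qed
  then show ?thesis by (simp add: has_derivative_at)
qed

lemma bihom_vanishing:
  assumes "bihom m n f"
  shows "vanishing (m + n) f"
proof -
  obtain C where "\<forall>x. norm (f x) \<le> C * norm x ^ (m + n)" using bihom_bound[OF assms] by blast
  then show ?thesis by (intro vanishingI[of _ C] always_eventually)
qed

lemma bihom_vanishing_Re: "bihom m n f \<Longrightarrow> vanishing (m + n) (\<lambda>x. Re (f x))"
  by (intro vanishing_Re bihom_vanishing)

text \<open>Perturbing the argument by terms of order \<open>e\<close> changes a homogeneous polynomial of degree \<open>d\<close>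
  only in order \<open>d - 1 + e\<close>. This is what makes computations modulo terms of fourth order
  possible.\<close>

lemma bihom_perturb:
  fixes f :: "complex^'n \<Rightarrow> complex" and y a :: "'b::real_normed_vector \<Rightarrow> complex^'n"
  assumes "bihom m n f" "vanishing 1 y" "vanishing e a" "e \<ge> 1"
  shows "vanishing (m + n - 1 + e) (\<lambda>x. f (y x + a x) - f (y x))"
proof -
  obtain C where C: "C \<ge> 0" "\<And>x y r. norm x \<le> r \<Longrightarrow> norm y \<le> r \<Longrightarrow> r \<le> 1 \<Longrightarrow>
     norm (f x - f y) \<le> C * r ^ (m + n - 1) * norm (x - y)" using bihom_lipschitz[OF assms(1)] by blast
  obtain D1 where D1: "D1 \<ge> 0" "\<forall>\<^sub>F x in nhds 0. norm (y x) \<le> D1 * norm x ^ 1"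
    using assms(2) by (rule vanishingE)
  obtain D2 where D2: "D2 \<ge> 0" "\<forall>\<^sub>F x in nhds 0. norm (a x) \<le> D2 * norm x ^ 1"
    using vanishing_mono[OF assms(3,4)] by (rule vanishingE)
  obtain E where E: "E \<ge> 0" "\<forall>\<^sub>F x in nhds 0. norm (a x) \<le> E * norm x ^ e"
    using assms(3) by (rule vanishingE)
  have "((\<lambda>x. x) \<longlongrightarrow> (0::'b)) (nhds 0)" by (simp add: filterlim_def)
  then have "((\<lambda>x::'b. (D1 + D2) * norm x) \<longlongrightarrow> (D1 + D2) * norm (0::'b)) (nhds 0)"
    by (intro tendsto_intros)
  then have "\<forall>\<^sub>F x in nhds 0. (D1 + D2) * norm (x::'b) < 1"
    by (rule order_tendstoD) simp
  with D1(2) D2(2) E(2) have "\<forall>\<^sub>F x in nhds 0. norm (f (y x + a x) - f (y x))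
    \<le> (C * (D1 + D2) ^ (m + n - 1) * E) * norm x ^ (m + n - 1 + e)"
  proof eventually_elim
    case (elim x)
    have "norm (y x) \<le> (D1 + D2) * norm x" "norm (y x + a x) \<le> (D1 + D2) * norm x"
      using elim norm_triangle_ineq[of "y x" "a x"] mult_nonneg_nonneg[OF D2(1) norm_ge_zero[of x]]
      unfolding distrib_right power_one_right by linarith+
    then have "norm (f (y x + a x) - f (y x)) \<le> C * ((D1 + D2) * norm x) ^ (m + n - 1) * norm ((y x + a x) - y x)"
      using elim by (intro C(2)) auto
    also have "\<dots> \<le> C * ((D1 + D2) * norm x) ^ (m + n - 1) * (E * norm x ^ e)"
      using elim C(1) D1(1) D2(1) by (intro mult_left_mono) auto
    also have "\<dots> = (C * (D1 + D2) ^ (m + n - 1) * E) * norm x ^ (m + n - 1 + e)"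
      unfolding power_mult_distrib power_add by (simp only: mult_ac)
    finally show ?case .
  qed
  then show ?thesis by (rule vanishingI)
qed

lemma bihom_2_3_vanishing:
  fixes a :: "complex^'n \<Rightarrow> complex^'n"
  assumes "\<And>i. \<exists>a2 a3. bihom 2 0 a2 \<and> bihom 3 0 a3 \<and> (\<forall>x. a x $ i = a2 x + a3 x)"
  shows "vanishing 2 a"
proof (rule vanishing_vec)
  fix i
  obtain a2 a3 where a23: "bihom 2 0 a2" "bihom 3 0 a3" "\<And>x. a x $ i = a2 x + a3 x" using assms[of i] by blast
  have "vanishing 2 a2" "vanishing 2 a3"
    using vanishing_mono[OF bihom_vanishing[OF a23(1)]] vanishing_mono[OF bihom_vanishing[OF a23(2)]] by auto
  then show "vanishing 2 (\<lambda>x. a x $ i)" unfolding a23(3) by (rule vanishing_add)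
qed

section \<open>Taylor's formula to third order\<close>

definition dir_deriv :: "'a::real_normed_vector \<Rightarrow> ('a \<Rightarrow> real) \<Rightarrow> 'a \<Rightarrow> real" where
  "dir_deriv v f y = frechet_derivative f (at y) v"

lemma smooth_on_dir_deriv: "smooth_on S f \<Longrightarrow> smooth_on S (dir_deriv v f)"
  unfolding dir_deriv_def[abs_def] by (rule smooth_on_frechet_derivative)

lemma smooth_on_dir_deriv_iter: "smooth_on S f \<Longrightarrow> smooth_on S ((dir_deriv v ^^ n) f)"
  by (induction n) (auto intro: smooth_on_dir_deriv)

lemma dir_deriv_expand:
  fixes f :: "'a::euclidean_space \<Rightarrow> real"
  assumes "smooth_on S f" "y \<in> S"
  shows "dir_deriv x f y = (\<Sum>b\<in>Basis. (x \<bullet> b) * dir_deriv b f y)"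
  using linear_eq_sum_Basis[OF linear_frechet_derivative[OF smooth_on_differentiable[OF assms]], of x]
  by (simp add: dir_deriv_def)

lemma smooth_on_scaled_sum:
  fixes h :: "'i \<Rightarrow> 'a::real_normed_vector \<Rightarrow> real"
  assumes "open S" "\<And>c. c \<in> I \<Longrightarrow> smooth_on S (h c)"
  shows "smooth_on S (\<lambda>y. \<Sum>c\<in>I. k c * h c y)"
  by (intro smooth_on_sum smooth_on_bilinear[OF _ bounded_bilinear_mult] smooth_on_const assms)

lemma dir_deriv_iter_cong:
  assumes "open S" "smooth_on S f" and "\<And>y. y \<in> S \<Longrightarrow> f y = g y" "y \<in> S"
  shows "(dir_deriv x ^^ n) f y = (dir_deriv x ^^ n) g y"
  using assms(4)
proof (induction n arbitrary: y)
  case (Suc n)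
  have "frechet_derivative ((dir_deriv x ^^ n) f) (at y) = frechet_derivative ((dir_deriv x ^^ n) g) (at y)"
    by (rule frechet_derivative_transform_within_open[OF _ assms(1) Suc.prems Suc.IH])
      (rule smooth_on_differentiable[OF smooth_on_dir_deriv_iter[OF assms(2)] Suc.prems])
  then show ?case by (simp add: dir_deriv_def[of x "(dir_deriv x ^^ n) _"])
qed (simp add: assms)

lemma dir_deriv_iter_sum:
  fixes h :: "'i \<Rightarrow> 'a::real_normed_vector \<Rightarrow> real"
  assumes "open S" "\<And>c. c \<in> I \<Longrightarrow> smooth_on S (h c)" "y \<in> S"
  shows "(dir_deriv x ^^ n) (\<lambda>y. \<Sum>c\<in>I. k c * h c y) y = (\<Sum>c\<in>I. k c * (dir_deriv x ^^ n) (h c) y)"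
  using assms(3)
proof (induction n arbitrary: y)
  case (Suc n)
  have sm: "smooth_on S (\<lambda>y. \<Sum>c\<in>I. k c * h c y)" by (rule smooth_on_scaled_sum[OF assms(1,2)])
  have "frechet_derivative ((dir_deriv x ^^ n) (\<lambda>y. \<Sum>c\<in>I. k c * h c y)) (at y)
      = frechet_derivative (\<lambda>y. \<Sum>c\<in>I. k c * (dir_deriv x ^^ n) (h c) y) (at y)"
    by (rule frechet_derivative_transform_within_open[OF _ assms(1) Suc.prems Suc.IH])
      (rule smooth_on_differentiable[OF smooth_on_dir_deriv_iter[OF sm] Suc.prems])
  moreover have "((\<lambda>y. \<Sum>c\<in>I. k c * (dir_deriv x ^^ n) (h c) y) has_derivative
       (\<lambda>v. \<Sum>c\<in>I. k c * frechet_derivative ((dir_deriv x ^^ n) (h c)) (at y) v)) (at y)"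
    by (intro has_derivative_sum has_derivative_mult_right)
      (use smooth_on_differentiable[OF smooth_on_dir_deriv_iter[OF assms(2)] Suc.prems] in
        \<open>simp add: frechet_derivative_works[symmetric]\<close>)
  ultimately show ?case
    by (simp add: dir_deriv_def[of x "(dir_deriv x ^^ n) _"] frechet_derivative_at[symmetric])
qed simp

text \<open>Along a line one differentiates repeatedly in the direction \<open>x\<close>; peeling off the innermost
  derivative expresses the result by iterated partial derivatives, with coefficients that are
  polynomial in \<open>x\<close>.\<close>

lemma dir_deriv_iter_Suc:
  fixes f :: "'a::euclidean_space \<Rightarrow> real"
  assumes "open S" "smooth_on S f" "y \<in> S"
  shows "(dir_deriv x ^^ Suc n) f y = (\<Sum>c\<in>Basis. (x \<bullet> c) * (dir_deriv x ^^ n) (dir_deriv c f) y)"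
proof -
  have "(dir_deriv x ^^ Suc n) f y = (dir_deriv x ^^ n) (dir_deriv x f) y"
    by (simp add: funpow_swap1)
  also have "\<dots> = (dir_deriv x ^^ n) (\<lambda>y. \<Sum>c\<in>Basis. (x \<bullet> c) * dir_deriv c f y) y"
    by (rule dir_deriv_iter_cong[OF assms(1) smooth_on_dir_deriv[OF assms(2)] _ assms(3)])
      (rule dir_deriv_expand[OF assms(2)])
  also have "\<dots> = (\<Sum>c\<in>Basis. (x \<bullet> c) * (dir_deriv x ^^ n) (dir_deriv c f) y)"
    by (rule dir_deriv_iter_sum[OF assms(1) smooth_on_dir_deriv[OF assms(2)] assms(3)])
  finally show ?thesis .
qed

text \<open>Provides the uniform bound for the remainder in Taylor's formula.\<close>

lemma dir_deriv_iter_bound: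
  fixes f :: "'a::euclidean_space \<Rightarrow> real"
  assumes "open S" "compact K" "K \<subseteq> S"
  shows "smooth_on S f \<Longrightarrow> \<exists>C\<ge>0. \<forall>x. \<forall>y\<in>K. \<bar>(dir_deriv x ^^ n) f y\<bar> \<le> C * norm x ^ n"
proof (induction n arbitrary: f)
  case 0
  have "bounded (f ` K)"
    using smooth_on_continuous[OF 0] assms(2,3)
    by (intro compact_imp_bounded compact_continuous_image) (auto intro: continuous_on_subset)
  then obtain C where C: "\<forall>z\<in>f ` K. norm z \<le> C" by (auto simp: bounded_iff)
  then show ?case by (intro exI[of _ "max C 0"]) fastforce
next
  case (Suc n)
  have "\<exists>C\<ge>0. \<forall>x. \<forall>y\<in>K. \<bar>(dir_deriv x ^^ n) (dir_deriv c f) y\<bar> \<le> C * norm x ^ n" for c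
    by (rule Suc.IH[OF smooth_on_dir_deriv[OF Suc.prems]])
  then obtain C where C: "\<And>c. C c \<ge> 0"
    "\<And>c x y. y \<in> K \<Longrightarrow> \<bar>(dir_deriv x ^^ n) (dir_deriv c f) y\<bar> \<le> C c * norm x ^ n" by metis
  have "\<bar>(dir_deriv x ^^ Suc n) f y\<bar> \<le> (\<Sum>c\<in>Basis. C c) * norm x ^ Suc n" if "y \<in> K" for x y
  proof -
    have y: "y \<in> S" using that assms(3) by auto
    have "\<bar>(dir_deriv x ^^ Suc n) f y\<bar> \<le> (\<Sum>c\<in>Basis. \<bar>(x \<bullet> c) * (dir_deriv x ^^ n) (dir_deriv c f) y\<bar>)"
      unfolding dir_deriv_iter_Suc[OF assms(1) Suc.prems y] by (rule sum_abs)
    also have "\<dots> \<le> (\<Sum>c\<in>Basis. norm x * (C c * norm x ^ n))"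
      unfolding abs_mult by (intro sum_mono mult_mono C that Basis_le_norm) auto
    also have "\<dots> = (\<Sum>c\<in>Basis. C c) * norm x ^ Suc n"
      by (simp add: sum_distrib_right sum_distrib_left mult_ac)
    finally show ?thesis .
  qed
  then show ?case by (intro exI[of _ "\<Sum>c\<in>Basis. C c"]) (auto intro: sum_nonneg C(1))
qed

lemma dir_deriv_line:
  assumes "smooth_on S f" "p + t *\<^sub>R x \<in> S"
  shows "((\<lambda>t. f (p + t *\<^sub>R x)) has_real_derivative dir_deriv x f (p + t *\<^sub>R x)) (at t)"
proof -
  let ?D = "frechet_derivative f (at (p + t *\<^sub>R x))"
  have D: "(f has_derivative ?D) (at (p + t *\<^sub>R x))"
    by (rule smooth_on_has_derivative[OF assms])
  have "((f \<circ> (\<lambda>t. p + t *\<^sub>R x)) has_derivative (?D \<circ> (\<lambda>h. h *\<^sub>R x))) (at t)"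
    by (intro diff_chain_at D) (auto intro!: derivative_eq_intros)
  then show ?thesis
    by (simp add: has_field_derivative_def o_def dir_deriv_def
        linear_scale[OF has_derivative_linear[OF D]] mult_commute_abs)
qed

lemma taylor_third_order:
  fixes f :: "'a::euclidean_space \<Rightarrow> real"
  assumes "open U" "smooth_on U f" "p \<in> U"
  shows "vanishing 4 (\<lambda>x. f (p + x) - (f p + (\<Sum>b\<in>Basis. (x \<bullet> b) * dir_deriv b f p)
      + (\<Sum>b\<in>Basis. \<Sum>c\<in>Basis. (x \<bullet> b) * (x \<bullet> c) * dir_deriv c (dir_deriv b f) p) / 2
      + (\<Sum>b\<in>Basis. \<Sum>c\<in>Basis. \<Sum>d\<in>Basis.
           (x \<bullet> b) * (x \<bullet> c) * (x \<bullet> d) * dir_deriv d (dir_deriv c (dir_deriv b f)) p) / 6))"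
    (is "vanishing 4 ?r")
proof -
  obtain r where r: "r > 0" "cball p r \<subseteq> U" using assms(1,3) open_contains_cball by blast
  obtain C where C: "\<And>x y. y \<in> cball p r \<Longrightarrow> \<bar>(dir_deriv x ^^ 4) f y\<bar> \<le> C * norm x ^ 4" "C \<ge> 0"
    using dir_deriv_iter_bound[OF assms(1) compact_cball r(2) assms(2)] by blast
  note sm = smooth_on_dir_deriv
  have 1: "(dir_deriv x ^^ 1) f p = (\<Sum>b\<in>Basis. (x \<bullet> b) * dir_deriv b f p)" for x
    using dir_deriv_iter_Suc[OF assms, of 0 x] by simp
  have 2: "(dir_deriv x ^^ 2) f p = (\<Sum>b\<in>Basis. \<Sum>c\<in>Basis. (x \<bullet> b) * (x \<bullet> c) * dir_deriv c (dir_deriv b f) p)" for x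
    by (simp only: numeral_2_eq_2 dir_deriv_iter_Suc[OF assms(1) _ assms(3)] assms(2) sm funpow_0)
      (simp add: sum_distrib_left mult_ac)
  have 3: "(dir_deriv x ^^ 3) f p = (\<Sum>b\<in>Basis. \<Sum>c\<in>Basis. \<Sum>d\<in>Basis.
           (x \<bullet> b) * (x \<bullet> c) * (x \<bullet> d) * dir_deriv d (dir_deriv c (dir_deriv b f)) p)" for x
    by (simp only: numeral_3_eq_3 dir_deriv_iter_Suc[OF assms(1) _ assms(3)] assms(2) sm funpow_0)
      (simp add: sum_distrib_left mult_ac)
  show ?thesis
  proof (rule vanishingI[of _ C])
    have "\<forall>\<^sub>F x in nhds 0. x \<in> cball (0::'a) r"
      using r(1) by (intro eventually_nhds_in_nhd) simp
    then show "\<forall>\<^sub>F x in nhds 0. norm (?r x) \<le> C * norm x ^ 4"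
    proof (rule eventually_mono)
      fix x :: 'a assume x: "x \<in> cball 0 r"
      define G where "G n t = (dir_deriv x ^^ n) f (p + t *\<^sub>R x)" for n t
      have seg: "p + t *\<^sub>R x \<in> cball p r" if "0 \<le> t" "t \<le> 1" for t
        using that x mult_mono[of t 1 "norm x" r] r(1) by (simp add: dist_norm)
      have "\<exists>t. 0 < t \<and> t < 1 \<and> f (p + 1 *\<^sub>R x) = (\<Sum>m<4. (G m 0 / fact m) * 1 ^ m) + (G 4 t / fact 4) * 1 ^ 4"
      proof (rule Maclaurin)
        show "G 0 = (\<lambda>t. f (p + t *\<^sub>R x))" by (simp add: G_def fun_eq_iff)
        have "DERIV (G m) t :> G (Suc m) t" if "0 \<le> t" "t \<le> 1" for m t
        proof -
          have "p + t *\<^sub>R x \<in> U" using seg[OF that] r(2) by blast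
          from dir_deriv_line[OF smooth_on_dir_deriv_iter[OF assms(2)] this, of m x]
          show ?thesis by (simp add: G_def[abs_def])
        qed
        then show "\<forall>m t. m < 4 \<and> 0 \<le> t \<and> t \<le> 1 \<longrightarrow> DERIV (G m) t :> G (Suc m) t" by blast
      qed auto
      then obtain t where t: "0 < t" "t < 1"
        "f (p + x) = G 0 0 + G 1 0 + G 2 0 / 2 + G 3 0 / 6 + G 4 t / 24"
        by (auto simp: numeral_eq_Suc fact_numeral)
      have "\<bar>G 4 t / 24\<bar> \<le> C * norm x ^ 4"
        using C(1)[OF seg[of t], of x] t(1,2) C(2) by (simp add: G_def)
      then show "norm (?r x) \<le> C * norm x ^ 4"
        unfolding t(3) 1[symmetric] 2[symmetric] 3[symmetric] by (simp add: G_def)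
    qed
  qed
qed

text \<open>The mean value theorem applied twice. The second difference is symmetric in \<open>v\<close> and \<open>w\<close>,
  whereas the right-hand side is not: this is the classical reason for the symmetry of second
  derivatives.\<close>

lemma second_difference:
  assumes "smooth_on U f" "ball p r \<subseteq> U" "s > 0" "s * norm v + s * norm w < r"
  shows "\<exists>y\<in>ball p r. f (p + s *\<^sub>R v + s *\<^sub>R w) - f (p + s *\<^sub>R v) - f (p + s *\<^sub>R w) + f p
     = s * s * dir_deriv w (dir_deriv v f) y"
proof -
  have inb: "p + t *\<^sub>R v + t' *\<^sub>R w \<in> ball p r" if "0 \<le> t" "t \<le> s" "0 \<le> t'" "t' \<le> s" for t t'
  proof -
    have "norm (t *\<^sub>R v + t' *\<^sub>R w) \<le> t * norm v + t' * norm w"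
      using norm_triangle_ineq[of "t *\<^sub>R v" "t' *\<^sub>R w"] that by simp
    also have "\<dots> \<le> s * norm v + s * norm w"
      by (intro add_mono mult_right_mono that) auto
    finally have "norm (t *\<^sub>R v + t' *\<^sub>R w) < r" using assms(4) by linarith
    moreover have "dist p (p + t *\<^sub>R v + t' *\<^sub>R w) = norm (t *\<^sub>R v + t' *\<^sub>R w)"
      using dist_add_cancel[of p 0 "t *\<^sub>R v + t' *\<^sub>R w"] by (simp add: add.assoc)
    ultimately show ?thesis by simp
  qed
  let ?g = "\<lambda>t. f ((p + s *\<^sub>R w) + t *\<^sub>R v) - f (p + t *\<^sub>R v)"
  have "\<exists>t. 0 < t \<and> t < s \<and> ?g s - ?g 0 = (s - 0) * (dir_deriv v f ((p + s *\<^sub>R w) + t *\<^sub>R v) - dir_deriv v f (p + t *\<^sub>R v))"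
  proof (rule MVT2[OF assms(3)])
    fix t assume t: "0 \<le> t" "t \<le> s"
    have "(p + s *\<^sub>R w) + t *\<^sub>R v \<in> U" "p + t *\<^sub>R v \<in> U"
      using inb[OF t, of s] inb[OF t, of 0] assms(2,3) by (auto simp: algebra_simps)
    then show "DERIV ?g t :> dir_deriv v f ((p + s *\<^sub>R w) + t *\<^sub>R v) - dir_deriv v f (p + t *\<^sub>R v)"
      by (intro DERIV_diff dir_deriv_line[OF assms(1)])
  qed
  then obtain t where t: "0 < t" "t < s"
    "?g s - ?g 0 = s * (dir_deriv v f ((p + s *\<^sub>R w) + t *\<^sub>R v) - dir_deriv v f (p + t *\<^sub>R v))"
    by auto
  let ?h = "\<lambda>t'. dir_deriv v f ((p + t *\<^sub>R v) + t' *\<^sub>R w)"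
  have "\<exists>t'. 0 < t' \<and> t' < s \<and> ?h s - ?h 0 = (s - 0) * dir_deriv w (dir_deriv v f) ((p + t *\<^sub>R v) + t' *\<^sub>R w)"
  proof (rule MVT2[OF assms(3)])
    fix t' assume t': "0 \<le> t'" "t' \<le> s"
    have "(p + t *\<^sub>R v) + t' *\<^sub>R w \<in> U" using inb[of t t'] t t' assms(2) by auto
    then show "DERIV ?h t' :> dir_deriv w (dir_deriv v f) ((p + t *\<^sub>R v) + t' *\<^sub>R w)"
      by (intro dir_deriv_line[OF smooth_on_dir_deriv[OF assms(1)]])
  qed
  then obtain t' where t': "0 < t'" "t' < s"
    "?h s - ?h 0 = s * dir_deriv w (dir_deriv v f) ((p + t *\<^sub>R v) + t' *\<^sub>R w)" by auto
  show ?thesis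
  proof (rule bexI[OF _ inb[of t t']])
    show "f (p + s *\<^sub>R v + s *\<^sub>R w) - f (p + s *\<^sub>R v) - f (p + s *\<^sub>R w) + f p
     = s * s * dir_deriv w (dir_deriv v f) (p + t *\<^sub>R v + t' *\<^sub>R w)"
      using t(3) t'(3) by (simp add: algebra_simps)
  qed (use t t' in auto)
qed

lemma dir_deriv_commute:
  assumes "open U" "smooth_on U f" "p \<in> U"
  shows "dir_deriv v (dir_deriv w f) p = dir_deriv w (dir_deriv v f) p"
proof -
  let ?a = "dir_deriv v (dir_deriv w f)" and ?b = "dir_deriv w (dir_deriv v f)"
  have "\<bar>?a p - ?b p\<bar> \<le> e + e" if e: "e > 0" for e
  proof -
    have cont: "continuous_on U ?a" "continuous_on U ?b"
      by (intro smooth_on_continuous smooth_on_dir_deriv assms)+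
    then have "isCont ?a p" "isCont ?b p"
      using assms by (auto simp: continuous_on_eq_continuous_at)
    then have "(?a \<longlongrightarrow> ?a p) (nhds p)" "(?b \<longlongrightarrow> ?b p) (nhds p)"
      by (simp_all add: isCont_def tendsto_at_iff_tendsto_nhds)
    then have "\<forall>\<^sub>F y in nhds p. dist (?a y) (?a p) < e" "\<forall>\<^sub>F y in nhds p. dist (?b y) (?b p) < e"
      using e by (auto dest: tendstoD)
    moreover have "\<forall>\<^sub>F y in nhds p. y \<in> U" using assms by (intro eventually_nhds_in_open)
    ultimately have "\<forall>\<^sub>F y in nhds p. y \<in> U \<and> dist (?a y) (?a p) < e \<and> dist (?b y) (?b p) < e"
      by eventually_elim auto
    then obtain r where r: "r > 0" "\<And>y. dist y p < r \<Longrightarrow> y \<in> U \<and> dist (?a y) (?a p) < e \<and> dist (?b y) (?b p) < e"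
      unfolding eventually_nhds_metric by blast
    then have sub: "ball p r \<subseteq> U" by (auto simp: dist_commute)
    \<comment> \<open>a step that keeps the parallelogram inside the ball; the summand 1 avoids division by 0\<close>
    define s where "s = r / (2 * (1 + norm v + norm w))"
    have "1 + norm v + norm w > 0" by (smt (verit) norm_ge_zero)
    then have s: "s > 0" using r(1) by (simp add: s_def)
    have "s * (1 + norm v + norm w) = r / 2"
      using \<open>1 + norm v + norm w > 0\<close> by (simp add: s_def field_simps)
    then have small: "s * norm v + s * norm w < r" using s r(1) by (simp add: algebra_simps)
    from second_difference[OF assms(2) sub s small] obtain y1 where y1: "y1 \<in> ball p r"
      "f (p + s *\<^sub>R v + s *\<^sub>R w) - f (p + s *\<^sub>R v) - f (p + s *\<^sub>R w) + f p = s * s * ?b y1" by blast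
    from second_difference[OF assms(2) sub s, of w v] small obtain y2 where y2: "y2 \<in> ball p r"
      "f (p + s *\<^sub>R w + s *\<^sub>R v) - f (p + s *\<^sub>R w) - f (p + s *\<^sub>R v) + f p = s * s * ?a y2" by auto
    have "s * s * ?b y1 = s * s * ?a y2" using y1(2) y2(2) by (simp add: algebra_simps)
    then have "?b y1 = ?a y2" using s by simp
    moreover have "dist (?a y2) (?a p) < e" "dist (?b y1) (?b p) < e"
      using r(2)[of y1] r(2)[of y2] y1(1) y2(1) by (simp_all add: dist_commute)
    ultimately show ?thesis by (simp add: dist_real_def)
  qed
  then have "\<bar>?a p - ?b p\<bar> \<le> e" if "e > 0" for e using that[THEN half_gt_zero] by fastforce
  then have "\<bar>?a p - ?b p\<bar> \<le> 0" by (rule field_le_epsilon[of _ 0, simplified])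
  then show ?thesis by simp
qed

section \<open>Normalising the cubic terms\<close>

text \<open>Collects all monomials that contain \<open>x\<^sub>k\<close>.\<close>

lemma bihom_quadratic_split:
  fixes f :: "complex^'n \<Rightarrow> complex"
  assumes "bihom 2 0 f"
  obtains c where "\<And>x. f x = x $ k * (\<Sum>j\<in>UNIV. c j * x $ j) + f (z_part k x)"
proof -
  obtain d where d: "\<And>x. f x = (\<Sum>i\<in>UNIV. \<Sum>j\<in>UNIV. d i j * x $ i * x $ j)"
    using bihom_quadratic_coeffs[OF assms] by blast
  define c where "c j = (if j = k then d k k else d k j + d j k)" for j
  have U: "sum g UNIV = g k + sum g (-{k})" for g :: "'n \<Rightarrow> complex"
    using sum.remove[of UNIV k g] by (simp add: Compl_eq_Diff_UNIV)
  have z: "sum (g (z_part k x)) (-{k}) = sum (g x) (-{k})" if "\<And>i. i \<noteq> k \<Longrightarrow> g (z_part k x) i = g x i"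
    for g :: "complex^'n \<Rightarrow> 'n \<Rightarrow> complex" and x
    using that by (intro sum.cong) auto
  have "f x = x $ k * (\<Sum>j\<in>UNIV. c j * x $ j) + f (z_part k x)" for x
  proof -
    have 1: "f (z_part k x) = (\<Sum>i\<in>-{k}. \<Sum>j\<in>-{k}. d i j * x $ i * x $ j)"
      unfolding d U by (simp add: z_part_def)
    have 2: "(\<Sum>j\<in>UNIV. c j * x $ j) = d k k * x $ k + (\<Sum>j\<in>-{k}. d k j * x $ j) + (\<Sum>j\<in>-{k}. d j k * x $ j)"
      unfolding U by (simp add: c_def algebra_simps sum.distrib)
    have 3: "f x = d k k * x $ k * x $ k + (\<Sum>j\<in>-{k}. d k j * x $ k * x $ j)
       + (\<Sum>i\<in>-{k}. d i k * x $ i * x $ k) + (\<Sum>i\<in>-{k}. \<Sum>j\<in>-{k}. d i j * x $ i * x $ j)"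
      unfolding d U by (simp add: sum.distrib)
    show ?thesis unfolding 1 2 3 by (simp add: algebra_simps sum_distrib_left)
  qed
  then show ?thesis by (rule that)
qed

text \<open>Sorting the terms of type (2,1) by what can be done with them: those in \<open>Q\<^sub>l\<close> contain a
  conjugate variable outside \<open>J\<close> and will be removed, the \<open>P\<^sub>l\<close> survive, and in the remaining terms
  \<open>x\<^sub>k S(x, \<bar>x)\<close> the sesquilinear form is brought to \<open>H + \<i>K\<close> with real \<open>H\<close> and \<open>K\<close>. For a pair
  of indices in \<open>J\<close> this is the decomposition into Hermitian and anti-Hermitian part. A mixed term
  \<open>D\<close>, with \<open>x\<^sub>j\<close> for \<open>j \<notin> J\<close> and \<open>\<bar>x\<^sub>l\<close> for \<open>l \<in> J\<close>, is completed to the real form \<open>D + \<bar>D\<close>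
  at the expense of \<open>\<bar>D\<close>, whose conjugate variables are outside \<open>J\<close>.\<close>

lemma bihom_21_decompose:
  fixes f :: "complex^'n \<Rightarrow> complex" and J :: "'n set"
  assumes "bihom 2 1 f"
  obtains Q P :: "'n \<Rightarrow> complex^'n \<Rightarrow> complex" and H K :: "complex^'n \<Rightarrow> real" and \<kappa>
  where "\<And>l. bihom 2 0 (Q l)" "\<And>l. bihom 2 0 (P l)" "bihom 1 1 (\<lambda>x. complex_of_real (H x))"
    "\<And>j l. \<kappa> l j = cnj (\<kappa> j l)"
    "\<And>x. complex_of_real (K x) = (\<Sum>j\<in>J. \<Sum>l\<in>J. \<kappa> j l * x $ j * cnj (x $ l))"
    "\<And>x. f x = (\<Sum>l\<in>-J. cnj (x $ l) * Q l x) + (\<Sum>l\<in>J. cnj (x $ l) * P l (z_part k x))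
       + x $ k * (H x + \<i> * K x)"
proof -
  obtain P where P: "\<And>l. bihom 2 0 (P l)" "\<And>x. f x = (\<Sum>l\<in>UNIV. cnj (x $ l) * P l x)"
    using bihom_cnj_factor[of 2 0 f] assms by auto
  have "\<exists>c. \<forall>x. P l x = x $ k * (\<Sum>j\<in>UNIV. c j * x $ j) + P l (z_part k x)" for l
    by (rule bihom_quadratic_split[OF P(1)[of l], of k]) blast
  then obtain c where c: "\<And>l x. P l x = x $ k * (\<Sum>j\<in>UNIV. c l j * x $ j) + P l (z_part k x)" by metis
  define D where "D x = (\<Sum>l\<in>J. cnj (x $ l) * (\<Sum>j\<in>-J. c l j * x $ j))" for x
  define E where "E x = (\<Sum>l\<in>J. cnj (x $ l) * (\<Sum>j\<in>J. c l j * x $ j))" for x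
  have sesq: "bihom 1 1 (\<lambda>x. \<Sum>l\<in>A. cnj (x $ l) * (\<Sum>j\<in>B. c l j * x $ j))" for A B
  proof (rule bihom_sum)
    fix l
    show "bihom 1 1 (\<lambda>x. cnj (x $ l) * (\<Sum>j\<in>B. c l j * x $ j))"
    proof -
      have "bihom 1 0 (\<lambda>x. \<Sum>j\<in>B. c l j * x $ j)" by (intro bihom_sum bihom_scale bihom_coord)
      from bihom_mult[OF bihom_cnj_coord this, of l] show ?thesis by simp
    qed
  qed
  have hD: "bihom 1 1 D" "bihom 1 1 E" unfolding D_def[abs_def] E_def[abs_def] by (rule sesq)+
  \<comment> \<open>the Hermitian form \<open>(E - \<bar>E) / (2\<i>)\<close>, whose value is the imaginary part of \<open>E\<close>\<close>
  define \<kappa> where "\<kappa> j l = - (\<i> / 2) * (c l j - cnj (c j l))" for j l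
  \<comment> \<open>the subtracted terms are those of \<open>x\<^sub>k \<bar>D\<close>, sorted by their conjugate variable\<close>
  define Q where "Q l x = P l x - x $ k * (\<Sum>j\<in>J. cnj (c j l) * x $ j)" for l x
  have U: "sum g UNIV = sum g (-J) + sum g J" for g :: "'n \<Rightarrow> complex"
    using sum.union_disjoint[of "-J" J g] by (simp add: Compl_partition2)
  show ?thesis
  proof (rule that[of Q P "\<lambda>x. 2 * Re (D x) + Re (E x)" \<kappa> "\<lambda>x. Im (E x)"])
    show "bihom 2 0 (Q l)" for l
    proof -
      have "bihom 1 0 (\<lambda>x. \<Sum>j\<in>J. cnj (c j l) * x $ j)" by (intro bihom_sum bihom_scale bihom_coord)
      from bihom_mult[OF bihom_coord this, of k] show ?thesis
        unfolding Q_def[abs_def] by (intro bihom_diff P(1)) (simp add: numeral_2_eq_2)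
    qed
    show "bihom 2 0 (P l)" for l by (rule P(1))
    have "complex_of_real (2 * Re (D x) + Re (E x)) = (D x + cnj (D x)) + 1/2 * (E x + cnj (E x))" for x
      by (simp add: complex_eq_iff)
    moreover have "bihom 1 1 (\<lambda>x. (D x + cnj (D x)) + 1/2 * (E x + cnj (E x)))"
      by (intro bihom.add bihom_scale bihom_cnj hD)
    ultimately show "bihom 1 1 (\<lambda>x. complex_of_real (2 * Re (D x) + Re (E x)))" by simp
    show "\<kappa> l j = cnj (\<kappa> j l)" for j l
      by (simp add: \<kappa>_def complex_eq_iff algebra_simps)
    show "complex_of_real (Im (E x)) = (\<Sum>j\<in>J. \<Sum>l\<in>J. \<kappa> j l * x $ j * cnj (x $ l))" for x
    proof -
      have 1: "E x = (\<Sum>j\<in>J. \<Sum>l\<in>J. c l j * x $ j * cnj (x $ l))"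
        unfolding E_def by (subst sum.swap) (simp add: sum_distrib_left mult_ac)
      have 2: "cnj (E x) = (\<Sum>j\<in>J. \<Sum>l\<in>J. cnj (c j l) * x $ j * cnj (x $ l))"
        unfolding E_def by (simp add: sum_distrib_left mult_ac)
      have "complex_of_real (Im (E x)) = - (\<i> / 2) * (E x - cnj (E x))"
        by (simp add: complex_eq_iff)
      also have "\<dots> = (\<Sum>j\<in>J. \<Sum>l\<in>J. \<kappa> j l * x $ j * cnj (x $ l))"
        unfolding 2 unfolding 1
        by (simp add: \<kappa>_def sum_subtractf[symmetric] sum_distrib_left algebra_simps)
      finally show ?thesis .
    qed
    show "f x = (\<Sum>l\<in>-J. cnj (x $ l) * Q l x) + (\<Sum>l\<in>J. cnj (x $ l) * P l (z_part k x))
       + x $ k * (complex_of_real (2 * Re (D x) + Re (E x)) + \<i> * complex_of_real (Im (E x)))" for x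
    proof -
      have cD: "cnj (D x) = (\<Sum>l\<in>-J. cnj (x $ l) * (\<Sum>j\<in>J. cnj (c j l) * x $ j))"
        unfolding D_def by (simp add: sum_distrib_left) (subst sum.swap, simp add: mult_ac)
      have DE: "(\<Sum>l\<in>J. cnj (x $ l) * (\<Sum>j\<in>UNIV. c l j * x $ j)) = D x + E x"
        unfolding U by (simp add: D_def E_def sum.distrib algebra_simps)
      have "complex_of_real (2 * Re (D x) + Re (E x)) + \<i> * complex_of_real (Im (E x)) = D x + E x + cnj (D x)"
        by (simp add: complex_eq_iff)
      moreover have "(\<Sum>l\<in>J. cnj (x $ l) * P l x) = x $ k * (D x + E x) + (\<Sum>l\<in>J. cnj (x $ l) * P l (z_part k x))"
      proof -
        have "(\<Sum>l\<in>J. cnj (x $ l) * P l x)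
          = (\<Sum>l\<in>J. cnj (x $ l) * (x $ k * (\<Sum>j\<in>UNIV. c l j * x $ j) + P l (z_part k x)))"
          by (rule sum.cong[OF refl]) (simp only: c[of _ x, symmetric])
        then show ?thesis unfolding DE[symmetric]
          by (simp add: sum.distrib sum_distrib_left distrib_left mult.left_commute)
      qed
      moreover have "(\<Sum>l\<in>-J. cnj (x $ l) * Q l x) = (\<Sum>l\<in>-J. cnj (x $ l) * P l x) - x $ k * cnj (D x)"
        unfolding cD Q_def by (simp add: sum_distrib_left right_diff_distrib sum_subtractf mult_ac)
      ultimately show ?thesis unfolding P(2)[of x] U by (simp add: algebra_simps)
    qed
  qed
qed

text \<open>The algebra of the normal form, with the polynomials replaced by independent variables. The
  right-hand side consists of products of total order at least 4.\<close>

lemma cubic_identity: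
  fixes xk \<alpha> lam A B q SQ BP :: complex and h H K :: real
  defines "\<beta> \<equiv> \<alpha> - lam * xk"
  defines "A' \<equiv> A - lam * \<beta> - xk * q"
  defines "n2 \<equiv> 2 * Re \<beta> + h"
  defines "n3 \<equiv> 2 * Re A' + 2 * Re SQ + 2 * Re BP + 2 * Re (\<i> * xk) * K"
  assumes B: "B - cnj lam * \<beta> - lam * h = cnj xk * q + SQ + BP + xk * (H + \<i> * K)"
  shows "2 * Re xk + (2 * Re \<alpha> + h + 2 * Re (xk * cnj lam)) + 2 * Re A + 2 * Re B
      - (1 + 2 * Re lam + (H + 2 * Re q)) * (2 * Re xk + n2 + n3)
    = - (2 * Re lam * n3 + (H + 2 * Re q) * (n2 + n3))"
proof -
  have "B = cnj lam * \<beta> + lam * h + (cnj xk * q + SQ + BP + xk * (H + \<i> * K))"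
    using B by (simp add: algebra_simps)
  then have "Re B = Re (cnj lam * \<beta>) + Re lam * h + Re (cnj xk * q) + Re SQ + Re BP + Re xk * H - Im xk * K"
    by simp
  then show ?thesis
    unfolding n2_def n3_def A'_def \<beta>_def by (simp add: algebra_simps)
qed

text \<open>The normal form \<open>2 Re w + h\<^sub>0 + 2 Re B' + K u\<close>, before \<open>K\<close> has been diagonalised.\<close>

definition model_function ::
  "'n::finite \<Rightarrow> 'n set \<Rightarrow> 'n set \<Rightarrow> ('n \<Rightarrow> real) \<Rightarrow> ('n \<Rightarrow> complex^'n \<Rightarrow> complex) \<Rightarrow> (complex^'n \<Rightarrow> real) \<Rightarrow>
     complex^'n \<Rightarrow> real" where
  "model_function k J\<^sub>2 J\<^sub>3 s P K y = 2 * Re (y $ k) + phi2 J\<^sub>2 s y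
     + 2 * Re (\<Sum>l\<in>J\<^sub>3. cnj (y $ l) * P l (z_part k y)) + 2 * Re (\<i> * y $ k) * K y"

lemma bihom_model_cubic:
  assumes P: "\<And>l. bihom 2 0 (P l)"
    and K: "\<And>x. complex_of_real (K x) = (\<Sum>j\<in>J. \<Sum>l\<in>J. \<kappa> j l * x $ j * cnj (x $ l))"
  shows "bihom 2 1 (\<lambda>y. (\<Sum>l\<in>J. cnj (y $ l) * P l (z_part k y)) + \<i> * y $ k * K y)"
proof (rule bihom.add)
  have "bihom 2 1 (\<lambda>y. cnj (y $ l) * P l (z_part k y))" for l
    using bihom_mult[OF bihom_cnj_coord[of l] bihom_compose[OF bihom_z_part[of k] P[of l]]] by (simp add: numeral_2_eq_2)
  then show "bihom 2 1 (\<lambda>y. \<Sum>l\<in>J. cnj (y $ l) * P l (z_part k y))" by (rule bihom_sum)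
  have "bihom 1 1 (\<lambda>x. x $ j * cnj (x $ l))" for j l
    using bihom_mult[OF bihom_coord bihom_cnj_coord, of j l] by simp
  then have "bihom 1 1 (\<lambda>x. complex_of_real (K x))" unfolding K mult.assoc by (intro bihom_sum bihom_scale)
  from bihom_mult[OF bihom_scale[OF bihom_coord[of k], of \<i>] this]
  show "bihom 2 1 (\<lambda>y. \<i> * y $ k * K y)" by (simp add: numeral_2_eq_2)
qed

lemma model_function_perturb:
  assumes P: "\<And>l. bihom 2 0 (P l)"
    and K: "\<And>x. complex_of_real (K x) = (\<Sum>j\<in>J\<^sub>3. \<Sum>l\<in>J\<^sub>3. \<kappa> j l * x $ j * cnj (x $ l))"
    and y: "vanishing 1 y" and e: "vanishing 4 e"
  shows "vanishing 4 (\<lambda>x. model_function k J\<^sub>2 J\<^sub>3 s P K (y x + e x) - model_function k J\<^sub>2 J\<^sub>3 s P K (y x))"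
proof -
  define G where "G y = (\<Sum>l\<in>J\<^sub>3. cnj (y $ l) * P l (z_part k y)) + \<i> * y $ k * K y" for y
  have hG: "bihom 2 1 G" unfolding G_def[abs_def] by (rule bihom_model_cubic[OF P K])
  have model: "model_function k J\<^sub>2 J\<^sub>3 s P K y = 2 * Re (y $ k) + Re (complex_of_real (phi2 J\<^sub>2 s y)) + 2 * Re (G y)" for y
    unfolding model_function_def G_def by simp
  have "vanishing 4 (\<lambda>x. (y x + e x) $ k - y x $ k)"
    by (rule vanishing_mono[OF bihom_perturb[OF bihom_coord y e]]) simp_all
  moreover have "vanishing 4 (\<lambda>x. complex_of_real (phi2 J\<^sub>2 s (y x + e x)) - complex_of_real (phi2 J\<^sub>2 s (y x)))"
    by (rule vanishing_mono[OF bihom_perturb[OF bihom_phi2 y e]]) simp_all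
  moreover have "vanishing 4 (\<lambda>x. G (y x + e x) - G (y x))"
    by (rule vanishing_mono[OF bihom_perturb[OF hG y e]]) simp_all
  ultimately have "vanishing 4 (\<lambda>x. 2 * Re ((y x + e x) $ k - y x $ k)
    + Re (complex_of_real (phi2 J\<^sub>2 s (y x + e x)) - complex_of_real (phi2 J\<^sub>2 s (y x)))
    + 2 * Re (G (y x + e x) - G (y x)))"
    by (intro vanishing_add[OF vanishing_add[OF vanishing_real_mult[OF vanishing_Re] vanishing_Re]
          vanishing_real_mult[OF vanishing_Re]])
  then show ?thesis unfolding model by (simp add: algebra_simps)
qed

text \<open>The central step. All terms up to third order are matched by the choice of \<open>m\<close> and \<open>a\<close>; the
  errors are the products in \<open>cubic_identity\<close> and those made in evaluating the normal form at the
  perturbed argument \<open>x + a(x)\<close>.\<close>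

lemma cubic_normal_form:
  fixes k :: "'n::finite"
  assumes part: "k \<notin> J\<^sub>2" "insert k J\<^sub>2 = -J\<^sub>3"
    and s: "\<And>j. j \<in> J\<^sub>2 \<Longrightarrow> s j \<in> {-1, 1}"
    and hps: "bihom 2 0 \<alpha>" "bihom 3 0 A" "bihom 2 1 B" "bihom 1 0 lam"
  obtains a :: "complex^'n \<Rightarrow> complex^'n" and m P \<kappa> K where
    "\<And>i. \<exists>a2 a3. bihom 2 0 a2 \<and> bihom 3 0 a3 \<and> (\<forall>x. a x $ i = a2 x + a3 x)"
    "(m \<longlongrightarrow> 1) (nhds 0)" "\<And>l. bihom 2 0 (P l)" "\<And>j l. \<kappa> l j = cnj (\<kappa> j l)"
    "\<And>x. complex_of_real (K x) = (\<Sum>j\<in>J\<^sub>3. \<Sum>l\<in>J\<^sub>3. \<kappa> j l * x $ j * cnj (x $ l))"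
    "vanishing 4 (\<lambda>x. 2 * Re (x $ k) + (2 * Re (\<alpha> x) + phi2 J\<^sub>2 s x + 2 * Re (x $ k * cnj (lam x)))
        + 2 * Re (A x) + 2 * Re (B x) - m x * model_function k J\<^sub>2 J\<^sub>3 s P K (x + a x))"
proof -
  \<comment> \<open>The term \<open>2 Re \<lambda> \<cdot> 2 Re x\<^sub>k\<close> produced by the factor \<open>m\<close> equals
     \<open>2 Re (x\<^sub>k \<bar>\<lambda>) + 2 Re (\<lambda> x\<^sub>k)\<close>; its holomorphic part is compensated in \<open>w\<close>.\<close>
  define \<beta> where "\<beta> x = \<alpha> x - lam x * x $ k" for x
  have h\<beta>: "bihom 2 0 \<beta>" unfolding \<beta>_def[abs_def]
    using bihom_diff[OF hps(1)] bihom_mult[OF hps(4) bihom_coord[of k]] by (simp add: numeral_2_eq_2)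
  have "bihom 2 1 (\<lambda>x. cnj (lam x) * \<beta> x)" "bihom 2 1 (\<lambda>x. lam x * complex_of_real (phi2 J\<^sub>2 s x))"
    using bihom_mult[OF bihom_cnj[OF hps(4)] h\<beta>] bihom_mult[OF hps(4) bihom_phi2] by (simp_all add: numeral_2_eq_2)
  then have "bihom 2 1 (\<lambda>x. B x - cnj (lam x) * \<beta> x - lam x * complex_of_real (phi2 J\<^sub>2 s x))"
    by (intro bihom_diff hps(3))
  then obtain Q P H K \<kappa> where Q: "\<And>l. bihom 2 0 (Q l)" and P: "\<And>l. bihom 2 0 (P l)"
    and H: "bihom 1 1 (\<lambda>x. complex_of_real (H x))" and \<kappa>: "\<And>j l. \<kappa> l j = cnj (\<kappa> j l)"
    and K: "\<And>x. complex_of_real (K x) = (\<Sum>j\<in>J\<^sub>3. \<Sum>l\<in>J\<^sub>3. \<kappa> j l * x $ j * cnj (x $ l))"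
    and dec: "\<And>x. B x - cnj (lam x) * \<beta> x - lam x * complex_of_real (phi2 J\<^sub>2 s x)
       = (\<Sum>l\<in>-J\<^sub>3. cnj (x $ l) * Q l x) + (\<Sum>l\<in>J\<^sub>3. cnj (x $ l) * P l (z_part k x))
       + x $ k * (H x + \<i> * K x)"
    by (rule bihom_21_decompose[of _ J\<^sub>3 k]) (rule that)
  define SQ where "SQ x = (\<Sum>l\<in>J\<^sub>2. cnj (x $ l) * Q l x)" for x
  define BP where "BP x = (\<Sum>l\<in>J\<^sub>3. cnj (x $ l) * P l (z_part k x))" for x
  define G where "G y = BP y + \<i> * y $ k * K y" for y
  \<comment> \<open>\<open>\<lambda>\<beta>\<close> and \<open>x\<^sub>k Q\<^sub>k\<close> are the pluriharmonic terms of third order that \<open>m\<close> creates\<close>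
  define A' where "A' x = A x - lam x * \<beta> x - x $ k * Q k x" for x
  define a :: "complex^'n \<Rightarrow> complex^'n" where
    "a x = (\<chi> i. if i = k then \<beta> x + A' x else if i \<in> J\<^sub>2 then s i * Q i x else 0)" for x
  define m where "m x = 1 + 2 * Re (lam x) + (H x + 2 * Re (Q k x))" for x
  \<comment> \<open>second- and third-order part of the normal form at \<open>x + a(x)\<close>, and the remainder\<close>
  define n2 where "n2 x = 2 * Re (\<beta> x) + phi2 J\<^sub>2 s x" for x
  define n3 where "n3 x = 2 * Re (A' x) + 2 * Re (SQ x) + 2 * Re (BP x) + 2 * Re (\<i> * x $ k) * K x" for x
  define r where "r x = (\<Sum>j\<in>J\<^sub>2. s j * (cmod (Q j x))\<^sup>2) + 2 * Re (G (x + a x) - G x)" for x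
  have hA': "bihom 3 0 A'"
    using bihom_diff[OF bihom_diff[OF hps(2)]] bihom_mult[OF hps(4) h\<beta>] bihom_mult[OF bihom_coord Q, of k k]
    unfolding A'_def[abs_def] by (simp add: numeral_eq_Suc)
  have hG: "bihom 2 1 G" unfolding G_def[abs_def] BP_def by (rule bihom_model_cubic[OF P K])
  have a_hp: "\<exists>a2 a3. bihom 2 0 a2 \<and> bihom 3 0 a3 \<and> (\<forall>x. a x $ i = a2 x + a3 x)" for i
  proof (cases "i = k")
    case True
    then show ?thesis using h\<beta> hA' by (intro exI[of _ \<beta>] exI[of _ A']) (simp add: a_def)
  next
    case False
    have "bihom 2 0 (\<lambda>x. (if i \<in> J\<^sub>2 then complex_of_real (s i) else 0) * Q i x)" by (rule bihom_scale[OF Q])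
    with False bihom_zero[of 3 0] show ?thesis
      by (intro exI[of _ "\<lambda>x. (if i \<in> J\<^sub>2 then complex_of_real (s i) else 0) * Q i x"] exI[of _ "\<lambda>x. 0"])
        (simp add: a_def)
  qed
  have a_van: "vanishing 2 a" by (rule bihom_2_3_vanishing[OF a_hp])
  have phi2_shift: "phi2 J\<^sub>2 s (x + a x) = phi2 J\<^sub>2 s x + 2 * Re (SQ x) + (\<Sum>j\<in>J\<^sub>2. s j * (cmod (Q j x))\<^sup>2)" for x
  proof -
    have "s j * (cmod ((x + a x) $ j))\<^sup>2 = s j * (cmod (x $ j))\<^sup>2 + 2 * Re (cnj (x $ j) * Q j x) + s j * (cmod (Q j x))\<^sup>2"
      if "j \<in> J\<^sub>2" for j
    proof -
      have "j \<noteq> k" using that part(1) by auto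
      then have "(x + a x) $ j = x $ j + s j * Q j x" using that by (simp add: a_def)
      moreover have "s j = 1 \<or> s j = -1" using s[OF that] by auto
      moreover have "(cmod (u + v))\<^sup>2 = (cmod u)\<^sup>2 + 2 * Re (cnj u * v) + (cmod v)\<^sup>2" for u v
        unfolding cmod_power2 by (simp add: power2_eq_square algebra_simps)
      moreover have "(cmod (u - v))\<^sup>2 = (cmod u)\<^sup>2 - 2 * Re (cnj u * v) + (cmod v)\<^sup>2" for u v
        unfolding cmod_power2 by (simp add: power2_eq_square algebra_simps)
      ultimately show ?thesis by (elim disjE) simp_all
    qed
    then show ?thesis
      unfolding phi2_def SQ_def by (simp add: sum.distrib sum_distrib_left)
  qed
  have model: "model_function k J\<^sub>2 J\<^sub>3 s P K (x + a x) = 2 * Re (x $ k) + n2 x + n3 x + r x" for x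
  proof -
    have eq: "model_function k J\<^sub>2 J\<^sub>3 s P K y = 2 * Re (y $ k) + phi2 J\<^sub>2 s y + 2 * Re (G y)" for y
      unfolding model_function_def G_def BP_def by simp
    have "Re ((x + a x) $ k) = Re (x $ k) + Re (\<beta> x) + Re (A' x)" by (simp add: a_def)
    moreover have "2 * Re (G x) = 2 * Re (BP x) + 2 * Re (\<i> * x $ k) * K x" by (simp add: G_def)
    ultimately show ?thesis unfolding eq phi2_shift by (simp add: n2_def n3_def r_def)
  qed
  have "sum g (-J\<^sub>3) = g k + sum g J\<^sub>2" for g :: "'n \<Rightarrow> complex"
    unfolding part(2)[symmetric] using part(1) by simp
  then have dec': "B x - cnj (lam x) * \<beta> x - lam x * complex_of_real (phi2 J\<^sub>2 s x)
     = cnj (x $ k) * Q k x + SQ x + BP x + x $ k * (H x + \<i> * K x)" for x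
    unfolding dec by (simp add: SQ_def BP_def)
  have identity: "2 * Re (x $ k) + (2 * Re (\<alpha> x) + phi2 J\<^sub>2 s x + 2 * Re (x $ k * cnj (lam x)))
        + 2 * Re (A x) + 2 * Re (B x) - m x * model_function k J\<^sub>2 J\<^sub>3 s P K (x + a x)
      = - (2 * Re (lam x) * n3 x + (H x + 2 * Re (Q k x)) * (n2 x + n3 x)) - m x * r x" for x
    using cubic_identity[OF dec'[of x, unfolded \<beta>_def]]
    unfolding model m_def n2_def n3_def A'_def \<beta>_def by (simp add: algebra_simps)
  have v_lam: "vanishing 1 (\<lambda>x. 2 * Re (lam x))"
    using vanishing_real_mult[OF bihom_vanishing_Re[OF hps(4)]] by simp
  have v: "vanishing 2 H" "vanishing 2 (\<lambda>x. Re (Q k x))" "vanishing 2 (\<lambda>x. Re (\<beta> x))"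
    "vanishing 2 (phi2 J\<^sub>2 s)"
    using bihom_vanishing_Re[OF H] bihom_vanishing_Re[OF Q[of k]] bihom_vanishing_Re[OF h\<beta>]
      bihom_vanishing_Re[OF bihom_phi2[of J\<^sub>2 s]] by (simp_all add: numeral_2_eq_2)
  have v_H: "vanishing 2 (\<lambda>x. H x + 2 * Re (Q k x))"
    by (rule vanishing_add[OF v(1) vanishing_real_mult[OF v(2)]])
  have v_n2: "vanishing 2 n2"
    unfolding n2_def[abs_def] by (rule vanishing_add[OF vanishing_real_mult[OF v(3)] v(4)])
  have hSQ: "bihom 2 1 SQ" unfolding SQ_def[abs_def]
    using bihom_mult[OF bihom_cnj_coord Q] by (intro bihom_sum) (simp add: numeral_2_eq_2)
  have n3: "n3 x = 2 * Re (A' x) + 2 * Re (SQ x) + 2 * Re (G x)" for x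
    by (simp add: n3_def G_def)
  have "vanishing 3 (\<lambda>x. Re (A' x))" "vanishing 3 (\<lambda>x. Re (SQ x))" "vanishing 3 (\<lambda>x. Re (G x))"
    using bihom_vanishing_Re[OF hA'] bihom_vanishing_Re[OF hSQ] bihom_vanishing_Re[OF hG] by simp_all
  then have v_n3: "vanishing 3 n3" unfolding n3[abs_def] by (intro vanishing_add vanishing_real_mult)
  have m1: "vanishing 1 (\<lambda>x. m x - 1)"
    unfolding m_def using vanishing_add[OF v_lam vanishing_mono[OF v_H]] by simp
  have v_m: "vanishing 0 m"
    using vanishing_add[OF vanishing_mono[OF m1, of 0] vanishing_const[of 1]] by simp
  have v_r: "vanishing 4 r"
  proof -
    have "vanishing 4 (\<lambda>x. G (x + a x) - G x)"
      using bihom_perturb[OF hG vanishing_id a_van] by simp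
    moreover have "vanishing 4 (\<lambda>x. s j * (cmod (Q j x))\<^sup>2)" for j
    proof -
      have "vanishing 2 (\<lambda>x. cmod (Q j x))"
        by (rule vanishing_norm_le[of _ "Q j"]) (use bihom_vanishing[OF Q[of j]] in simp_all)
      from vanishing_real_mult[OF vanishing_mult[OF this this]] show ?thesis
        by (simp add: power2_eq_square)
    qed
    ultimately show ?thesis unfolding r_def[abs_def]
      by (intro vanishing_add[OF vanishing_sum vanishing_real_mult[OF vanishing_Re]])
  qed
  show ?thesis
  proof (rule that[of a m P \<kappa> K])
    have "((\<lambda>x. m x - 1 + 1) \<longlongrightarrow> 0 + 1) (nhds 0)"
      by (intro tendsto_add vanishing_tendsto[OF m1] tendsto_const) simp
    then show "(m \<longlongrightarrow> 1) (nhds 0)" by simp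
    have "vanishing 4 (\<lambda>x. 2 * Re (lam x) * n3 x)"
      using vanishing_mult[OF v_lam v_n3] by simp
    moreover have "vanishing 4 (\<lambda>x. (H x + 2 * Re (Q k x)) * (n2 x + n3 x))"
      using vanishing_mult[OF v_H vanishing_add[OF v_n2 vanishing_mono[OF v_n3, of 2]]] by simp
    moreover have "vanishing 4 (\<lambda>x. m x * r x)"
      using vanishing_mult[OF v_m v_r] by simp
    ultimately show "vanishing 4 (\<lambda>x. 2 * Re (x $ k) + (2 * Re (\<alpha> x) + phi2 J\<^sub>2 s x + 2 * Re (x $ k * cnj (lam x)))
        + 2 * Re (A x) + 2 * Re (B x) - m x * model_function k J\<^sub>2 J\<^sub>3 s P K (x + a x))"
      unfolding identity by (intro vanishing_diff vanishing_uminus vanishing_add)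
  qed (fact a_hp P \<kappa> K)+
qed

section \<open>Polynomial changes of coordinates\<close>

text \<open>Besides holomorphy, smoothness is recorded in the sense of \<open>smooth_on\<close>, since the map is
  composed with a defining function that is only smooth.\<close>

definition smooth_holomorphic :: "(complex^'n::finite \<Rightarrow> complex^'m::finite) \<Rightarrow> bool" where
  "smooth_holomorphic f \<longleftrightarrow> smooth_on UNIV f \<and>
     (\<forall>x. \<exists>f'. (f has_derivative f') (at x) \<and> (\<forall>c v. f' (c *s v) = c *s f' v))"

lemma smooth_holomorphic_derivative:
  assumes "smooth_holomorphic f"
  obtains f' where "(f has_derivative f') (at x)" "\<And>c v. f' (c *s v) = c *s f' v"
  using assms unfolding smooth_holomorphic_def by blast

lemma smooth_holomorphic_compose:
  assumes "smooth_holomorphic g" "smooth_holomorphic f"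
  shows "smooth_holomorphic (\<lambda>x. g (f x))"
  unfolding smooth_holomorphic_def
proof (intro conjI allI)
  show "smooth_on UNIV (\<lambda>x. g (f x))"
    by (rule smooth_on_compose[of UNIV UNIV]) (use assms in \<open>auto simp: smooth_holomorphic_def\<close>)
  fix x
  obtain f' where f': "(f has_derivative f') (at x)" "\<And>c v. f' (c *s v) = c *s f' v"
    using smooth_holomorphic_derivative[OF assms(2)] by blast
  obtain g' where g': "(g has_derivative g') (at (f x))" "\<And>c v. g' (c *s v) = c *s g' v"
    using smooth_holomorphic_derivative[OF assms(1)] by blast
  have "(g \<circ> f has_derivative g' \<circ> f') (at x)" by (rule diff_chain_at[OF f'(1) g'(1)])
  then show "\<exists>h'. ((\<lambda>x. g (f x)) has_derivative h') (at x) \<and> (\<forall>c v. h' (c *s v) = c *s h' v)"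
    using f'(2) g'(2) by (intro exI[of _ "g' \<circ> f'"]) (simp add: o_def)
qed

lemma bounded_linear_axis: "bounded_linear (axis i :: complex \<Rightarrow> complex^'n)"
  by (rule linear_conv_bounded_linear[THEN iffD1]) (auto intro!: linearI simp: axis_def vec_eq_iff)

lemma smooth_holomorphic_vec:
  fixes f :: "complex^'n \<Rightarrow> complex^'m"
  assumes sm: "\<And>i. smooth_on UNIV (\<lambda>x. f x $ i)"
    and hol: "\<And>i x. \<exists>f'. ((\<lambda>x. f x $ i) has_derivative f') (at x) \<and> (\<forall>c v. f' (c *s v) = c * f' v)"
  shows "smooth_holomorphic f"
  unfolding smooth_holomorphic_def
proof (intro conjI allI)
  have f: "(\<lambda>x. \<Sum>i\<in>UNIV. axis i (f x $ i)) = f"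
    by (auto simp: fun_eq_iff vec_eq_iff axis_def)
  have "smooth_on UNIV (\<lambda>x. \<Sum>i\<in>UNIV. axis i (f x $ i))"
    by (intro smooth_on_sum open_UNIV smooth_on_linear_compose[OF open_UNIV bounded_linear_axis sm])
  then show "smooth_on UNIV f" by (simp only: f)
  fix x
  have "\<forall>i. \<exists>f'. ((\<lambda>x. f x $ i) has_derivative f') (at x) \<and> (\<forall>c v. f' (c *s v) = c * f' v)"
    using hol by blast
  from choice[OF this] obtain f'
    where f': "\<And>i. ((\<lambda>x. f x $ i) has_derivative f' i) (at x)" "\<And>i c v. f' i (c *s v) = c * f' i v"
    by blast
  have "((\<lambda>x. \<Sum>i\<in>UNIV. axis i (f x $ i)) has_derivative (\<lambda>v. \<Sum>i\<in>UNIV. axis i (f' i v))) (at x)"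
    by (intro has_derivative_sum bounded_linear.has_derivative[OF bounded_linear_axis f'(1)])
  then have "(f has_derivative (\<lambda>v. \<Sum>i\<in>UNIV. axis i (f' i v))) (at x)" by (simp only: f)
  moreover have "(\<Sum>i\<in>UNIV. axis i (f' i (c *s v))) = c *s (\<Sum>i\<in>UNIV. axis i (f' i v))" for c v
    by (simp add: f'(2) vec_eq_iff axis_def)
  ultimately show "\<exists>f'. (f has_derivative f') (at x) \<and> (\<forall>c v. f' (c *s v) = c *s f' v)" by blast
qed

text \<open>Iterating \<open>F \<mapsto> id - a \<circ> F\<close>, starting from the identity, gains one order in each step because
  \<open>a\<close> starts in degree 2. Two iterations give an inverse of \<open>id + a\<close> up to fourth order which is
  still a polynomial.\<close>

lemma truncated_inverse:
  fixes a :: "complex^'n \<Rightarrow> complex^'n"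
  assumes a: "\<And>i. \<exists>a2 a3. bihom 2 0 a2 \<and> bihom 3 0 a3 \<and> (\<forall>x. a x $ i = a2 x + a3 x)"
  obtains F :: "complex^'n \<Rightarrow> complex^'n" where "smooth_holomorphic F"
    "vanishing 2 (\<lambda>x. F x - x)" "vanishing 4 (\<lambda>x. F x + a (F x) - x)"
proof -
  have perturb: "vanishing (1 + e) (\<lambda>x. a (y x + b x) - a (y x))"
    if "vanishing 1 y" "vanishing e b" "e \<ge> 1" for e and y b :: "complex^'n \<Rightarrow> complex^'n"
  proof (rule vanishing_vec)
    fix i
    obtain a2 a3 where a23: "bihom 2 0 a2" "bihom 3 0 a3" "\<And>x. a x $ i = a2 x + a3 x" using a by blast
    have "vanishing (1 + e) (\<lambda>x. a2 (y x + b x) - a2 (y x))" "vanishing (1 + e) (\<lambda>x. a3 (y x + b x) - a3 (y x))"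
      using bihom_perturb[OF a23(1) that] vanishing_mono[OF bihom_perturb[OF a23(2) that], of "1 + e"] by auto
    from vanishing_add[OF this] show "vanishing (1 + e) (\<lambda>x. (a (y x + b x) - a (y x)) $ i)"
      by (simp add: a23(3) algebra_simps)
  qed
  have a_van: "vanishing 2 a" by (rule bihom_2_3_vanishing[OF a])
  have sh: "smooth_holomorphic (\<lambda>x. x - a (f x))" if f: "smooth_holomorphic f" for f :: "complex^'n \<Rightarrow> complex^'n"
  proof -
    have "smooth_holomorphic a"
    proof (rule smooth_holomorphic_vec)
      fix i
      obtain a2 a3 where a23: "bihom 2 0 a2" "bihom 3 0 a3" "\<And>x. a x $ i = a2 x + a3 x" using a by blast
      have h: "(\<lambda>x. a x $ i) = (\<lambda>x. a2 x + a3 x)" using a23(3) by blast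
      show "smooth_on UNIV (\<lambda>x. a x $ i)" unfolding h
        by (intro smooth_on_add bihom_smooth[OF a23(1)] bihom_smooth[OF a23(2)]) simp
      fix x
      obtain f' g' where "(a2 has_derivative f') (at x)" "\<And>c v. f' (c *s v) = c * f' v"
        "(a3 has_derivative g') (at x)" "\<And>c v. g' (c *s v) = c * g' v"
        using bihom_holomorphic[OF a23(1) refl, of x] bihom_holomorphic[OF a23(2) refl, of x] by blast
      then show "\<exists>f'. ((\<lambda>x. a x $ i) has_derivative f') (at x) \<and> (\<forall>c v. f' (c *s v) = c * f' v)"
        unfolding h by (intro exI[of _ "\<lambda>v. f' v + g' v"]) (auto simp: algebra_simps intro: has_derivative_add)
    qed
    then have af: "smooth_holomorphic (\<lambda>x. a (f x))" using f by (rule smooth_holomorphic_compose)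
    show ?thesis unfolding smooth_holomorphic_def
    proof (intro conjI allI)
      have "smooth_on UNIV (\<lambda>x. x + - (a (f x)))"
        using af unfolding smooth_holomorphic_def
        by (intro smooth_on_add[OF open_UNIV smooth_on_bounded_linear[OF open_UNIV bounded_linear_ident]]
            smooth_on_linear_compose[OF open_UNIV bounded_linear_minus[OF bounded_linear_ident]]) blast
      then show "smooth_on UNIV (\<lambda>x. x - a (f x))" by simp
      fix x
      obtain f' where f': "((\<lambda>x. a (f x)) has_derivative f') (at x)" "\<And>c v. f' (c *s v) = c *s f' v"
        using smooth_holomorphic_derivative[OF af] by blast
      have "((\<lambda>x. x - a (f x)) has_derivative (\<lambda>v. v - f' v)) (at x)"
        by (intro has_derivative_diff has_derivative_ident f')
      then show "\<exists>f'. ((\<lambda>x. x - a (f x)) has_derivative f') (at x) \<and> (\<forall>c v. f' (c *s v) = c *s f' v)"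
        using f'(2) by (intro exI[of _ "\<lambda>v. v - f' v"]) (simp add: vec_eq_iff algebra_simps)
    qed
  qed
  define F2 where "F2 x = x - a x" for x
  define F3 where "F3 x = x - a (F2 x)" for x
  have id: "smooth_holomorphic (\<lambda>x::complex^'n. x)"
    unfolding smooth_holomorphic_def
    by (auto intro!: smooth_on_bounded_linear bounded_linear_ident has_derivative_ident exI[of _ "\<lambda>x. x"])
  have sh2: "smooth_holomorphic F2" unfolding F2_def[abs_def] by (rule sh[OF id])
  have v2: "vanishing 1 F2" unfolding F2_def[abs_def]
    by (intro vanishing_diff vanishing_id vanishing_mono[OF a_van]) simp
  have "vanishing 3 (\<lambda>x. a (x + - a x) - a x)"
    using perturb[OF vanishing_id vanishing_uminus[OF a_van]] by (simp add: numeral_eq_Suc)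
  from vanishing_uminus[OF this] have v32: "vanishing 3 (\<lambda>x. F3 x - F2 x)"
    by (simp add: F3_def F2_def)
  from perturb[OF v2 this] have "vanishing 4 (\<lambda>x. a (F3 x) - a (F2 x))" by simp
  then have "vanishing 4 (\<lambda>x. F3 x + a (F3 x) - x)" by (simp add: F3_def)
  moreover have "vanishing 2 (\<lambda>x. F3 x - x)"
    using vanishing_diff[OF vanishing_mono[OF v32, of 2] a_van] by (simp add: F2_def)
  moreover have "smooth_holomorphic F3" unfolding F3_def[abs_def] by (rule sh[OF sh2])
  ultimately show ?thesis by (intro that)
qed

definition lin_map :: "('n \<Rightarrow> complex^'m) \<Rightarrow> complex^'n \<Rightarrow> complex^'m" where
  "lin_map b x = (\<Sum>i\<in>UNIV. x $ i *s b i)"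

lemma lin_map_add: "lin_map b (x + y) = lin_map b x + lin_map b y"
  by (simp add: lin_map_def vec.scale_left_distrib sum.distrib)

lemma lin_map_scale: "lin_map b (c *s x) = c *s lin_map b x"
  by (simp add: lin_map_def vec.scale_sum_right)

lemma lin_map_nth: "lin_map b x $ j = (\<Sum>i\<in>UNIV. b i $ j * x $ i)"
  by (simp add: lin_map_def mult.commute)

lemma bihom_lin_map: "bihom 1 0 (\<lambda>x. lin_map b x $ j)"
  unfolding lin_map_nth by (intro bihom_sum bihom_scale bihom_coord)

lemma bounded_linear_lin_map: "bounded_linear (lin_map b)"
  unfolding linear_conv_bounded_linear[symmetric]
proof (rule linearI)
  show "lin_map b (r *\<^sub>R x) = r *\<^sub>R lin_map b x" for r x
    by (simp add: vec_eq_iff lin_map_nth scaleR_sum_right)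
qed (rule lin_map_add)

lemma smooth_holomorphic_lin_map: "smooth_holomorphic (\<lambda>x. c + lin_map b x)"
  unfolding smooth_holomorphic_def
proof (intro conjI allI)
  show "smooth_on UNIV (\<lambda>x. c + lin_map b x)"
    by (intro smooth_on_add[OF open_UNIV smooth_on_const smooth_on_bounded_linear[OF open_UNIV bounded_linear_lin_map]])
  fix x
  have "((\<lambda>x. c + lin_map b x) has_derivative (\<lambda>v. 0 + lin_map b v)) (at x)"
    by (intro has_derivative_add has_derivative_const bounded_linear_imp_has_derivative bounded_linear_lin_map)
  then show "\<exists>f'. ((\<lambda>x. c + lin_map b x) has_derivative f') (at x) \<and> (\<forall>a v. f' (a *s v) = a *s f' v)"
    by (intro exI[of _ "lin_map b"]) (simp add: lin_map_scale)
qed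

section \<open>From an expansion of a defining function to a graph\<close>

lemma vec_linearI:
  fixes f :: "complex^'n \<Rightarrow> complex^'m"
  assumes "\<And>x y. f (x + y) = f x + f y" "\<And>c x. f (c *s x) = c *s f x"
  shows "Vector_Spaces.linear (*s) (*s) f"
  by unfold_locales (use assms in auto)

text \<open>The point with given \<open>z\<close>, \<open>u = \<i>(w - \<bar>w)\<close> and \<open>t = w + \<bar>w\<close>, that is with
  \<open>w = (t - \<i>u)/2\<close>.\<close>

definition graph_point :: "'n \<Rightarrow> ((complex^'n) \<times> real) \<times> real \<Rightarrow> complex^'n::finite" where
  "graph_point k v = z_part k (fst (fst v)) + axis k (Complex (snd v / 2) (- snd (fst v) / 2))"

lemma bounded_linear_graph_point: "bounded_linear (graph_point k)"
  unfolding linear_conv_bounded_linear[symmetric]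
  by (rule linearI)
    (auto simp: graph_point_def z_part_def axis_def vec_eq_iff complex_eq_iff field_simps)

lemma graph_point_simps:
  "z_part k (graph_point k ((z, u), t)) = z_part k z"
  "u_part k (graph_point k ((z, u), t)) = u"
  "Re (graph_point k ((z, u), t) $ k) = t / 2"
  by (auto simp: graph_point_def z_part_def u_part_def axis_def vec_eq_iff)

lemma graph_point_inverse: "graph_point k ((z_part k \<zeta>, u_part k \<zeta>), 2 * Re (\<zeta> $ k)) = \<zeta>"
  by (auto simp: graph_point_def z_part_def u_part_def axis_def vec_eq_iff complex_eq_iff)

lemma u_part_eq: "u_part k \<zeta> = 2 * Re (\<i> * \<zeta> $ k)"
  by (simp add: u_part_def)

lemma bounded_linear_z_part: "bounded_linear (z_part k)"
  unfolding linear_conv_bounded_linear[symmetric]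
  by (rule linearI) (auto simp: z_part_def vec_eq_iff)

lemma bounded_linear_u_part: "bounded_linear (u_part k)"
  unfolding linear_conv_bounded_linear[symmetric] u_part_eq[abs_def]
  by (rule linearI) (auto simp: algebra_simps)

text \<open>The expansion is used twice. On the graph of \<open>P\<close> the factor \<open>2 Re w - P\<close> vanishes, so
  that \<open>\<rho> \<circ> \<Phi>\<close> is of fourth order there. To first order the factor \<open>m\<close> tends to 1, which gives
  the nonzero derivative of \<open>\<rho> \<circ> \<Phi>\<close> in the direction of \<open>Re w\<close> that the implicit function
  theorem requires.\<close>

lemma hypersurface_graph:
  fixes \<Phi> :: "complex^'n \<Rightarrow> complex^'n" and P :: "(complex^'n) \<times> real \<Rightarrow> real"
  assumes ldf: "local_defining_function M p U \<rho>" and p: "p \<in> M"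
    and \<Phi>: "smooth_holomorphic \<Phi>" "\<Phi> 0 = p" "inj (frechet_derivative \<Phi> (at 0))"
    and P: "\<And>z u. P (z_part k z, u) = P (z, u)" "vanishing 2 P"
    and m: "(m \<longlongrightarrow> 1) (nhds 0)"
    and expansion: "vanishing 4 (\<lambda>\<zeta>. \<rho> (\<Phi> \<zeta>) - m \<zeta> * (2 * Re (\<zeta> $ k) - P (z_part k \<zeta>, u_part k \<zeta>)))"
  shows "\<exists>V Z A \<phi>. holomorphic_coordinates_at p V Z \<and> open A \<and> smooth_on A \<phi> \<and>
    (\<forall>x\<in>V. (z_part k (Z x), u_part k (Z x)) \<in> A \<and>
       (x \<in> M \<longleftrightarrow> Z x $ k + cnj (Z x $ k) = complex_of_real (\<phi> (z_part k (Z x), u_part k (Z x))))) \<and>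
    (\<lambda>y. \<phi> y - P y) \<in> O[at (0, 0)](\<lambda>y. norm y ^ 4)"
proof -
  have U: "open U" "p \<in> U" "smooth_on U \<rho>" "\<And>x. x \<in> U \<Longrightarrow> x \<in> M \<longleftrightarrow> \<rho> x = 0"
    using ldf by (auto simp: local_defining_function_def)
  have sm\<Phi>: "smooth_on UNIV \<Phi>" using \<Phi>(1) by (simp add: smooth_holomorphic_def)
  have d\<Phi>: "(\<Phi> has_derivative frechet_derivative \<Phi> (at x)) (at x)" for x
    by (rule smooth_on_has_derivative[OF sm\<Phi> UNIV_I])
  \<comment> \<open>the equation \<open>R((z, u), t) = 0\<close> is to be solved for \<open>t = w + \<bar>w\<close>\<close>
  define R where "R v = \<rho> (\<Phi> (graph_point k v))" for v
  define W where "W = {v. \<Phi> (graph_point k v) \<in> U}"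
  have sm: "smooth_on UNIV (\<lambda>v. \<Phi> (graph_point k v))"
    by (rule smooth_on_compose[of UNIV UNIV, OF _ _ _ sm\<Phi> smooth_on_bounded_linear[OF _ bounded_linear_graph_point]]) auto
  have W: "open W" unfolding W_def
    using open_vimage[OF U(1), of "\<lambda>v. \<Phi> (graph_point k v)"] smooth_on_continuous[OF sm] by (simp add: vimage_def)
  have smR: "smooth_on W R" unfolding R_def[abs_def]
    by (rule smooth_on_compose[OF W U(1) _ U(3) smooth_on_subset[OF sm]]) (auto simp: W_def)
  have g0: "graph_point k 0 = 0"
    by (rule linear_0[OF bounded_linear.linear[OF bounded_linear_graph_point]])
  have W0: "0 \<in> W" and R0: "R 0 = 0" using \<Phi>(2) U(2) U(4)[OF U(2)] p by (simp_all add: W_def R_def g0)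
  have P0: "P (0, 0) = 0" using vanishing_at_zero[OF P(2)] by (simp add: zero_prod_def)
  define e where "e \<zeta> = \<rho> (\<Phi> \<zeta>) - m \<zeta> * (2 * Re (\<zeta> $ k) - P (z_part k \<zeta>, u_part k \<zeta>))" for \<zeta>
  have e: "vanishing 4 e" unfolding e_def[abs_def] by (rule expansion)
  have R_eq: "R ((z, u), t) = m (graph_point k ((z, u), t)) * (t - P (z, u)) + e (graph_point k ((z, u), t))" for z u t
    by (simp add: e_def R_def graph_point_simps P(1))
  let ?D = "frechet_derivative R (at 0)"
  have "?D (0, 1) = 1"
  proof -
    let ?\<gamma> = "\<lambda>h. graph_point k ((0, 0), h)"
    have "((\<lambda>t. R (0 + t *\<^sub>R (0, 1))) has_real_derivative dir_deriv (0, 1) R (0 + 0 *\<^sub>R (0, 1))) (at 0)"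
      using W0 by (intro dir_deriv_line[OF smR]) (simp add: zero_prod_def)
    then have "((\<lambda>t. R ((0, 0), t)) has_real_derivative ?D (0, 1)) (at 0)"
      by (simp add: dir_deriv_def zero_prod_def)
    then have lim: "((\<lambda>h. (R ((0, 0), h) - R ((0, 0), 0)) / h) \<longlongrightarrow> ?D (0, 1)) (at 0)"
      by (simp add: DERIV_def)
    have bl: "bounded_linear ?\<gamma>"
      by (intro bounded_linear_compose[OF bounded_linear_graph_point] bounded_linear_Pair bounded_linear_zero
          bounded_linear_ident)
    have "vanishing 4 (\<lambda>h. e (?\<gamma> h))" by (rule vanishing_compose[OF e vanishing_bounded_linear[OF bl]])
    then obtain C where C: "\<forall>\<^sub>F h in nhds 0. norm (e (?\<gamma> h)) \<le> C * norm h ^ 4" by (rule vanishingE)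
    have "((\<lambda>h. e (?\<gamma> h) / h) \<longlongrightarrow> 0) (at 0)"
    proof (rule Lim_null_comparison)
      show "\<forall>\<^sub>F h in at 0. norm (e (?\<gamma> h) / h) \<le> C * \<bar>h\<bar> ^ 3"
        unfolding eventually_at_filter using C
      proof eventually_elim
        case (elim h)
        show ?case
        proof (intro impI)
          assume "h \<noteq> 0"
          with elim show "norm (e (?\<gamma> h) / h) \<le> C * \<bar>h\<bar> ^ 3"
            by (simp add: divide_le_eq numeral_eq_Suc mult_ac)
        qed
      qed
      have "((\<lambda>h::real. C * \<bar>h\<bar> ^ 3) \<longlongrightarrow> C * \<bar>0\<bar> ^ 3) (at 0)" by (intro tendsto_intros)
      then show "((\<lambda>h::real. C * \<bar>h\<bar> ^ 3) \<longlongrightarrow> 0) (at 0)" by simp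
    qed
    moreover have "((\<lambda>h. m (?\<gamma> h)) \<longlongrightarrow> 1) (at 0)"
    proof (rule filterlim_compose[OF m])
      have "(?\<gamma> \<longlongrightarrow> 0) (nhds 0)" by (rule vanishing_tendsto[OF vanishing_bounded_linear[OF bl]]) simp
      then show "(?\<gamma> \<longlongrightarrow> 0) (at 0)" by (rule filterlim_mono) (auto simp: at_within_def)
    qed
    ultimately have "((\<lambda>h. m (?\<gamma> h) + e (?\<gamma> h) / h) \<longlongrightarrow> 1 + 0) (at 0)" by (intro tendsto_add)
    moreover have "\<forall>\<^sub>F h in at 0. m (?\<gamma> h) + e (?\<gamma> h) / h = (R ((0, 0), h) - R ((0, 0), 0)) / h"
      unfolding eventually_at_filter
      by (rule always_eventually) (use R0 in \<open>simp add: R_eq P0 zero_prod_def field_simps\<close>)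
    ultimately have "((\<lambda>h. (R ((0, 0), h) - R ((0, 0), 0)) / h) \<longlongrightarrow> 1) (at 0)"
      using Lim_transform_eventually by fastforce
    with lim show ?thesis by (rule tendsto_unique[OF trivial_limit_at])
  qed
  then have "?D (0, 1) > 0" by simp
  note D_pos = this
  obtain A \<delta> \<phi> C where A: "open A" "0 \<in> A" "\<delta> > 0" "smooth_on A \<phi>" "C > 0"
    and inW: "\<And>y x. y \<in> A \<Longrightarrow> \<bar>x\<bar> < \<delta> \<Longrightarrow> (y, x) \<in> W"
    and sol: "\<And>y x. y \<in> A \<Longrightarrow> \<bar>x\<bar> < \<delta> \<Longrightarrow> R (y, x) = 0 \<longleftrightarrow> x = \<phi> y"
    and bound: "\<And>y x. y \<in> A \<Longrightarrow> \<bar>x\<bar> < \<delta> \<Longrightarrow> \<bar>x - \<phi> y\<bar> \<le> C * \<bar>R (y, x)\<bar>"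
  proof (rule implicit_function[OF W smR W0 R0 D_pos], goal_cases)
    case (1 A \<delta> \<phi> C)
    from 1(2-7) 1(9,10) show ?case by (rule 1(1))
  qed
  obtain U' V' Z where U': "open U'" "0 \<in> U'" and V': "open V'" and hom: "homeomorphism U' V' \<Phi> Z"
    and dZ: "\<And>y. y \<in> V' \<Longrightarrow> (Z has_derivative inv (frechet_derivative \<Phi> (at (Z y)))) (at y)"
    and bij: "\<And>y. y \<in> V' \<Longrightarrow> bij (frechet_derivative \<Phi> (at (Z y)))"
  proof (rule smooth_inverse_function[OF open_UNIV sm\<Phi> UNIV_I \<Phi>(3)], goal_cases)
    case (1 U' V' Z)
    from 1(2,4,5,7-9) show ?case by (rule 1(1))
  qed
  define S where "S = {\<zeta>. (z_part k \<zeta>, u_part k \<zeta>) \<in> A \<and> \<bar>2 * Re (\<zeta> $ k)\<bar> < \<delta>}"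
  have "open S"
  proof -
    have "open ((\<lambda>\<zeta>. (z_part k \<zeta>, u_part k \<zeta>)) -` A)"
      by (intro open_vimage A(1) continuous_on_Pair linear_continuous_on bounded_linear_z_part bounded_linear_u_part)
    moreover have "open {\<zeta>. \<bar>2 * Re (\<zeta> $ k)\<bar> < \<delta>}"
      by (intro open_Collect_less continuous_intros)
    ultimately show ?thesis unfolding S_def Collect_conj_eq vimage_def by (rule open_Int)
  qed
  have "0 \<in> S" using A(2,3) linear_0[OF bounded_linear.linear[OF bounded_linear_z_part], of k]
    by (simp add: S_def u_part_def zero_prod_def)
  \<comment> \<open>the coordinate range: both the inverse of \<open>\<Phi>\<close> and the implicit function are available\<close>
  define N where "N = U' \<inter> S"
  define V where "V = \<Phi> ` N"
  have Z\<Phi>: "Z (\<Phi> \<zeta>) = \<zeta>" if "\<zeta> \<in> U'" for \<zeta> using hom that by (rule homeomorphism_apply1)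
  have VV': "V \<subseteq> V'" using hom by (auto simp: V_def N_def homeomorphism_def)
  have V_eq: "V = V' \<inter> Z -` N"
  proof
    show "V \<subseteq> V' \<inter> Z -` N" using VV' Z\<Phi> by (auto simp: V_def N_def)
    show "V' \<inter> Z -` N \<subseteq> V"
    proof
      fix y assume y: "y \<in> V' \<inter> Z -` N"
      then have "y = \<Phi> (Z y)" using homeomorphism_apply2[OF hom, of y] by auto
      with y show "y \<in> V" unfolding V_def by blast
    qed
  qed
  have oN: "open N" unfolding N_def using U'(1) \<open>open S\<close> by (rule open_Int)
  have oV: "open V" unfolding V_eq
    by (rule continuous_open_preimage[OF _ V' oN]) (use hom in \<open>simp add: homeomorphism_def\<close>)
  have ZV: "Z ` V = N" unfolding V_def image_image using Z\<Phi> by (simp add: N_def)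
  have injZ: "inj_on Z V" unfolding V_eq
    by (rule inj_on_subset[of Z V']) (use homeomorphism_apply2[OF hom] in \<open>auto intro: inj_on_inverseI\<close>)
  have inv: "inv_into V Z \<zeta> = \<Phi> \<zeta>" if "\<zeta> \<in> N" for \<zeta>
  proof -
    have "inv_into V Z (Z (\<Phi> \<zeta>)) = \<Phi> \<zeta>" using that by (intro inv_into_f_f[OF injZ]) (simp add: V_def)
    then show ?thesis using that Z\<Phi> by (simp add: N_def)
  qed
  have lin\<Phi>: "frechet_derivative \<Phi> (at x) (c *s v) = c *s frechet_derivative \<Phi> (at x) v" for x c v
  proof -
    obtain f' where f': "(\<Phi> has_derivative f') (at x)" "\<And>c v. f' (c *s v) = c *s f' v"
      using smooth_holomorphic_derivative[OF \<Phi>(1)] by blast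
    have "f' = frechet_derivative \<Phi> (at x)" by (rule frechet_derivative_at[OF f'(1)])
    with f'(2) show ?thesis by simp
  qed
  have add\<Phi>: "frechet_derivative \<Phi> (at x) (v + w) = frechet_derivative \<Phi> (at x) v + frechet_derivative \<Phi> (at x) w" for x v w
    by (rule linear_add[OF has_derivative_linear[OF d\<Phi>]])
  have hol: "holomorphic_map_on V Z"
    unfolding holomorphic_map_on_def
  proof
    fix y assume "y \<in> V"
    then have y: "y \<in> V'" using VV' by blast
    let ?f = "frechet_derivative \<Phi> (at (Z y))"
    have f: "?f (inv ?f v) = v" "inv ?f (?f v) = v" for v
      using bij[OF y] by (auto simp: bij_is_surj surj_f_inv_f bij_is_inj)
    have "Vector_Spaces.linear (*s) (*s) (inv ?f)"
    proof (rule vec_linearI)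
      show "inv ?f (v + w) = inv ?f v + inv ?f w" for v w
        using f(2)[of "inv ?f v + inv ?f w"] by (simp only: add\<Phi> f(1))
      show "inv ?f (c *s v) = c *s inv ?f v" for c v
        using f(2)[of "c *s inv ?f v"] by (simp only: lin\<Phi> f(1))
    qed
    with dZ[OF y] show "\<exists>f'. (Z has_derivative f') (at y) \<and> Vector_Spaces.linear (*s) (*s) f'" by blast
  qed
  have hol': "holomorphic_map_on (Z ` V) (inv_into V Z)"
    unfolding holomorphic_map_on_def ZV
  proof
    fix \<zeta> assume \<zeta>: "\<zeta> \<in> N"
    have "(inv_into V Z has_derivative frechet_derivative \<Phi> (at \<zeta>)) (at \<zeta>)"
      by (rule has_derivative_transform_within_open[OF d\<Phi> oN \<zeta>]) (simp add: inv)
    moreover have "Vector_Spaces.linear (*s) (*s) (frechet_derivative \<Phi> (at \<zeta>))"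
      by (rule vec_linearI[OF add\<Phi> lin\<Phi>])
    ultimately show "\<exists>f'. (inv_into V Z has_derivative f') (at \<zeta>) \<and> Vector_Spaces.linear (*s) (*s) f'" by blast
  qed
  have "p \<in> V" unfolding V_def using \<Phi>(2) U'(2) \<open>0 \<in> S\<close> by (auto simp: N_def intro!: image_eqI[of _ _ 0])
  moreover have "Z p = 0" using Z\<Phi>[OF U'(2)] \<Phi>(2) by simp
  ultimately have coord: "holomorphic_coordinates_at p V Z"
    unfolding holomorphic_coordinates_at_def using oV oN injZ hol hol' by (simp add: ZV)
  have graph: "(z_part k (Z x), u_part k (Z x)) \<in> A \<and>
       (x \<in> M \<longleftrightarrow> Z x $ k + cnj (Z x $ k) = complex_of_real (\<phi> (z_part k (Z x), u_part k (Z x))))"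
    if xV: "x \<in> V" for x
  proof -
    obtain \<zeta> where \<zeta>: "\<zeta> \<in> N" "x = \<Phi> \<zeta>" using xV by (auto simp: V_def)
    have Zx: "Z x = \<zeta>" using \<zeta> Z\<Phi> by (simp add: N_def)
    let ?y = "(z_part k \<zeta>, u_part k \<zeta>)"
    have y: "?y \<in> A" "\<bar>2 * Re (\<zeta> $ k)\<bar> < \<delta>" using \<zeta>(1) by (auto simp: N_def S_def)
    have "x \<in> U" using inW[OF y] unfolding W_def mem_Collect_eq graph_point_inverse \<zeta>(2) .
    then have "x \<in> M \<longleftrightarrow> \<rho> x = 0" by (rule U(4))
    also have "\<dots> \<longleftrightarrow> R (?y, 2 * Re (\<zeta> $ k)) = 0" unfolding R_def graph_point_inverse \<zeta>(2) ..
    also have "\<dots> \<longleftrightarrow> 2 * Re (\<zeta> $ k) = \<phi> ?y" by (rule sol[OF y])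
    also have "\<dots> \<longleftrightarrow> \<zeta> $ k + cnj (\<zeta> $ k) = complex_of_real (\<phi> ?y)"
      unfolding complex_add_cnj of_real_eq_iff ..
    finally show ?thesis using y(1) unfolding Zx by blast
  qed
  \<comment> \<open>on the graph of \<open>P\<close> the function \<open>\<rho> \<circ> \<Phi>\<close> coincides with the error term \<open>e\<close>\<close>
  have "vanishing 4 (\<lambda>y. e (graph_point k (y, P y)))"
  proof (rule vanishing_compose[OF e])
    have "vanishing 1 (\<lambda>y. graph_point k (y, 0) + P y *\<^sub>R graph_point k (0, 1))"
    proof (rule vanishing_add)
      show "vanishing 1 (\<lambda>y. graph_point k (y, 0))"
        by (intro vanishing_bounded_linear bounded_linear_compose[OF bounded_linear_graph_point]
            bounded_linear_Pair bounded_linear_zero bounded_linear_ident)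
      have "vanishing 1 (\<lambda>y. norm (graph_point k (0, 1)) * P y)"
        by (intro vanishing_real_mult vanishing_mono[OF P(2)]) simp
      then show "vanishing 1 (\<lambda>y. P y *\<^sub>R graph_point k (0, 1))"
        by (rule vanishing_norm_le) (simp add: abs_mult)
    qed
    moreover have "graph_point k (y, 0) + P y *\<^sub>R graph_point k (0, 1) = graph_point k (y, P y)" for y
      using linear_add[OF bounded_linear.linear[OF bounded_linear_graph_point], of k "(y, 0)" "P y *\<^sub>R (0, 1)"]
        linear_scale[OF bounded_linear.linear[OF bounded_linear_graph_point], of k "P y" "(0, 1)"] by simp
    ultimately show "vanishing 1 (\<lambda>y. graph_point k (y, P y))" by simp
  qed
  then obtain D where D: "\<forall>\<^sub>F y in nhds 0. norm (e (graph_point k (y, P y))) \<le> D * norm y ^ 4"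
    by (rule vanishingE)
  have "(P \<longlongrightarrow> 0) (nhds 0)" by (rule vanishing_tendsto[OF P(2)]) simp
  then have "\<forall>\<^sub>F y in nhds 0. dist (P y) 0 < \<delta>" using A(3) by (rule tendstoD)
  moreover have "\<forall>\<^sub>F y in nhds 0. y \<in> A" using A(1,2) by (rule eventually_nhds_in_open)
  ultimately have "\<forall>\<^sub>F y in nhds 0. norm (\<phi> y - P y) \<le> (C * D) * norm y ^ 4"
    using D
  proof eventually_elim
    case (elim y)
    have "\<bar>P y - \<phi> y\<bar> \<le> C * \<bar>R (y, P y)\<bar>" using elim by (intro bound) auto
    also have "R (y, P y) = e (graph_point k (y, P y))" using R_eq[of "fst y" "snd y" "P y"] by simp
    also have "C * \<bar>e (graph_point k (y, P y))\<bar> \<le> C * (D * norm y ^ 4)"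
      using elim A(5) by (intro mult_left_mono) auto
    finally show ?case by (simp add: abs_minus_commute mult.assoc)
  qed
  then have "vanishing 4 (\<lambda>y. \<phi> y - P y)" by (rule vanishingI)
  then have "(\<lambda>y. \<phi> y - P y) \<in> O[at (0, 0)](\<lambda>y. norm y ^ 4)"
    unfolding zero_prod_def[symmetric] by (rule vanishing_imp_bigo)
  with coord A(1,4) graph show ?thesis
    by (intro exI[of _ V] exI[of _ Z] exI[of _ A] exI[of _ \<phi>] conjI ballI) auto
qed

section \<open>Hermitian forms and adapted linear coordinates\<close>

text \<open>Additivity and homogeneity are required in the first argument only; the symmetry transfers them
  to the second, where homogeneity becomes conjugate.\<close>

definition hermitian_form :: "(complex^'n::finite \<Rightarrow> complex^'n \<Rightarrow> complex) \<Rightarrow> bool" where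
  "hermitian_form L \<longleftrightarrow>
     (\<forall>x y z. L (x + y) z = L x z + L y z) \<and> (\<forall>c x z. L (c *s x) z = c * L x z) \<and>
     (\<forall>x z. L z x = cnj (L x z))"

context
  fixes L :: "complex^'n::finite \<Rightarrow> complex^'n \<Rightarrow> complex"
  assumes L: "hermitian_form L"
begin

lemma herm_add: "L (x + y) z = L x z + L y z"
  and herm_scale: "L (c *s x) z = c * L x z"
  and herm_sym: "L z x = cnj (L x z)"
  using L unfolding hermitian_form_def by blast+

lemma herm_add_right: "L z (x + y) = L z x + L z y"
  by (subst (1 2 3) herm_sym) (simp add: herm_add)

lemma herm_scale_right: "L z (c *s x) = cnj c * L z x"
  by (subst (1 2) herm_sym) (simp add: herm_scale)

lemma herm_zero: "L 0 z = 0" "L z 0 = 0"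
  using herm_scale[of 0 0 z] herm_scale_right[of z 0 0] by auto

lemma herm_sum: "L (\<Sum>i\<in>I. f i) z = (\<Sum>i\<in>I. L (f i) z)"
  by (induction I rule: infinite_finite_induct) (auto simp: herm_zero herm_add)

lemma herm_sum_right: "L z (\<Sum>i\<in>I. f i) = (\<Sum>i\<in>I. L z (f i))"
  by (induction I rule: infinite_finite_induct) (auto simp: herm_zero herm_add_right)

lemma herm_diag_real: "Im (L x x) = 0"
  using herm_sym[of x x] by (simp add: complex_eq_iff)

text \<open>Polarisation with \<open>x + y\<close> and \<open>x + \<i>y\<close>.\<close>

lemma herm_polarization:
  assumes S: "vec.subspace S" and z: "\<And>x. x \<in> S \<Longrightarrow> L x x = 0" and xy: "x \<in> S" "y \<in> S"
  shows "L x y = 0"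
proof -
  have "x + y \<in> S" "x + \<i> *s y \<in> S"
    using S xy by (auto intro!: vec.subspace_add vec.subspace_scale)
  then have "L (x + y) (x + y) = 0" "L (x + \<i> *s y) (x + \<i> *s y) = 0" by (auto intro: z)
  then have "L x y + L y x = 0" "- \<i> * L x y + \<i> * L y x = 0"
    using z[OF xy(1)] z[OF xy(2)]
    by (simp_all add: herm_add herm_add_right herm_scale herm_scale_right)
  then show ?thesis by (simp add: complex_eq_iff)
qed

text \<open>Sylvester diagonalisation by induction on the dimension: a vector \<open>v\<close> with \<open>L(v, v) = \<plusminus>1\<close> splits
  off its orthogonal complement, and if no such vector exists the form vanishes by polarisation.\<close>

lemma hermitian_orthogonal_basis:
  fixes S :: "(complex^'n) set"
  assumes "vec.subspace S"
  shows "\<exists>B. B \<subseteq> S \<and> vec.independent B \<and> vec.span B = S \<and>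
     (\<forall>b\<in>B. \<forall>b'\<in>B. b \<noteq> b' \<longrightarrow> L b b' = 0) \<and> (\<forall>b\<in>B. L b b \<in> {-1, 0, 1})"
  using assms
proof (induction "vec.dim S" arbitrary: S rule: less_induct)
  case less
  show ?case
  proof (cases "\<forall>x\<in>S. L x x = 0")
    case True
    obtain B where "B \<subseteq> S" "vec.independent B" "S \<subseteq> vec.span B"
      using vec.maximal_independent_subset[of S] by metis
    moreover have "vec.span B = S"
      using calculation less.prems by (simp add: vec.span_minimal subset_antisym)
    moreover have "L b b' = 0" if "b \<in> B" "b' \<in> B" for b b'
      using herm_polarization[OF less.prems] True that calculation(1) by blast
    ultimately show ?thesis by (intro exI[of _ B]) auto
  next
    case False
    then obtain x where x: "x \<in> S" "L x x \<noteq> 0" by blast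
    define t where "t = Re (L x x)"
    have Lx: "L x x = of_real t" using herm_diag_real[of x] by (simp add: t_def complex_eq_iff)
    with x have t: "t \<noteq> 0" by auto
    define v where "v = complex_of_real (1 / sqrt \<bar>t\<bar>) *s x"
    have vS: "v \<in> S" unfolding v_def using less.prems x(1) by (rule vec.subspace_scale)
    have "L v v = of_real (1 / sqrt \<bar>t\<bar>) * (of_real (1 / sqrt \<bar>t\<bar>) * of_real t)"
      unfolding v_def herm_scale herm_scale_right Lx complex_cnj_complex_of_real ..
    also have "\<dots> = of_real (1 / sqrt \<bar>t\<bar> * (1 / sqrt \<bar>t\<bar>) * t)"
      by (simp only: of_real_mult mult.assoc)
    also have "1 / sqrt \<bar>t\<bar> * (1 / sqrt \<bar>t\<bar>) * t = t / \<bar>t\<bar>"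
      by simp
    also have "t / \<bar>t\<bar> = sgn t" by (simp add: sgn_if)
    finally have Lv: "L v v = of_real (sgn t)" .
    then have Lv0: "L v v \<noteq> 0" "L v v \<in> {-1, 0, 1}" using t by (auto simp: sgn_if)
    define S' where "S' = {y \<in> S. L y v = 0}"
    have S': "vec.subspace S'" unfolding vec.subspace_def S'_def
      using less.prems by (auto simp: vec.subspace_def herm_zero herm_add herm_scale)
    have "v \<notin> S'" using Lv0 by (simp add: S'_def)
    then have "S' \<subset> S" using vS by (auto simp: S'_def)
    then have "vec.dim S' < vec.dim S"
      using vec.dim_psubset[of S' S] vec.span_eq_iff S' less.prems by metis
    from less.hyps[OF this S'] obtain B where B: "B \<subseteq> S'" "vec.independent B" "vec.span B = S'"
      "\<forall>b\<in>B. \<forall>b'\<in>B. b \<noteq> b' \<longrightarrow> L b b' = 0" "\<forall>b\<in>B. L b b \<in> {-1, 0, 1}" by blast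
    have "vec.independent (insert v B)"
      using B(2,3) \<open>v \<notin> S'\<close> by (simp add: vec.independent_insert)
    moreover have "vec.span (insert v B) = S"
    proof
      show "vec.span (insert v B) \<subseteq> S"
        using less.prems vS B(1) by (intro vec.span_minimal) (auto simp: S'_def)
      show "S \<subseteq> vec.span (insert v B)"
      proof
        fix y assume y: "y \<in> S"
        define c where "c = L y v / L v v"
        have "y - c *s v \<in> S" using less.prems y vS by (intro vec.subspace_diff vec.subspace_scale)
        moreover have "L (y - c *s v) v = 0"
          using herm_add[of "y - c *s v" "c *s v" v] Lv0 by (simp add: herm_scale c_def)
        ultimately have "y - c *s v \<in> vec.span B" unfolding B(3) by (simp add: S'_def)
        then show "y \<in> vec.span (insert v B)" unfolding vec.span_insert by blast
      qed
    qed
    moreover have "L b v = 0" "L v b = 0" if "b \<in> B" for b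
      using B(1) that herm_sym[of b v] herm_sym[of v b] by (auto simp: S'_def)
    moreover have "insert v B \<subseteq> S" using vS B(1) by (auto simp: S'_def)
    ultimately show ?thesis using B(4,5) Lv0 by (intro exI[of _ "insert v B"]) auto
  qed
qed

text \<open>The radical is spanned by the null vectors of the basis.\<close>

lemma hermitian_rank_orthogonal_basis:
  assumes B: "vec.independent B" "vec.span B = S"
    and orth: "\<forall>b\<in>B. \<forall>b'\<in>B. b \<noteq> b' \<longrightarrow> L b b' = 0"
  shows "card {b\<in>B. L b b \<noteq> 0} = form_rank S L"
proof -
  have fin: "finite B" by (rule vec.finiteI_independent[OF B(1)])
  define B0 where "B0 = {b\<in>B. L b b = 0}"
  have "{v\<in>S. \<forall>v'\<in>S. L v v' = 0} = vec.span B0"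
  proof
    show "{v\<in>S. \<forall>v'\<in>S. L v v' = 0} \<subseteq> vec.span B0"
    proof clarify
      fix v assume v: "v \<in> S" "\<forall>v'\<in>S. L v v' = 0"
      then obtain u where u: "v = (\<Sum>b\<in>B. u b *s b)"
        using B(2) vec.span_finite[OF fin] by auto
      have "u b = 0" if "b \<in> B" "L b b \<noteq> 0" for b
      proof -
        have "L v b = (\<Sum>b'\<in>B. u b' * L b' b)" unfolding u by (simp add: herm_sum herm_scale)
        also have "\<dots> = (\<Sum>b'\<in>B. if b' = b then u b * L b b else 0)"
          using orth that(1) by (intro sum.cong) auto
        also have "\<dots> = u b * L b b" using fin that(1) by simp
        finally show ?thesis using v(2) that vec.span_base[OF that(1)] B(2) by auto
      qed
      then have "v = (\<Sum>b\<in>B0. u b *s b)"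
        unfolding u B0_def using fin by (intro sum.mono_neutral_right) auto
      then show "v \<in> vec.span B0" by (simp add: vec.span_sum vec.span_scale vec.span_base)
    qed
    have sub: "vec.subspace {v\<in>S. \<forall>v'\<in>S. L v v' = 0}"
      using vec.subspace_span[of B] unfolding B(2)
      by (auto simp: vec.subspace_def herm_zero herm_add herm_scale)
    show "vec.span B0 \<subseteq> {v\<in>S. \<forall>v'\<in>S. L v v' = 0}"
    proof (rule vec.span_minimal[OF _ sub], clarify)
      fix b assume b: "b \<in> B0"
      have "L b v' = 0" if "v' \<in> S" for v'
      proof -
        from that obtain u where u: "v' = (\<Sum>b\<in>B. u b *s b)"
          using B(2) vec.span_finite[OF fin] by auto
        have "L b b' = 0" if "b' \<in> B" for b' using b orth that by (cases "b = b'") (auto simp: B0_def)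
        then show ?thesis unfolding u by (simp add: herm_sum_right herm_scale_right)
      qed
      then show "b \<in> S \<and> (\<forall>v'\<in>S. L b v' = 0)"
        using b vec.span_base[of b B] B(2) by (auto simp: B0_def)
    qed
  qed
  moreover have "vec.independent B0" using B(1) by (rule vec.independent_mono) (auto simp: B0_def)
  ultimately have "vec.dim {v\<in>S. \<forall>v'\<in>S. L v v' = 0} = card B0"
    by (simp add: vec.dim_span vec.dim_eq_card_independent)
  moreover have "vec.dim S = card B"
    using B vec.dim_span vec.dim_eq_card_independent by metis
  moreover have "{b\<in>B. L b b \<noteq> 0} = B - B0" by (auto simp: B0_def)
  ultimately show ?thesis
    unfolding form_rank_def using fin by (simp add: card_Diff_subset B0_def)
qed

end

lemma hyperplane_dim:
  fixes l :: "'n::finite \<Rightarrow> complex"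
  assumes "l i0 \<noteq> 0"
  shows "vec.dim {v::complex^'n. (\<Sum>i\<in>UNIV. l i * v $ i) = 0} = CARD('n) - 1"
    and "vec.subspace {v::complex^'n. (\<Sum>i\<in>UNIV. l i * v $ i) = 0}"
proof -
  let ?l = "\<lambda>v::complex^'n. (\<Sum>i\<in>UNIV. l i * v $ i)"
  let ?H = "{v. ?l v = 0}"
  have add: "?l (x + y) = ?l x + ?l y" for x y by (simp add: algebra_simps sum.distrib)
  have scale: "?l (c *s x) = c * ?l x" for c x by (simp add: sum_distrib_left mult_ac)
  show H: "vec.subspace ?H" unfolding vec.subspace_def mem_Collect_eq add scale by simp
  define e where "e = axis i0 (1 / l i0)"
  have "?l e = (\<Sum>i\<in>UNIV. if i = i0 then 1 else 0)"
    using assms by (intro sum.cong) (auto simp: e_def axis_def)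
  then have e: "?l e = 1" by simp
  have "x \<in> vec.span (insert e ?H)" for x
  proof -
    have "?l (x - ?l x *s e) + ?l (?l x *s e) = ?l x" by (subst add[symmetric]) simp
    then have "x - ?l x *s e \<in> ?H" unfolding scale e by simp
    then have "x - ?l x *s e \<in> vec.span ?H" by (rule vec.span_base)
    then show ?thesis unfolding vec.span_insert by blast
  qed
  then have "vec.span (insert e ?H) = UNIV" by blast
  then have "vec.dim (insert e ?H) = CARD('n)"
    using vec.dim_span[of "insert e ?H"] by (simp only: vec_dim_card)
  moreover have "vec.span ?H = ?H" using H by (rule vec.span_eq_iff[THEN iffD2])
  then have "e \<notin> vec.span ?H" using e by (simp del: vec.span_eq_iff)
  ultimately show "vec.dim ?H = CARD('n) - 1" by (simp add: vec.dim_insert)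
qed

lemma linear_combination_inj:
  fixes b :: "'i \<Rightarrow> complex^'n"
  assumes "finite I" "inj_on b I" "vec.independent (b ` I)" "(\<Sum>i\<in>I. x i *s b i) = 0" "i \<in> I"
  shows "x i = 0"
proof -
  have "(\<Sum>v\<in>b ` I. x (inv_into I b v) *s v) = (\<Sum>i\<in>I. x i *s b i)"
    using assms(2) by (simp add: sum.reindex)
  then have "x (inv_into I b (b i)) = 0"
    using vec.independentD[OF assms(3), of "b ` I" "\<lambda>v. x (inv_into I b v)" "b i"] assms by auto
  then show ?thesis using assms by simp
qed

lemma herm_lin_map:
  assumes "hermitian_form L"
  shows "L (lin_map b x) (lin_map b x) = (\<Sum>i\<in>UNIV. \<Sum>j\<in>UNIV. x $ i * cnj (x $ j) * L (b i) (b j))"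
  unfolding lin_map_def
  by (simp add: herm_sum[OF assms] herm_sum_right[OF assms] herm_scale[OF assms] herm_scale_right[OF assms]
      sum_distrib_left mult_ac) (rule sum.swap)

text \<open>An orthogonal basis of the kernel of \<open>l\<close> is completed by a vector on which \<open>l\<close> takes the value 1.
  Nothing is known about the Hermitian form on the added vector; it is responsible for the term with
  the linear form \<open>lam\<close>.\<close>

lemma adapted_linear_coordinates:
  fixes l :: "'n::finite \<Rightarrow> complex"
  assumes L: "hermitian_form L" and l: "l i0 \<noteq> 0"
    and rank: "form_rank {v. (\<Sum>i\<in>UNIV. l i * v $ i) = 0} L = q"
  obtains k :: 'n and J\<^sub>2 J\<^sub>3 b s lam where "coordinate_splitting q k J\<^sub>2 J\<^sub>3"
    "\<And>j. j \<in> J\<^sub>2 \<Longrightarrow> s j \<in> {-1, 1}" "\<And>x. lin_map b x = 0 \<Longrightarrow> x = 0"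
    "\<And>x. (\<Sum>i\<in>UNIV. l i * lin_map b x $ i) = x $ k" "bihom 1 0 lam"
    "\<And>x. Re (L (lin_map b x) (lin_map b x)) = phi2 J\<^sub>2 s x + 2 * Re (x $ k * cnj (lam x))"
proof -
  define H where "H = {v::complex^'n. (\<Sum>i\<in>UNIV. l i * v $ i) = 0}"
  have dimH: "vec.dim H = CARD('n) - 1" and subH: "vec.subspace H"
    unfolding H_def using hyperplane_dim[of l i0, OF l] by blast+
  obtain B where B: "B \<subseteq> H" "vec.independent B" "vec.span B = H"
    "\<forall>b\<in>B. \<forall>b'\<in>B. b \<noteq> b' \<longrightarrow> L b b' = 0" "\<forall>b\<in>B. L b b \<in> {-1, 0, 1}"
    using hermitian_orthogonal_basis[OF L subH] by blast
  have finB: "finite B" by (rule vec.finiteI_independent[OF B(2)])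
  have rankB: "card {b\<in>B. L b b \<noteq> 0} = q"
    using hermitian_rank_orthogonal_basis[OF L B(2,3,4)] rank by (simp add: H_def)
  have "card B = CARD('n) - 1"
    using dimH vec.dim_span[of B] vec.dim_eq_card_independent[OF B(2)] B(3) by simp
  then have card: "card B = card (-{i0})" by (simp add: Compl_eq_Diff_UNIV card_Diff_singleton)
  obtain f where f: "bij_betw f (-{i0}) B"
    using finite_same_card_bij[OF finite finB] card by (metis finite)
  define e where "e = (axis i0 (1 / l i0) :: complex^'n)"
  have "(\<Sum>i\<in>UNIV. l i * e $ i) = (\<Sum>i\<in>UNIV. if i = i0 then 1 else 0)"
    using l by (intro sum.cong) (auto simp: e_def axis_def)
  then have e: "(\<Sum>i\<in>UNIV. l i * e $ i) = 1" by simp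
  define b where "b i = (if i = i0 then e else f i)" for i
  have bB: "b i \<in> B" if "i \<noteq> i0" for i using f that by (auto simp: b_def bij_betw_def)
  have b_inj: "inj_on b (-{i0})" "b ` (-{i0}) = B"
    using f by (auto simp: b_def bij_betw_def inj_on_def)
  define J2 where "J2 = {i. i \<noteq> i0 \<and> L (b i) (b i) \<noteq> 0}"
  define J3 where "J3 = {i. i \<noteq> i0 \<and> L (b i) (b i) = 0}"
  have UNIV_split: "sum g UNIV = g i0 + sum g (-{i0})" for g :: "'n \<Rightarrow> complex"
    using sum.remove[of UNIV i0 g] by (simp add: Compl_eq_Diff_UNIV)
  have split: "coordinate_splitting q i0 J2 J3"
  proof -
    have un: "insert i0 (J2 \<union> J3) = UNIV" by (auto simp: J2_def J3_def)
    have "b ` J2 = {b\<in>B. L b b \<noteq> 0}" using b_inj by (auto simp: J2_def)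
    moreover have "inj_on b J2" by (rule inj_on_subset[OF b_inj(1)]) (auto simp: J2_def)
    from card_image[OF this] have "card (b ` J2) = card J2" .
    ultimately have c2: "card J2 = q" using rankB by simp
    have "CARD('n) = card (insert i0 (J2 \<union> J3))" using un by simp
    also have "\<dots> = Suc (card (J2 \<union> J3))" by (rule card_insert_disjoint) (auto simp: J2_def J3_def)
    also have "card (J2 \<union> J3) = card J2 + card J3" by (rule card_Un_disjoint) (auto simp: J2_def J3_def)
    finally have "card J3 = CARD('n) - q - 1" using c2 by simp
    with un c2 show ?thesis unfolding coordinate_splitting_def by (auto simp: J2_def J3_def)
  qed
  have lb: "(\<Sum>i\<in>UNIV. l i * b j $ i) = (if j = i0 then 1 else 0)" for j
    using e bB[of j] B(1) by (auto simp: b_def H_def)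
  have l_lin: "(\<Sum>i\<in>UNIV. l i * lin_map b x $ i) = x $ i0" for x
  proof -
    have "(\<Sum>i\<in>UNIV. l i * lin_map b x $ i) = (\<Sum>j\<in>UNIV. x $ j * (\<Sum>i\<in>UNIV. l i * b j $ i))"
      unfolding lin_map_nth sum_distrib_left by (subst sum.swap) (simp add: mult_ac)
    then show ?thesis unfolding lb by (simp add: if_distrib cong: if_cong)
  qed
  have inj: "x = 0" if x: "lin_map b x = 0" for x
  proof -
    have k0: "x $ i0 = 0" using l_lin[of x] x by simp
    have "(\<Sum>i\<in>-{i0}. x $ i *s b i) = lin_map b x"
      unfolding lin_map_def using k0 by (intro sum.mono_neutral_left) auto
    then have "(\<Sum>i\<in>-{i0}. x $ i *s b i) = 0" using x by simp
    then have "x $ i = 0" if "i \<noteq> i0" for i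
      using linear_combination_inj[of "-{i0}" b "\<lambda>i. x $ i" i] b_inj B(2) that by simp
    with k0 show ?thesis by (auto simp: vec_eq_iff) metis
  qed
  define s where "s j = Re (L (b j) (b j))" for j
  define lam where "lam x = L (b i0) (b i0) / 2 * x $ i0 + (\<Sum>j\<in>-{i0}. cnj (L (b i0) (b j)) * x $ j)" for x
  have hlam: "bihom 1 0 lam" unfolding lam_def[abs_def] by (intro bihom.add bihom_sum bihom_scale bihom_coord)
  have form: "Re (L (lin_map b x) (lin_map b x)) = phi2 J2 s x + 2 * Re (x $ i0 * cnj (lam x))" for x
  proof -
    define g where "g i j = x $ i * cnj (x $ j) * L (b i) (b j)" for i j
    have diag: "(\<Sum>j\<in>-{i0}. g i j) = complex_of_real (s i * (cmod (x $ i))\<^sup>2)" if "i \<noteq> i0" for i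
    proof -
      have "g i j = 0" if "j \<in> -{i0}" "j \<noteq> i" for j
      proof -
        have "b i \<noteq> b j" using b_inj(1) that \<open>i \<noteq> i0\<close> by (auto dest: inj_onD)
        then show ?thesis using B(4) bB[of i] bB[of j] that \<open>i \<noteq> i0\<close> by (simp add: g_def)
      qed
      then have "(\<Sum>j\<in>-{i0}. g i j) = (\<Sum>j\<in>{i}. g i j)"
        using that by (intro sum.mono_neutral_right) auto
      also have "\<dots> = x $ i * cnj (x $ i) * L (b i) (b i)" by (simp add: g_def)
      also have "L (b i) (b i) = complex_of_real (s i)"
        using herm_diag_real[OF L, of "b i"] by (simp add: s_def complex_eq_iff)
      finally show ?thesis by (simp only: of_real_mult complex_norm_square mult.commute)
    qed
    have "Re (\<Sum>i\<in>-{i0}. \<Sum>j\<in>-{i0}. g i j) = (\<Sum>i\<in>-{i0}. s i * (cmod (x $ i))\<^sup>2)"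
      using diag by (simp add: Re_sum)
    also have "\<dots> = phi2 J2 s x"
      unfolding phi2_def by (intro sum.mono_neutral_right) (auto simp: J2_def s_def)
    finally have 1: "Re (\<Sum>i\<in>-{i0}. \<Sum>j\<in>-{i0}. g i j) = phi2 J2 s x" .
    have "g i i0 = cnj (g i0 i)" for i
      using herm_sym[OF L, of "b i" "b i0"] by (simp add: g_def)
    then have 2: "(\<Sum>i\<in>-{i0}. g i i0) = cnj (\<Sum>j\<in>-{i0}. g i0 j)" by simp
    have 3: "x $ i0 * cnj (lam x) = cnj (L (b i0) (b i0)) / 2 * (x $ i0 * cnj (x $ i0)) + (\<Sum>j\<in>-{i0}. g i0 j)"
      unfolding lam_def g_def by (simp add: algebra_simps sum_distrib_left)
    have 4: "2 * Re (cnj (L (b i0) (b i0)) / 2 * (x $ i0 * cnj (x $ i0))) = Re (g i0 i0)"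
      using herm_diag_real[OF L, of "b i0"] by (simp add: g_def algebra_simps)
    have "L (lin_map b x) (lin_map b x) = g i0 i0 + (\<Sum>j\<in>-{i0}. g i0 j) + (\<Sum>i\<in>-{i0}. g i i0)
        + (\<Sum>i\<in>-{i0}. \<Sum>j\<in>-{i0}. g i j)"
      unfolding herm_lin_map[OF L] g_def[symmetric] UNIV_split by (simp add: sum.distrib)
    then show ?thesis unfolding 3 using 1 4 by (simp add: 2 algebra_simps)
  qed
  show ?thesis
  proof (rule that[of i0 J2 J3 s b lam])
    show "s j \<in> {-1, 1}" if "j \<in> J2" for j
    proof -
      have "j \<noteq> i0" "L (b j) (b j) \<noteq> 0" using that by (auto simp: J2_def)
      then have "L (b j) (b j) \<in> {-1, 1}" using B(5) bB[of j] by auto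
      then show ?thesis by (auto simp: s_def)
    qed
  qed (fact split inj l_lin hlam form)+
qed

text \<open>The linear change of the coordinates in \<open>J\<close> alone: the restriction of the form to the
  coordinate subspace of \<open>J\<close> is diagonalised and the other coordinates are left fixed.\<close>

lemma diagonalize_block:
  fixes J :: "'n::finite set"
  assumes \<kappa>: "\<And>j l. \<kappa> l j = cnj (\<kappa> j l)"
  obtains b \<epsilon> where "\<And>j. j \<in> J \<Longrightarrow> \<epsilon> j \<in> {-1, 0, 1}" "\<And>j i. j \<in> J \<Longrightarrow> i \<notin> J \<Longrightarrow> b j $ i = 0"
    "\<And>j. j \<notin> J \<Longrightarrow> b j = axis j 1" "\<And>x i. i \<notin> J \<Longrightarrow> lin_map b x $ i = x $ i"
    "\<And>x. lin_map b x = 0 \<Longrightarrow> x = 0"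
    "\<And>x. (\<Sum>j\<in>J. \<Sum>l\<in>J. \<kappa> j l * lin_map b x $ j * cnj (lin_map b x $ l))
        = complex_of_real (\<Sum>j\<in>J. \<epsilon> j * (cmod (x $ j))\<^sup>2)"
proof -
  define L where "L x y = (\<Sum>j\<in>J. \<Sum>l\<in>J. \<kappa> j l * x $ j * cnj (y $ l))" for x y :: "complex^'n"
  have "L y x = cnj (L x y)" for x y
  proof -
    have "cnj (L x y) = (\<Sum>j\<in>J. \<Sum>l\<in>J. \<kappa> l j * cnj (x $ j) * y $ l)"
      unfolding L_def by (simp only: cnj_sum complex_cnj_mult complex_cnj_cnj \<kappa>[symmetric])
    also have "\<dots> = L y x" unfolding L_def by (subst sum.swap) (simp add: mult_ac)
    finally show ?thesis ..
  qed
  moreover have "L (x + y) z = L x z + L y z" for x y z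
    by (simp add: L_def sum.distrib algebra_simps)
  moreover have "L (a *s x) z = a * L x z" for a x z
    by (simp add: L_def sum_distrib_left mult_ac)
  ultimately have L: "hermitian_form L" unfolding hermitian_form_def by blast
  define W where "W = {x::complex^'n. \<forall>i. i \<notin> J \<longrightarrow> x $ i = 0}"
  have subW: "vec.subspace W" by (auto simp: W_def vec.subspace_def)
  obtain B where B: "B \<subseteq> W" "vec.independent B" "vec.span B = W"
    "\<forall>b\<in>B. \<forall>b'\<in>B. b \<noteq> b' \<longrightarrow> L b b' = 0" "\<forall>b\<in>B. L b b \<in> {-1, 0, 1}"
    using hermitian_orthogonal_basis[OF L subW] by blast
  have finB: "finite B" by (rule vec.finiteI_independent[OF B(2)])
  have "card B = vec.dim W"
    using vec.dim_span[of B] vec.dim_eq_card_independent[OF B(2)] B(3) by simp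
  also have "vec.dim W = card J" unfolding W_def by (rule dim_substandard_cart)
  finally have "card J = card B" ..
  then obtain f where f: "bij_betw f J B"
    using finite_same_card_bij[of J B] finB finite[of J] by blast
  define b where "b i = (if i \<in> J then f i else axis i 1)" for i
  have bB: "b i \<in> B" if "i \<in> J" for i using f that by (auto simp: b_def bij_betw_def)
  have b_inj: "inj_on b J" "b ` J = B"
    using f by (auto simp: b_def bij_betw_def inj_on_def)
  have b0: "b j $ i = 0" if "j \<in> J" "i \<notin> J" for i j using bB[of j] B(1) that by (auto simp: W_def)
  have b1: "b j = axis j 1" if "j \<notin> J" for j using that by (simp add: b_def)
  have nth: "lin_map b x $ i = x $ i" if "i \<notin> J" for x i
  proof -
    have "b j $ i * x $ j = (if j = i then x $ i else 0)" for j
      using that b0[of j i] by (cases "j \<in> J") (auto simp: b1 axis_def)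
    then show ?thesis unfolding lin_map_nth by simp
  qed
  have inj: "x = 0" if x: "lin_map b x = 0" for x
  proof -
    have k0: "x $ i = 0" if "i \<notin> J" for i using nth[OF that, of x] x by simp
    have "(\<Sum>i\<in>J. x $ i *s b i) = lin_map b x"
      unfolding lin_map_def using k0 by (intro sum.mono_neutral_left) auto
    then have "(\<Sum>i\<in>J. x $ i *s b i) = 0" using x by simp
    then have "x $ i = 0" if "i \<in> J" for i
      using linear_combination_inj[of J b "\<lambda>i. x $ i" i] b_inj B(2) that by simp
    with k0 show ?thesis by (auto simp: vec_eq_iff)
  qed
  define \<epsilon> where "\<epsilon> j = Re (L (b j) (b j))" for j
  have form: "L (lin_map b x) (lin_map b x) = complex_of_real (\<Sum>j\<in>J. \<epsilon> j * (cmod (x $ j))\<^sup>2)" for x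
  proof -
    have off: "L (b i) z = 0" if "i \<notin> J" for i z
      using that by (auto simp: L_def b1 axis_def intro!: sum.neutral)
    have off': "L z (b i) = 0" if "i \<notin> J" for i z
      using off[OF that, of z] herm_sym[OF L, of z "b i"] by simp
    have "L (lin_map b x) (lin_map b x) = (\<Sum>i\<in>UNIV. if i \<in> J then complex_of_real (\<epsilon> i * (cmod (x $ i))\<^sup>2) else 0)"
      unfolding herm_lin_map[OF L]
    proof (rule sum.cong[OF refl])
      fix i
      have "x $ i * cnj (x $ j) * L (b i) (b j) = 0" if "j \<noteq> i" for j
      proof (cases "i \<in> J \<and> j \<in> J")
        case True
        then have "b i \<noteq> b j" using b_inj(1) that by (auto dest: inj_onD)
        then show ?thesis using True B(4) bB[of i] bB[of j] by simp
      qed (use off off' in auto)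
      then have "(\<Sum>j\<in>UNIV. x $ i * cnj (x $ j) * L (b i) (b j)) = (\<Sum>j\<in>{i}. x $ i * cnj (x $ j) * L (b i) (b j))"
        by (intro sum.mono_neutral_right) auto
      also have "\<dots> = x $ i * cnj (x $ i) * L (b i) (b i)" by simp
      also have "L (b i) (b i) = complex_of_real (\<epsilon> i)"
        using herm_diag_real[OF L, of "b i"] by (simp add: \<epsilon>_def complex_eq_iff)
      also have "x $ i * cnj (x $ i) * complex_of_real (\<epsilon> i) = complex_of_real (\<epsilon> i * (cmod (x $ i))\<^sup>2)"
        by (simp only: of_real_mult complex_norm_square mult.commute)
      finally show "(\<Sum>j\<in>UNIV. x $ i * cnj (x $ j) * L (b i) (b j))
         = (if i \<in> J then complex_of_real (\<epsilon> i * (cmod (x $ i))\<^sup>2) else 0)"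
        using off[of i "b i"] by (auto simp: \<epsilon>_def)
    qed
    also have "\<dots> = (\<Sum>i\<in>J. complex_of_real (\<epsilon> i * (cmod (x $ i))\<^sup>2))"
      by (simp add: sum.If_cases)
    finally show ?thesis by simp
  qed
  show ?thesis
  proof (rule that[of \<epsilon> b])
    show "\<epsilon> j \<in> {-1, 0, 1}" if "j \<in> J" for j
      using B(5) bB[OF that] by (auto simp: \<epsilon>_def)
  qed (fact b0 b1 nth inj form[unfolded L_def])+
qed

section \<open>The Levi form in the Taylor expansion\<close>

lemma inner_eq_Re:
  fixes b :: "complex^'n"
  obtains c where "bihom 1 0 c" "\<And>y. y \<bullet> b = 2 * Re (c y)"
proof
  show "bihom 1 0 (\<lambda>y. \<Sum>i\<in>UNIV. (cnj (b $ i) / 2) * y $ i)" by (intro bihom_sum bihom_scale bihom_coord)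
  show "y \<bullet> b = 2 * Re (\<Sum>i\<in>UNIV. (cnj (b $ i) / 2) * y $ i)" for y
    unfolding inner_vec_def Re_sum sum_distrib_left
    by (intro sum.cong refl) (simp add: inner_complex_def algebra_simps)
qed

text \<open>From \<open>2 Re c \<cdot> 2 Re d = 2 Re (c d) + 2 Re (c \<bar>d)\<close>.\<close>

lemma quadratic_bidegree:
  fixes K :: "'a \<Rightarrow> 'b \<Rightarrow> real" and c :: "'a \<Rightarrow> complex^'n \<Rightarrow> complex" and d :: "'b \<Rightarrow> complex^'n \<Rightarrow> complex"
  assumes "\<And>i. bihom 1 0 (c i)" "\<And>j. bihom 1 0 (d j)"
  obtains \<alpha> h where "bihom 2 0 \<alpha>" "bihom 1 1 h"
    "\<And>y. (\<Sum>i\<in>I. \<Sum>j\<in>J. (2 * Re (c i y)) * (2 * Re (d j y)) * K i j) = 2 * Re (\<alpha> y) + Re (h y)"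
proof
  define \<alpha> where "\<alpha> y = (\<Sum>i\<in>I. \<Sum>j\<in>J. complex_of_real (K i j) * (c i y * d j y))" for y
  define h where "h y = (\<Sum>i\<in>I. \<Sum>j\<in>J. complex_of_real (2 * K i j) * (c i y * cnj (d j y)))" for y
  have 1: "bihom 2 0 (\<lambda>y. c i y * d j y)" "bihom 1 1 (\<lambda>y. c i y * cnj (d j y))" for i j
    using bihom_mult[OF assms(1)[of i] assms(2)[of j]] bihom_mult[OF assms(1)[of i] bihom_cnj[OF assms(2)[of j]]]
    by (simp_all add: numeral_2_eq_2)
  show "bihom 2 0 \<alpha>" "bihom 1 1 h"
    unfolding \<alpha>_def[abs_def] h_def[abs_def] by (intro bihom_sum bihom_scale 1)+
  show "(\<Sum>i\<in>I. \<Sum>j\<in>J. (2 * Re (c i y)) * (2 * Re (d j y)) * K i j) = 2 * Re (\<alpha> y) + Re (h y)" for y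
    unfolding \<alpha>_def h_def Re_sum sum_distrib_left sum.distrib[symmetric]
    by (intro sum.cong refl) (simp add: algebra_simps)
qed

text \<open>The product of three real parts has one term of type (3,0) and three of type (2,1), up to
  conjugation.\<close>

lemma cubic_bidegree:
  fixes K :: "'a \<Rightarrow> 'b \<Rightarrow> 'c \<Rightarrow> real" and c :: "'a \<Rightarrow> complex^'n \<Rightarrow> complex"
    and d :: "'b \<Rightarrow> complex^'n \<Rightarrow> complex" and e :: "'c \<Rightarrow> complex^'n \<Rightarrow> complex"
  assumes c: "\<And>i. bihom 1 0 (c i)" and d: "\<And>j. bihom 1 0 (d j)" and e: "\<And>l. bihom 1 0 (e l)"
  obtains A B where "bihom 3 0 A" "bihom 2 1 B"
    "\<And>y. (\<Sum>i\<in>I. \<Sum>j\<in>J. \<Sum>l\<in>L. (2 * Re (c i y)) * (2 * Re (d j y)) * (2 * Re (e l y)) * K i j l)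
       = 2 * Re (A y) + 2 * Re (B y)"
proof
  define A where "A y = (\<Sum>i\<in>I. \<Sum>j\<in>J. \<Sum>l\<in>L. complex_of_real (K i j l) * (c i y * d j y * e l y))" for y
  define B where "B y = (\<Sum>i\<in>I. \<Sum>j\<in>J. \<Sum>l\<in>L. complex_of_real (K i j l) *
      (c i y * d j y * cnj (e l y) + c i y * cnj (d j y) * e l y + cnj (c i y) * d j y * e l y))" for y
  have 1: "bihom 3 0 (\<lambda>y. c i y * d j y * e l y)" "bihom 2 1 (\<lambda>y. c i y * d j y * cnj (e l y))"
    "bihom 2 1 (\<lambda>y. c i y * cnj (d j y) * e l y)" "bihom 2 1 (\<lambda>y. cnj (c i y) * d j y * e l y)" for i j l
    using bihom_mult[OF bihom_mult[OF c[of i] d[of j]] e[of l]]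
      bihom_mult[OF bihom_mult[OF c[of i] d[of j]] bihom_cnj[OF e[of l]]]
      bihom_mult[OF bihom_mult[OF c[of i] bihom_cnj[OF d[of j]]] e[of l]]
      bihom_mult[OF bihom_mult[OF bihom_cnj[OF c[of i]] d[of j]] e[of l]]
    by (simp_all add: numeral_eq_Suc)
  show "bihom 3 0 A" unfolding A_def[abs_def] by (intro bihom_sum bihom_scale 1)
  show "bihom 2 1 B" unfolding B_def[abs_def] by (intro bihom_sum bihom_scale bihom.add 1)
  show "(\<Sum>i\<in>I. \<Sum>j\<in>J. \<Sum>l\<in>L. (2 * Re (c i y)) * (2 * Re (d j y)) * (2 * Re (e l y)) * K i j l)
     = 2 * Re (A y) + 2 * Re (B y)" for y
    unfolding A_def B_def Re_sum sum_distrib_left sum.distrib[symmetric]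
    by (intro sum.cong refl) (simp add: algebra_simps)
qed

lemma frechet_derivative_of_real:
  assumes "smooth_on U \<rho>" "x \<in> U"
  shows "frechet_derivative (\<lambda>x. complex_of_real (\<rho> x)) (at x) v = complex_of_real (dir_deriv v \<rho> x)"
proof -
  have "(\<rho> has_derivative frechet_derivative \<rho> (at x)) (at x)"
    by (rule smooth_on_has_derivative[OF assms])
  from bounded_linear.has_derivative[OF bounded_linear_of_real[where ?'a = complex] this]
  have "(\<lambda>v. complex_of_real (frechet_derivative \<rho> (at x) v)) = frechet_derivative (\<lambda>x. complex_of_real (\<rho> x)) (at x)"
    by (rule frechet_derivative_at)
  from fun_cong[OF this, of v] show ?thesis by (simp add: dir_deriv_def)
qed

lemma levi_coefficient:
  fixes \<rho> :: "complex^'n \<Rightarrow> real"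
  assumes "open U" "smooth_on U \<rho>" "p \<in> U"
  defines "D v w \<equiv> dir_deriv v (dir_deriv w \<rho>) p"
  shows "wirtinger i (wirtinger_bar j (\<lambda>x. complex_of_real (\<rho> x))) p =
    (complex_of_real (D (axis i 1) (axis j 1) + D (axis i \<i>) (axis j \<i>))
      + \<i> * complex_of_real (D (axis i 1) (axis j \<i>) - D (axis i \<i>) (axis j 1))) / 4"
proof -
  note fd = frechet_derivative_of_real[OF assms(2)]
  define g where "g x = (complex_of_real (dir_deriv (axis j 1) \<rho> x) + \<i> * complex_of_real (dir_deriv (axis j \<i>) \<rho> x)) / 2" for x
  have "(dir_deriv v \<rho> has_derivative frechet_derivative (dir_deriv v \<rho>) (at p)) (at p)" for v
    by (rule smooth_on_has_derivative[OF smooth_on_dir_deriv[OF assms(2)] assms(3)])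
  note dd = bounded_linear.has_derivative[OF bounded_linear_of_real[where ?'a = complex] this]
  have g: "(g has_derivative (\<lambda>w. (complex_of_real (D w (axis j 1)) + \<i> * complex_of_real (D w (axis j \<i>))) / 2)) (at p)"
    unfolding g_def[abs_def] D_def dir_deriv_def[of _ "dir_deriv _ \<rho>"]
    by (intro bounded_linear.has_derivative[OF bounded_linear_divide] has_derivative_add has_derivative_mult_right dd)
  have "(wirtinger_bar j (\<lambda>x. complex_of_real (\<rho> x)) has_derivative
      (\<lambda>w. (complex_of_real (D w (axis j 1)) + \<i> * complex_of_real (D w (axis j \<i>))) / 2)) (at p)"
    by (rule has_derivative_transform_within_open[OF g assms(1,3)]) (simp add: wirtinger_bar_def fd g_def)
  from frechet_derivative_at[OF this, symmetric] show ?thesis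
    unfolding wirtinger_def by (simp add: field_simps)
qed

text \<open>A consequence of the symmetry of the real second derivatives.\<close>

lemma levi_form_hermitian:
  fixes \<rho> :: "complex^'n \<Rightarrow> real"
  assumes "open U" "smooth_on U \<rho>" "p \<in> U"
  shows "hermitian_form (levi_form \<rho> p)"
proof -
  let ?c = "\<lambda>i j. wirtinger i (wirtinger_bar j (\<lambda>x. complex_of_real (\<rho> x))) p"
  have c: "?c j i = cnj (?c i j)" for i j
    unfolding levi_coefficient[OF assms]
      dir_deriv_commute[OF assms, of "axis j 1" "axis i 1"] dir_deriv_commute[OF assms, of "axis j \<i>" "axis i \<i>"]
      dir_deriv_commute[OF assms, of "axis j 1" "axis i \<i>"] dir_deriv_commute[OF assms, of "axis j \<i>" "axis i 1"]
    by (simp add: complex_eq_iff)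
  have "levi_form \<rho> p z x = cnj (levi_form \<rho> p x z)" for x z
  proof -
    have "cnj (levi_form \<rho> p x z) = (\<Sum>i\<in>UNIV. \<Sum>j\<in>UNIV. ?c j i * cnj (x $ i) * z $ j)"
      unfolding levi_form_def by (simp only: cnj_sum complex_cnj_mult complex_cnj_cnj c[symmetric])
    also have "\<dots> = levi_form \<rho> p z x"
      unfolding levi_form_def by (subst sum.swap) (simp add: mult_ac)
    finally show ?thesis ..
  qed
  moreover have "levi_form \<rho> p (x + y) z = levi_form \<rho> p x z + levi_form \<rho> p y z" for x y z
    by (simp add: levi_form_def sum.distrib algebra_simps)
  moreover have "levi_form \<rho> p (a *s x) z = a * levi_form \<rho> p x z" for a x z
    by (simp add: levi_form_def sum_distrib_left mult_ac)
  ultimately show ?thesis unfolding hermitian_form_def by blast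
qed

lemma dir_deriv_complex_expand:
  fixes f :: "complex^'n \<Rightarrow> real"
  assumes "smooth_on S f" "y \<in> S"
  shows "dir_deriv v f y = (\<Sum>i\<in>UNIV. Re (v $ i) * dir_deriv (axis i 1) f y + Im (v $ i) * dir_deriv (axis i \<i>) f y)"
proof -
  have lin: "linear (frechet_derivative f (at y))"
    by (rule linear_frechet_derivative[OF smooth_on_differentiable[OF assms]])
  have "(\<Sum>i\<in>UNIV. Re (v $ i) *\<^sub>R axis i 1 + Im (v $ i) *\<^sub>R axis i \<i>) $ j = (\<Sum>i\<in>UNIV. if i = j then v $ i else 0)" for j
    unfolding sum_component by (intro sum.cong refl) (auto simp: axis_def complex_eq_iff)
  then have "v = (\<Sum>i\<in>UNIV. Re (v $ i) *\<^sub>R axis i 1 + Im (v $ i) *\<^sub>R axis i \<i>)"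
    by (simp add: vec_eq_iff del: sum_component)
  then have "frechet_derivative f (at y) v = frechet_derivative f (at y) (\<Sum>i\<in>UNIV. Re (v $ i) *\<^sub>R axis i 1 + Im (v $ i) *\<^sub>R axis i \<i>)"
    by (rule arg_cong)
  also have "\<dots> = (\<Sum>i\<in>UNIV. Re (v $ i) * frechet_derivative f (at y) (axis i 1) + Im (v $ i) * frechet_derivative f (at y) (axis i \<i>))"
    by (simp add: linear_sum[OF lin] linear_add[OF lin] linear_scale[OF lin])
  finally show ?thesis by (simp add: dir_deriv_def)
qed

lemma dir_deriv_wirtinger:
  fixes \<rho> :: "complex^'n \<Rightarrow> real"
  assumes "smooth_on U \<rho>" "p \<in> U"
  shows "dir_deriv v \<rho> p = 2 * Re (\<Sum>i\<in>UNIV. wirtinger i (\<lambda>x. complex_of_real (\<rho> x)) p * v $ i)"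
  unfolding dir_deriv_complex_expand[OF assms, of v] wirtinger_def frechet_derivative_of_real[OF assms]
    Re_sum sum_distrib_left
  by (intro sum.cong refl) (simp add: field_simps)

text \<open>Up to the factor 1/2, the Levi form is the part of the real Hessian that is invariant under
  multiplication by \<open>\<i>\<close>.\<close>

lemma levi_form_diag:
  fixes \<rho> :: "complex^'n \<Rightarrow> real"
  assumes "open U" "smooth_on U \<rho>" "p \<in> U"
  defines "D v w \<equiv> dir_deriv v (dir_deriv w \<rho>) p"
  shows "4 * Re (levi_form \<rho> p v v) = D v v + D (\<i> *s v) (\<i> *s v)"
proof -
  have left: "D v w = (\<Sum>i\<in>UNIV. Re (v $ i) * D (axis i 1) w + Im (v $ i) * D (axis i \<i>) w)" for v w
    unfolding D_def by (rule dir_deriv_complex_expand[OF smooth_on_dir_deriv[OF assms(2)] assms(3)])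
  have sym: "D v w = D w v" for v w unfolding D_def by (rule dir_deriv_commute[OF assms(1-3)])
  have right: "D w v = (\<Sum>j\<in>UNIV. Re (v $ j) * D w (axis j 1) + Im (v $ j) * D w (axis j \<i>))" for v w
    unfolding sym[of w] by (rule left)
  have D: "D v v = (\<Sum>i\<in>UNIV. \<Sum>j\<in>UNIV.
       Re (v $ i) * (Re (v $ j) * D (axis i 1) (axis j 1) + Im (v $ j) * D (axis i 1) (axis j \<i>))
     + Im (v $ i) * (Re (v $ j) * D (axis i \<i>) (axis j 1) + Im (v $ j) * D (axis i \<i>) (axis j \<i>)))" for v
    by (subst left, subst (1 2) right) (simp add: sum_distrib_left sum.distrib distrib_left)
  show ?thesis
    unfolding D levi_form_def levi_coefficient[OF assms(1-3), folded D_def] Re_sum sum_distrib_left sum.distrib[symmetric]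
    by (intro sum.cong refl) (simp add: field_simps)
qed

text \<open>The Taylor polynomial sorted by bidegree. That its part of type (1,1) is the Levi form is seen by
  replacing \<open>y\<close> by \<open>\<i>y\<close>: the part of type (2,0) changes sign, that of type (1,1) does not.\<close>

lemma taylor_bidegree:
  fixes \<rho> :: "complex^'n \<Rightarrow> real"
  assumes "open U" "smooth_on U \<rho>" "p \<in> U" "\<rho> p = 0"
  obtains \<alpha> A B where "bihom 2 0 \<alpha>" "bihom 3 0 A" "bihom 2 1 B"
    "vanishing 4 (\<lambda>y. \<rho> (p + y) - (2 * Re (\<Sum>i\<in>UNIV. wirtinger i (\<lambda>x. complex_of_real (\<rho> x)) p * y $ i)
        + (2 * Re (\<alpha> y) + Re (levi_form \<rho> p y y)) + 2 * Re (A y) + 2 * Re (B y)))"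
proof -
  define D where "D v w = dir_deriv v (dir_deriv w \<rho>) p" for v w
  have "\<exists>c. bihom 1 0 c \<and> (\<forall>y. y \<bullet> b = 2 * Re (c y))" for b :: "complex^'n"
    by (rule inner_eq_Re[of b]) blast
  then have "\<forall>b::complex^'n. \<exists>c. bihom 1 0 c \<and> (\<forall>y. y \<bullet> b = 2 * Re (c y))" by blast
  from choice[OF this] obtain c where c: "\<And>b::complex^'n. bihom 1 0 (c b)" "\<And>b y. y \<bullet> b = 2 * Re (c b y)"
    by blast
  obtain \<alpha> h where \<alpha>: "bihom 2 0 \<alpha>" and h: "bihom 1 1 h" and 2:
    "\<And>y. (\<Sum>b\<in>Basis. \<Sum>b'\<in>Basis. (2 * Re (c b y)) * (2 * Re (c b' y)) * (D b' b / 2)) = 2 * Re (\<alpha> y) + Re (h y)"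
    by (rule quadratic_bidegree[OF c(1) c(1), where K = "\<lambda>b b'. D b' b / 2"]) (rule that)
  obtain A B where A: "bihom 3 0 A" and B: "bihom 2 1 B" and 3:
    "\<And>y. (\<Sum>b\<in>Basis. \<Sum>b'\<in>Basis. \<Sum>b''\<in>Basis. (2 * Re (c b y)) * (2 * Re (c b' y)) * (2 * Re (c b'' y))
        * (dir_deriv b'' (dir_deriv b' (dir_deriv b \<rho>)) p / 6)) = 2 * Re (A y) + 2 * Re (B y)"
    by (rule cubic_bidegree[OF c(1) c(1) c(1),
          where K = "\<lambda>b b' b''. dir_deriv b'' (dir_deriv b' (dir_deriv b \<rho>)) p / 6"]) (rule that)
  have D2: "(\<Sum>b\<in>Basis. \<Sum>b'\<in>Basis. (y \<bullet> b) * (y \<bullet> b') * D b' b) = D y y" for y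
  proof -
    have "D y y = (\<Sum>b'\<in>Basis. (y \<bullet> b') * D b' y)"
      unfolding D_def by (rule dir_deriv_expand[OF smooth_on_dir_deriv[OF assms(2)] assms(3)])
    also have "\<dots> = (\<Sum>b'\<in>Basis. (y \<bullet> b') * D y b')"
      unfolding D_def using dir_deriv_commute[OF assms(1-3)] by simp
    also have "\<dots> = (\<Sum>b\<in>Basis. (y \<bullet> b) * (\<Sum>b'\<in>Basis. (y \<bullet> b') * D b' b))"
      unfolding D_def by (subst dir_deriv_expand[OF smooth_on_dir_deriv[OF assms(2)] assms(3), of y]) simp
    finally show ?thesis by (simp add: sum_distrib_left mult_ac)
  qed
  have quad: "D y y / 2 = 2 * Re (\<alpha> y) + Re (h y)" for y
    unfolding D2[symmetric] 2[symmetric] c(2) by (simp add: sum_divide_distrib)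
  have "Re (h y) = Re (levi_form \<rho> p y y)" for y
  proof -
    have "\<alpha> (\<i> *s y) = - \<alpha> y" "h (\<i> *s y) = h y"
      using bihom_homogeneous[OF \<alpha>, of \<i> y] bihom_homogeneous[OF h, of \<i> y] by simp_all
    then have "D (\<i> *s y) (\<i> *s y) / 2 = - 2 * Re (\<alpha> y) + Re (h y)" using quad[of "\<i> *s y"] by simp
    with quad[of y] have "D y y + D (\<i> *s y) (\<i> *s y) = 4 * Re (h y)" by simp
    then show ?thesis using levi_form_diag[OF assms(1-3), of y] by (simp add: D_def)
  qed
  note quad' = quad[unfolded this]
  have lin: "(\<Sum>b\<in>Basis. (y \<bullet> b) * dir_deriv b \<rho> p)
    = 2 * Re (\<Sum>i\<in>UNIV. wirtinger i (\<lambda>x. complex_of_real (\<rho> x)) p * y $ i)" for y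
    using dir_deriv_expand[OF assms(2,3), of y] dir_deriv_wirtinger[OF assms(2,3), of y] by simp
  note taylor_third_order[OF assms(1-3)]
  moreover have "(\<Sum>b\<in>Basis. \<Sum>c\<in>Basis. (x \<bullet> b) * (x \<bullet> c) * dir_deriv c (dir_deriv b \<rho>) p) / 2
     = 2 * Re (\<alpha> x) + Re (levi_form \<rho> p x x)" for x
    unfolding quad'[symmetric] D2[symmetric] by (simp add: D_def)
  moreover have "(\<Sum>b\<in>Basis. \<Sum>c\<in>Basis. \<Sum>d\<in>Basis.
           (x \<bullet> b) * (x \<bullet> c) * (x \<bullet> d) * dir_deriv d (dir_deriv c (dir_deriv b \<rho>)) p) / 6
     = 2 * Re (A x) + 2 * Re (B x)" for x
    unfolding 3[symmetric] c(2) by (simp add: sum_divide_distrib)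
  ultimately have "vanishing 4 (\<lambda>y. \<rho> (p + y) - (2 * Re (\<Sum>i\<in>UNIV. wirtinger i (\<lambda>x. complex_of_real (\<rho> x)) p * y $ i)
        + (2 * Re (\<alpha> y) + Re (levi_form \<rho> p y y)) + 2 * Re (A y) + 2 * Re (B y)))"
    unfolding lin assms(4) by (simp add: add.assoc)
  with \<alpha> A B show ?thesis by (rule that)
qed

section \<open>The normal form\<close>

lemma sum_coordinate_splitting:
  fixes g :: "'n::finite \<Rightarrow> complex"
  assumes "k \<notin> J\<^sub>2" "k \<notin> J\<^sub>3" "J\<^sub>2 \<inter> J\<^sub>3 = {}" "insert k (J\<^sub>2 \<union> J\<^sub>3) = UNIV"
  shows "sum g UNIV = g k + sum g J\<^sub>2 + sum g J\<^sub>3"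
proof -
  have "sum g (insert k (J\<^sub>2 \<union> J\<^sub>3)) = g k + sum g J\<^sub>2 + sum g J\<^sub>3"
    using assms(1-3) by (simp add: sum.union_disjoint add.assoc)
  then show ?thesis unfolding assms(4) .
qed

text \<open>The monomials with one factor from \<open>z\<^sub>2\<close> and one from \<open>z\<^sub>3\<close> occur in both orders, so their
  coefficients are added up in \<open>b\<close>.\<close>

lemma phi21_representation:
  fixes R :: "'n::finite \<Rightarrow> complex^'n \<Rightarrow> complex"
  assumes R: "\<And>l. bihom 2 0 (R l)"
    and part: "k \<notin> J\<^sub>2" "k \<notin> J\<^sub>3" "J\<^sub>2 \<inter> J\<^sub>3 = {}" "insert k (J\<^sub>2 \<union> J\<^sub>3) = (UNIV :: 'n set)"
  obtains a b c where "\<And>z. z $ k = 0 \<Longrightarrow> (\<Sum>l\<in>J\<^sub>3. cnj (z $ l) * R l z) = phi21 J\<^sub>2 J\<^sub>3 a b c z"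
proof -
  have "\<exists>r. \<forall>x. R l x = (\<Sum>i\<in>UNIV. \<Sum>j\<in>UNIV. r i j * x $ i * x $ j)" for l
    by (rule bihom_quadratic_coeffs[OF R[of l]]) blast
  then have "\<forall>l. \<exists>r. \<forall>x. R l x = (\<Sum>i\<in>UNIV. \<Sum>j\<in>UNIV. r i j * x $ i * x $ j)" by blast
  from choice[OF this] obtain r
    where r: "\<And>l x. R l x = (\<Sum>i\<in>UNIV. \<Sum>j\<in>UNIV. r l i j * x $ i * x $ j)" by blast
  define g where "g z l i j = r l i j * z $ i * z $ j * cnj (z $ l)" for z l i j
  have swap: "(\<Sum>l\<in>J\<^sub>3. \<Sum>i\<in>I. \<Sum>j\<in>J. g z l i j) = (\<Sum>i\<in>I. \<Sum>j\<in>J. \<Sum>l\<in>J\<^sub>3. g z l i j)" for z I J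
    by (subst sum.swap) (intro sum.cong refl sum.swap)
  show ?thesis
  proof (rule that[of "\<lambda>j1 j2 j3. r j3 j1 j2" "\<lambda>j1 j2 j3. r j3 j1 j2 + r j3 j2 j1" "\<lambda>j1 j2 j3. r j3 j1 j2"])
    fix z :: "complex^'n" assume z: "z $ k = 0"
    have "(\<Sum>l\<in>J\<^sub>3. cnj (z $ l) * R l z) = (\<Sum>l\<in>J\<^sub>3. \<Sum>i\<in>UNIV. \<Sum>j\<in>UNIV. g z l i j)"
      unfolding r g_def by (simp add: sum_distrib_left mult_ac)
    also have "\<dots> = (\<Sum>l\<in>J\<^sub>3. (\<Sum>i\<in>J\<^sub>2. \<Sum>j\<in>J\<^sub>2. g z l i j) + (\<Sum>i\<in>J\<^sub>2. \<Sum>j\<in>J\<^sub>3. g z l i j)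
        + ((\<Sum>i\<in>J\<^sub>3. \<Sum>j\<in>J\<^sub>2. g z l i j) + (\<Sum>i\<in>J\<^sub>3. \<Sum>j\<in>J\<^sub>3. g z l i j)))"
      unfolding sum_coordinate_splitting[OF part] using z by (simp add: g_def sum.distrib)
    also have "\<dots> = (\<Sum>i\<in>J\<^sub>2. \<Sum>j\<in>J\<^sub>2. \<Sum>l\<in>J\<^sub>3. g z l i j) + (\<Sum>i\<in>J\<^sub>2. \<Sum>j\<in>J\<^sub>3. \<Sum>l\<in>J\<^sub>3. g z l i j)
        + ((\<Sum>i\<in>J\<^sub>3. \<Sum>j\<in>J\<^sub>2. \<Sum>l\<in>J\<^sub>3. g z l i j) + (\<Sum>i\<in>J\<^sub>3. \<Sum>j\<in>J\<^sub>3. \<Sum>l\<in>J\<^sub>3. g z l i j))"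
      unfolding sum.distrib swap ..
    also have "(\<Sum>i\<in>J\<^sub>3. \<Sum>j\<in>J\<^sub>2. \<Sum>l\<in>J\<^sub>3. g z l i j) = (\<Sum>i\<in>J\<^sub>2. \<Sum>j\<in>J\<^sub>3. \<Sum>l\<in>J\<^sub>3. g z l j i)"
      by (rule sum.swap)
    finally show "(\<Sum>l\<in>J\<^sub>3. cnj (z $ l) * R l z)
      = phi21 J\<^sub>2 J\<^sub>3 (\<lambda>j1 j2 j3. r j3 j1 j2) (\<lambda>j1 j2 j3. r j3 j1 j2 + r j3 j2 j1) (\<lambda>j1 j2 j3. r j3 j1 j2) z"
      unfolding phi21_def g_def by (simp add: sum.distrib distrib_right distrib_left mult_ac)
  qed
qed

theorem proposition3p6:
  fixes M :: "(complex^'n) set" and p :: "complex^'n" and q :: nat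
  assumes "smooth_real_hypersurface M" and "p \<in> M" and "has_levi_rank M p q"
  shows "\<exists>(k::'n) J\<^sub>2 J\<^sub>3 V Z A (\<phi> :: (complex^'n) \<times> real \<Rightarrow> real)
           (s :: 'n \<Rightarrow> real) (\<epsilon> :: 'n \<Rightarrow> real) a b c.
    coordinate_splitting q k J\<^sub>2 J\<^sub>3 \<and>
    holomorphic_coordinates_at p V Z \<and>
    open A \<and> smooth_on A \<phi> \<and>
    (\<forall>x\<in>V. (z_part k (Z x), u_part k (Z x)) \<in> A \<and>
       (x \<in> M \<longleftrightarrow>
          Z x $ k + cnj (Z x $ k) = complex_of_real (\<phi> (z_part k (Z x), u_part k (Z x))))) \<and>
    (\<forall>j\<in>J\<^sub>2. s j \<in> {-1, 1}) \<and> (\<forall>j\<in>J\<^sub>3. \<epsilon> j \<in> {-1, 0, 1}) \<and>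
    (\<lambda>(z, u). \<phi> (z, u) -
        (phi2 J\<^sub>2 s z + (2 * Re (phi21 J\<^sub>2 J\<^sub>3 a b c z) + phi111 J\<^sub>3 \<epsilon> z u)))
      \<in> O[at (0, 0)](\<lambda>x. norm x ^ 4)"
proof -
  obtain U \<rho> where ldf: "local_defining_function M p U \<rho>"
    and rank: "form_rank (holomorphic_tangent_space \<rho> p) (levi_form \<rho> p) = q"
    using assms(3) by (auto simp: has_levi_rank_def)
  then have U: "open U" "smooth_on U \<rho>" "p \<in> U" and \<rho>0: "\<rho> p = 0"
    and d\<rho>: "frechet_derivative \<rho> (at p) \<noteq> (\<lambda>v. 0)"
    using assms(2) by (auto simp: local_defining_function_def)
  define l where "l i = wirtinger i (\<lambda>x. complex_of_real (\<rho> x)) p" for i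
  have "\<exists>i0. l i0 \<noteq> 0"
  proof (rule ccontr)
    assume "\<not> (\<exists>i0. l i0 \<noteq> 0)"
    then have "frechet_derivative \<rho> (at p) v = 0" for v
      using dir_deriv_wirtinger[OF U(2,3), of v] by (simp add: dir_deriv_def l_def)
    with d\<rho> show False by blast
  qed
  then obtain i0 where i0: "l i0 \<noteq> 0" by blast
  have rank': "form_rank {v. (\<Sum>i\<in>UNIV. l i * v $ i) = 0} (levi_form \<rho> p) = q"
    using rank by (simp add: holomorphic_tangent_space_def l_def)
  obtain k :: 'n and J2 J3 b s lam where split: "coordinate_splitting q k J2 J3"
    and s: "\<And>j. j \<in> J2 \<Longrightarrow> s j \<in> {-1, 1}" and T_inj: "\<And>x. lin_map b x = 0 \<Longrightarrow> x = 0"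
    and T_l: "\<And>x. (\<Sum>i\<in>UNIV. l i * lin_map b x $ i) = x $ k" and lam: "bihom 1 0 lam"
    and T_levi: "\<And>x. Re (levi_form \<rho> p (lin_map b x) (lin_map b x)) = phi2 J2 s x + 2 * Re (x $ k * cnj (lam x))"
    by (rule adapted_linear_coordinates[OF levi_form_hermitian[OF U] i0 rank']) (rule that)
  have part: "k \<notin> J2" "k \<notin> J3" "J2 \<inter> J3 = {}" "insert k (J2 \<union> J3) = UNIV"
    using split by (auto simp: coordinate_splitting_def)
  have J3c: "insert k J2 = - J3" using part by auto
  obtain \<alpha> A B where hps: "bihom 2 0 \<alpha>" "bihom 3 0 A" "bihom 2 1 B"
    and taylor: "vanishing 4 (\<lambda>y. \<rho> (p + y) - (2 * Re (\<Sum>i\<in>UNIV. l i * y $ i)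
        + (2 * Re (\<alpha> y) + Re (levi_form \<rho> p y y)) + 2 * Re (A y) + 2 * Re (B y)))"
    by (rule taylor_bidegree[OF U \<rho>0, folded l_def]) (rule that)
  have v1: "vanishing 4 (\<lambda>x. \<rho> (p + lin_map b x) - (2 * Re (x $ k)
        + (2 * Re (\<alpha> (lin_map b x)) + phi2 J2 s x + 2 * Re (x $ k * cnj (lam x)))
        + 2 * Re (A (lin_map b x)) + 2 * Re (B (lin_map b x))))"
    using vanishing_compose[OF taylor vanishing_bounded_linear[OF bounded_linear_lin_map[of b]]]
    unfolding T_l T_levi by (simp add: add.assoc)
  note hpT = bihom_compose[OF bihom_lin_map[of b] hps(1)] bihom_compose[OF bihom_lin_map[of b] hps(2)]
    bihom_compose[OF bihom_lin_map[of b] hps(3)]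
  obtain a m P \<kappa> K where
    a: "\<And>i. \<exists>a2 a3. bihom 2 0 a2 \<and> bihom 3 0 a3 \<and> (\<forall>x. a x $ i = a2 x + a3 x)"
    and m: "(m \<longlongrightarrow> 1) (nhds 0)" and P: "\<And>l. bihom 2 0 (P l)" and \<kappa>: "\<And>j l. \<kappa> l j = cnj (\<kappa> j l)"
    and K: "\<And>x. complex_of_real (K x) = (\<Sum>j\<in>J3. \<Sum>l\<in>J3. \<kappa> j l * x $ j * cnj (x $ l))"
    and v2: "vanishing 4 (\<lambda>x. 2 * Re (x $ k) + (2 * Re (\<alpha> (lin_map b x)) + phi2 J2 s x + 2 * Re (x $ k * cnj (lam x)))
        + 2 * Re (A (lin_map b x)) + 2 * Re (B (lin_map b x)) - m x * model_function k J2 J3 s P K (x + a x))"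
    by (rule cubic_normal_form[OF part(1) J3c s hpT lam]) (assumption, rule that)
  let ?N = "model_function k J2 J3 s P K"
  have v3: "vanishing 4 (\<lambda>x. \<rho> (p + lin_map b x) - m x * ?N (x + a x))"
    using vanishing_add[OF v1 v2] by (simp add: algebra_simps)
  obtain F where F: "smooth_holomorphic F" "vanishing 2 (\<lambda>x. F x - x)" "vanishing 4 (\<lambda>x. F x + a (F x) - x)"
    by (rule truncated_inverse[OF a]) (rule that)
  obtain b' \<epsilon> where \<epsilon>: "\<And>j. j \<in> J3 \<Longrightarrow> \<epsilon> j \<in> {-1, 0, 1}" and b'0: "\<And>j i. j \<in> J3 \<Longrightarrow> i \<notin> J3 \<Longrightarrow> b' j $ i = 0"
    and b'1: "\<And>j. j \<notin> J3 \<Longrightarrow> b' j = axis j 1" and S_nth: "\<And>x i. i \<notin> J3 \<Longrightarrow> lin_map b' x $ i = x $ i"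
    and S_inj: "\<And>x. lin_map b' x = 0 \<Longrightarrow> x = 0"
    and S_form: "\<And>x. (\<Sum>j\<in>J3. \<Sum>l\<in>J3. \<kappa> j l * lin_map b' x $ j * cnj (lin_map b' x $ l))
        = complex_of_real (\<Sum>j\<in>J3. \<epsilon> j * (cmod (x $ j))\<^sup>2)"
    by (rule diagonalize_block[of \<kappa> J3, OF \<kappa>]) (rule that)
  let ?S = "lin_map b'"
  \<comment> \<open>from the final coordinates back to the linear coordinates of the first step\<close>
  define h where "h \<zeta> = F (?S \<zeta>)" for \<zeta>
  define \<Phi> where "\<Phi> \<zeta> = p + lin_map b (h \<zeta>)" for \<zeta>
  have v_S: "vanishing 1 ?S" by (rule vanishing_bounded_linear[OF bounded_linear_lin_map])
  have "vanishing 1 (\<lambda>x. (F x - x) + x)"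
    by (rule vanishing_add[OF vanishing_mono[OF F(2)] vanishing_id]) simp
  then have "vanishing 1 F" by simp
  from vanishing_compose[OF this v_S] have v_h: "vanishing 1 h" by (simp add: h_def[abs_def])
  have F0: "F 0 = 0" using vanishing_at_zero[OF F(2)] by simp
  have S0: "?S 0 = 0" by (simp add: lin_map_def)
  have \<Phi>0: "\<Phi> 0 = p" by (simp add: \<Phi>_def h_def S0 F0 lin_map_def)
  have \<Phi>_hol: "smooth_holomorphic \<Phi>"
    unfolding \<Phi>_def[abs_def] h_def
    using smooth_holomorphic_compose[OF smooth_holomorphic_lin_map[of p b]
        smooth_holomorphic_compose[OF F(1) smooth_holomorphic_lin_map[of 0 b']]] by simp
  have "(\<Phi> has_derivative (\<lambda>v. lin_map b (?S v))) (at 0)"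
  proof -
    have dS: "(?S has_derivative ?S) (at 0)" and dT: "(lin_map b has_derivative lin_map b) (at (h 0))"
      by (intro bounded_linear_imp_has_derivative bounded_linear_lin_map)+
    have "(F has_derivative (\<lambda>x. x)) (at (?S 0))" using vanishing_2_derivative[OF F(2)] by (simp add: S0)
    from diff_chain_at[OF dS this] have "(h has_derivative ?S) (at 0)" by (simp add: h_def[abs_def] o_def)
    from diff_chain_at[OF this dT] have "((\<lambda>\<zeta>. p + lin_map b (h \<zeta>)) has_derivative (\<lambda>v. 0 + lin_map b (?S v))) (at 0)"
      by (intro has_derivative_add has_derivative_const) (simp add: o_def)
    then show ?thesis by (simp add: \<Phi>_def[abs_def])
  qed
  from frechet_derivative_at[OF this] have d\<Phi>: "frechet_derivative \<Phi> (at 0) = (\<lambda>v. lin_map b (?S v))" by simp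
  have \<Phi>_inj: "inj (frechet_derivative \<Phi> (at 0))"
    unfolding d\<Phi>
  proof (rule injI)
    fix x y assume "lin_map b (?S x) = lin_map b (?S y)"
    moreover have "lin_map b (?S (x - y)) + lin_map b (?S y) = lin_map b (?S x)"
      by (simp add: lin_map_add[symmetric])
    ultimately have "lin_map b (?S (x - y)) = 0" by simp
    then have "x - y = 0" using T_inj S_inj by blast
    then show "x = y" by simp
  qed
  have v4: "vanishing 4 (\<lambda>\<zeta>. \<rho> (\<Phi> \<zeta>) - m (h \<zeta>) * ?N (h \<zeta> + a (h \<zeta>)))"
    using vanishing_compose[OF v3 v_h] by (simp add: \<Phi>_def)
  have mh: "((\<lambda>\<zeta>. m (h \<zeta>)) \<longlongrightarrow> 1) (nhds 0)"
    by (rule filterlim_compose[OF m]) (use vanishing_tendsto[OF v_h] in simp)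
  have v_e: "vanishing 4 (\<lambda>\<zeta>. h \<zeta> + a (h \<zeta>) - ?S \<zeta>)"
    using vanishing_compose[OF F(3) v_S] by (simp add: h_def)
  have "vanishing 4 (\<lambda>\<zeta>. m (h \<zeta>) * (?N (h \<zeta> + a (h \<zeta>)) - ?N (?S \<zeta>)))"
    using vanishing_mult[OF tendsto_imp_vanishing_0[OF mh] model_function_perturb[OF P K v_S v_e]] by simp
  from vanishing_add[OF v4 this] have v5: "vanishing 4 (\<lambda>\<zeta>. \<rho> (\<Phi> \<zeta>) - m (h \<zeta>) * ?N (?S \<zeta>))"
    by (simp add: algebra_simps)
  define R where "R j z = (\<Sum>l\<in>J3. cnj (b' j $ l) * (- P l (?S z)))" for j z
  have hR: "bihom 2 0 (R j)" for j
    unfolding R_def[abs_def] by (intro bihom_sum bihom_scale bihom_uminus bihom_compose[OF bihom_lin_map] P)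
  obtain ca cb cc where phi21: "\<And>z. z $ k = 0 \<Longrightarrow> (\<Sum>l\<in>J3. cnj (z $ l) * R l z) = phi21 J2 J3 ca cb cc z"
    by (rule phi21_representation[OF hR part]) (rule that)
  \<comment> \<open>In the equation \<open>2 Re w + h\<^sub>0 + \<dots> = 0\<close> all terms but \<open>2 Re w\<close> change sides,
     hence the opposite signs.\<close>
  define Pol where "Pol y = phi2 J2 (\<lambda>j. - s j) (fst y)
    + (2 * Re (phi21 J2 J3 ca cb cc (fst y)) + phi111 J3 (\<lambda>j. - \<epsilon> j) (fst y) (snd y))" for y
  have z_nth: "z_part k z $ j = z $ j" if "j \<noteq> k" for z j using that by (simp add: z_part_def)
  have nek: "j \<noteq> k" if "j \<in> J2 \<or> j \<in> J3" for j using that part by auto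
  have Pol_z: "Pol (z_part k z, u) = Pol (z, u)" for z u
    unfolding Pol_def phi2_def phi21_def phi111_def by (simp add: z_nth nek cong: sum.cong)
  have v_Pol: "vanishing 2 Pol"
  proof -
    have f: "vanishing 1 (fst :: (complex^'n) \<times> real \<Rightarrow> _)" and g: "vanishing 1 (snd :: (complex^'n) \<times> real \<Rightarrow> _)"
      by (intro vanishing_bounded_linear bounded_linear_fst bounded_linear_snd)+
    have "vanishing 2 (\<lambda>y :: (complex^'n) \<times> real. phi2 J2 (\<lambda>j. - s j) (fst y))"
      using vanishing_compose[OF bihom_vanishing_Re[OF bihom_phi2[of J2 "\<lambda>j. - s j"]] f] by (simp add: numeral_2_eq_2)
    moreover have "vanishing 2 (\<lambda>y :: (complex^'n) \<times> real. Re (phi21 J2 J3 ca cb cc (fst y)))"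
      by (rule vanishing_mono[OF vanishing_compose[OF bihom_vanishing_Re[OF bihom_phi21] f]]) simp
    moreover have "vanishing 2 (\<lambda>y :: (complex^'n) \<times> real. phi111 J3 (\<lambda>j. - \<epsilon> j) (fst y) (snd y))"
    proof -
      have "phi111 J3 (\<lambda>j. - \<epsilon> j) z u = phi2 J3 (\<lambda>j. - \<epsilon> j) z * u" for z :: "complex^'n" and u
        by (simp add: phi111_def phi2_def sum_distrib_right)
      moreover have "vanishing (1 + 1 + 1) (\<lambda>y :: (complex^'n) \<times> real. Re (complex_of_real (phi2 J3 (\<lambda>j. - \<epsilon> j) (fst y))) * snd y)"
        by (rule vanishing_mult[OF vanishing_compose[OF bihom_vanishing_Re[OF bihom_phi2] f] g])
      ultimately show ?thesis by (auto elim: vanishing_mono)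
    qed
    ultimately show ?thesis unfolding Pol_def[abs_def] by (intro vanishing_add vanishing_real_mult)
  qed
  have model: "?N (?S \<zeta>) = 2 * Re (\<zeta> $ k) - Pol (z_part k \<zeta>, u_part k \<zeta>)" for \<zeta>
  proof -
    let ?z = "z_part k \<zeta>"
    have 1: "?S \<zeta> $ k = \<zeta> $ k" by (rule S_nth[OF part(2)])
    have "?S \<zeta> $ j = ?z $ j" if "j \<in> J2" for j
      using that part(1,3) by (subst S_nth) (auto simp: z_part_def)
    then have 2: "phi2 J2 s (?S \<zeta>) = phi2 J2 s ?z"
      unfolding phi2_def by (intro sum.cong refl) simp
    have S3: "?S x $ i = (\<Sum>j\<in>J3. b' j $ i * x $ j)" if "i \<in> J3" for i x
      unfolding lin_map_nth using that b'1 by (intro sum.mono_neutral_right) (auto simp: axis_def)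
    have zS: "z_part k (?S \<zeta>) = ?S ?z"
    proof (unfold vec_eq_iff, intro allI)
      fix i
      show "z_part k (?S \<zeta>) $ i = ?S ?z $ i"
      proof (cases "i \<in> J3")
        case True
        then have "i \<noteq> k" using part(2) by auto
        then show ?thesis unfolding z_nth[OF \<open>i \<noteq> k\<close>] S3[OF True]
          by (intro sum.cong refl) (simp add: z_nth nek)
      next
        case False
        then show ?thesis by (auto simp: z_part_def S_nth)
      qed
    qed
    have "(\<Sum>l\<in>J3. cnj (?S \<zeta> $ l) * P l (z_part k (?S \<zeta>)))
        = (\<Sum>l\<in>J3. \<Sum>j\<in>J3. cnj (\<zeta> $ j) * (cnj (b' j $ l) * P l (?S ?z)))"
      unfolding zS by (intro sum.cong refl) (simp add: S3 sum_distrib_left mult_ac)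
    also have "\<dots> = (\<Sum>j\<in>J3. cnj (\<zeta> $ j) * (\<Sum>l\<in>J3. cnj (b' j $ l) * P l (?S ?z)))"
      unfolding sum_distrib_left by (rule sum.swap)
    also have "\<dots> = - (\<Sum>j\<in>J3. cnj (?z $ j) * R j ?z)"
      unfolding R_def by (simp add: sum_negf z_nth nek cong: sum.cong)
    also have "\<dots> = - phi21 J2 J3 ca cb cc ?z"
      by (subst phi21) (simp_all add: z_part_def)
    finally have 3: "(\<Sum>l\<in>J3. cnj (?S \<zeta> $ l) * P l (z_part k (?S \<zeta>))) = - phi21 J2 J3 ca cb cc ?z" .
    have "complex_of_real (K (?S \<zeta>)) = complex_of_real (\<Sum>j\<in>J3. \<epsilon> j * (cmod (\<zeta> $ j))\<^sup>2)"
      unfolding K S_form ..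
    then have "K (?S \<zeta>) = (\<Sum>j\<in>J3. \<epsilon> j * (cmod (\<zeta> $ j))\<^sup>2)" by (simp only: of_real_eq_iff)
    also have "\<dots> = (\<Sum>j\<in>J3. \<epsilon> j * (cmod (?z $ j))\<^sup>2)" by (intro sum.cong refl) (simp add: z_nth nek)
    finally have 4: "2 * Re (\<i> * \<zeta> $ k) * K (?S \<zeta>) = - phi111 J3 (\<lambda>j. - \<epsilon> j) ?z (u_part k \<zeta>)"
      unfolding u_part_eq phi111_def by (simp add: sum_distrib_left sum_negf[symmetric] mult_ac)
    have 5: "phi2 J2 (\<lambda>j. - s j) ?z = - phi2 J2 s ?z" by (simp add: phi2_def sum_negf)
    show ?thesis
      unfolding model_function_def 1 2 3 4 Pol_def 5 by (simp add: 5)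
  qed
  from hypersurface_graph[OF ldf assms(2) \<Phi>_hol \<Phi>0 \<Phi>_inj Pol_z v_Pol mh v5[unfolded model]]
  obtain V Z D \<phi> where VZ: "holomorphic_coordinates_at p V Z" "open D" "smooth_on D \<phi>"
    "\<forall>x\<in>V. (z_part k (Z x), u_part k (Z x)) \<in> D \<and>
       (x \<in> M \<longleftrightarrow> Z x $ k + cnj (Z x $ k) = complex_of_real (\<phi> (z_part k (Z x), u_part k (Z x))))"
    and bigo: "(\<lambda>y. \<phi> y - Pol y) \<in> O[at (0, 0)](\<lambda>y. norm y ^ 4)"
    by blast
  have "(\<lambda>(z, u). \<phi> (z, u) - (phi2 J2 (\<lambda>j. - s j) z
      + (2 * Re (phi21 J2 J3 ca cb cc z) + phi111 J3 (\<lambda>j. - \<epsilon> j) z u))) \<in> O[at (0, 0)](\<lambda>x. norm x ^ 4)"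
    using bigo by (simp add: case_prod_beta' Pol_def)
  moreover have "\<forall>j\<in>J2. - s j \<in> {-1, 1}" using s by fastforce
  moreover have "\<forall>j\<in>J3. - \<epsilon> j \<in> {-1, 0, 1}" using \<epsilon> by fastforce
  ultimately show ?thesis
    using split VZ
    by (intro exI[of _ k] exI[of _ J2] exI[of _ J3] exI[of _ V] exI[of _ Z] exI[of _ D] exI[of _ \<phi>]
        exI[of _ "\<lambda>j. - s j"] exI[of _ "\<lambda>j. - \<epsilon> j"] exI[of _ ca] exI[of _ cb] exI[of _ cc] conjI)
qed

end
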